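(* Let $\mathcal{H}$ be a nonzero Hilbert space, let $\bm{C}\in\mathcal{B}(\mathcal{H})$ be hypocoercive with hypocoercivity index $m_{\mathrm{HC}}$, and let $E\subset\mathbb{R}\setminus(-1,1)$ be non-empty and countable. For $\eta\in E$ put $\bm{C}_\eta=\eta\,\bm{C}_{\mathrm{S}}+\bm{C}_{\mathrm{H}}$. Let $\mathcal{X}=\oplus_{\eta\in E}\mathcal{H}$ and let $\bm{C}_E$ be the (possibly unbounded) operator on $\mathcal{X}$ given by $$\bm{C}_E (x_\eta)_{\eta\in E}=(\bm{C}_\eta x_\eta)_{\eta\in E},\qquad D(\bm{C}_E)=\Big\{(x_\eta)_{\eta\in E}\in\mathcal{X}\ \Big|\ \sum_{\eta\in E}\|\bm{C}_\eta x_\eta\|^2<\infty\Big\}.$$ Let $(\bm{T}_E(t))_{t\ge0}$ be the strongly continuous semigroup on $\mathcal{X}$ generated by $-\bm{C}_E$. Then the following holds. (a) The operator $\bm{P}_E$ defined by $$\bm{P}_E\,x:=\Big(\sum_{j=0}^{m_{\mathrm{HC}}}\frac{1}{\eta^{2j}}(\bm{C}_\eta^* )^j\bm{C}_\eta^j\,x_\eta\Big)_{\eta\in E},\qquad x=(x_\eta)_{\eta\in E}\in\mathcal{X},$$ is bounded and self-adjoint, $\bm{P}_E\ge\bm{1}_{\mathcal{X}}$, and there exists $\sigma>0$ such that $$\langle-\bm{C}_E\,x,\bm{P}_E\,x\rangle+\langle\bm{P}_E\,x,-\bm{C}_E\,x\rangle\le-\sigma\|x\|^2\qquad\text{for all }x\in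 D(\bm{C}_E).$$ Hence, the semigroup $(\bm{T}_E(t))_{t\ge0}$ is exponentially stable, i.e. there are constants $M,\omega>0$ such that $\|\bm{T}_E(t)\|\le M\mathrm{e}^{-\omega t}$ for all $t\ge0$. (b) There are constants $c_1,c_2,\tau>0$ such that, with $a=2m_{\mathrm{HC}}+1$, $$1-c_1t^a\le\|\bm{T}_E(t)\|^2\le1-c_2t^a,\qquad 0\le t\le\tau.$$
   Context: For a Hilbert space $\mathcal{H}$, $\mathcal{B}(\mathcal{H})$ denotes the bounded linear operators on $\mathcal{H}$ and $\bm{1}_{\mathcal{H}}$ the identity. For $\bm{C}\in\mathcal{B}(\mathcal{H})$, the skew-Hermitian part is $\bm{C}_{\mathrm{S}}=\frac{\bm{C}-\bm{C}^*}{2}$ and the Hermitian part is $\bm{C}_{\mathrm{H}}=\frac{\bm{C}+\bm{C}^*}{2}$. For bounded self-adjoint operators, $\bm{B}_1\ge\bm{B}_2$ means $\langle\bm{B}_1x,x\rangle\ge\langle\bm{B}_2x,x\rangle$ for all $x$. The operator $\bm{C}$ is accretive if $\bm{C}_{\mathrm{H}}\ge0$. An accretive operator $\bm{C}\in\mathcal{B}(\mathcal{H})$ is called hypocoercive if there is an integer $m\ge0$ and $\kappa>0$ such that $\sum_{j=0}^m\bm{C}^j\bm{C}_{\mathrm{H}}(\bm{C}^* )^j\ge\kappa\,\bm{1}_{\mathcal{H}}$. The smallest such $m$ is the hypocoercivity index $m_{\mathrm{HC}}$ of $\bm{C}$. It is known that the condition may be replaced by $\sum_{j=0}^m(\bm{C}_{\mathrm{S}}^*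 )^j\bm{C}_{\mathrm{H}}\bm{C}_{\mathrm{S}}^j\ge\tilde\kappa\,\bm{1}_{\mathcal{H}}$ for some $\tilde\kappa>0$, yielding the same index. $\oplus_{\eta\in E}\mathcal{H}$ is the Hilbert space direct sum (square-summable families). The operator $-\bm{C}_E$ generates a strongly continuous semigroup since it is the sum of a skew-adjoint operator and a bounded self-adjoint operator. *)

theory Defs
  imports "HOL-Analysis.Analysis" "HOL-Library.Complex_Order"
begin

section \<open>Complex Hilbert spaces\<close>

text \<open>
  Norm and topology are those of the underlying real inner product space, whose inner product is
  the real part of \<open>cinner\<close>.  The complex inner product is linear in its first argument.
\<close>

class complex_inner = real_inner +
  fixes scaleC :: "complex \<Rightarrow> 'a \<Rightarrow> 'a"  (infixr \<open>*\<^sub>C\<close> 75)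
    and cinner :: "'a \<Rightarrow> 'a \<Rightarrow> complex"
  assumes scaleC_add_right: "c *\<^sub>C (x + y) = c *\<^sub>C x + c *\<^sub>C y"
    and scaleC_add_left: "(c + d) *\<^sub>C x = c *\<^sub>C x + d *\<^sub>C x"
    and scaleC_scaleC: "c *\<^sub>C d *\<^sub>C x = (c * d) *\<^sub>C x"
    and scaleC_of_real: "complex_of_real r *\<^sub>C x = scaleR r x"
    and cinner_commute: "cinner x y = cnj (cinner y x)"
    and cinner_add_left: "cinner (x + y) z = cinner x z + cinner y z"
    and cinner_scaleC_left: "cinner (c *\<^sub>C x) y = c * cinner x y"
    and inner_eq_Re_cinner: "inner x y = Re (cinner x y)"

class chilbert_space = complex_inner + complete_space

instantiation complex :: chilbert_space
begin
definition scaleC_complex :: "complex \<Rightarrow> complex \<Rightarrow> complex" where "scaleC_complex c x = c * x"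
definition cinner_complex :: "complex \<Rightarrow> complex \<Rightarrow> complex" where "cinner_complex x y = x * cnj y"
instance
  by standard (simp_all add: scaleC_complex_def cinner_complex_def scaleR_conv_of_real inner_complex_def algebra_simps)
end

lemma cinner_self: "cinner x x = complex_of_real ((norm x)\<^sup>2)" for x :: "'a::complex_inner"
proof -
  have "Im (cinner x x) = 0"
    using arg_cong[OF cinner_commute[of x x], of Im] by simp
  moreover have "Re (cinner x x) = (norm x)\<^sup>2"
    by (simp add: inner_eq_Re_cinner[symmetric] power2_norm_eq_inner)
  ultimately show ?thesis by (simp add: complex_eq_iff)
qed

lemma cinner_scaleC_right: "cinner x (c *\<^sub>C y) = cnj c * cinner x y" for x :: "'a::complex_inner"
  by (metis cinner_commute cinner_scaleC_left complex_cnj_cnj complex_cnj_mult)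

lemma cinner_add_right: "cinner x (y + z) = cinner x y + cinner x z" for x :: "'a::complex_inner"
  by (metis cinner_add_left cinner_commute complex_cnj_add)

lemma norm_scaleC: "norm (c *\<^sub>C x) = cmod c * norm x" for x :: "'a::complex_inner"
proof -
  have "complex_of_real ((norm (c *\<^sub>C x))\<^sup>2) = (c * cnj c) * cinner x x"
    unfolding cinner_self[symmetric] cinner_scaleC_left cinner_scaleC_right by (simp only: mult_ac)
  also have "\<dots> = complex_of_real ((cmod c * norm x)\<^sup>2)"
    unfolding cinner_self complex_norm_square[symmetric] by (simp add: power_mult_distrib)
  finally have "(norm (c *\<^sub>C x))\<^sup>2 = (cmod c * norm x)\<^sup>2"
    by (simp only: of_real_eq_iff)
  then show ?thesis by (simp add: power2_eq_iff_nonneg)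
qed

lemma norm_cinner_le: "cmod (cinner x y) \<le> norm x * norm y" for x :: "'a::complex_inner"
proof (cases "cinner x y = 0")
  case False
  define u where "u = cnj (sgn (cinner x y))"
  have u: "cmod u = 1" using False by (simp add: u_def norm_sgn)
  have "cinner (u *\<^sub>C x) y = cnj (sgn (cinner x y)) * cinner x y"
    by (simp add: u_def cinner_scaleC_left)
  also have "\<dots> = (cinner x y * cnj (cinner x y)) / complex_of_real (cmod (cinner x y))"
    by (simp add: sgn_div_norm scaleR_conv_of_real field_simps)
  also have "\<dots> = complex_of_real (cmod (cinner x y))"
    using False unfolding complex_norm_square[symmetric] by (simp add: power2_eq_square)
  finally have "cinner (u *\<^sub>C x) y = complex_of_real (cmod (cinner x y))" .
  then have "cmod (cinner x y) = inner (u *\<^sub>C x) y"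
    by (simp add: inner_eq_Re_cinner)
  also have "\<dots> \<le> norm (u *\<^sub>C x) * norm y" by (rule norm_cauchy_schwarz)
  finally show ?thesis by (simp add: norm_scaleC u)
qed simp


section \<open>Hilbert space direct sums\<close>

definition square_summable_on :: "('i \<Rightarrow> 'h::complex_inner) \<Rightarrow> 'i set \<Rightarrow> bool"
  where "square_summable_on f I \<longleftrightarrow> (\<lambda>i. (norm (f i))\<^sup>2) summable_on I"

typedef (overloaded) ('i, 'h::complex_inner) hsum = "{f :: 'i \<Rightarrow> 'h. square_summable_on f UNIV}"
  morphisms hsum_nth Abs_hsum
  by (rule exI[of _ "\<lambda>_. 0"]) (simp add: square_summable_on_def)

setup_lifting type_definition_hsum

lemma hsum_eqI: "(\<And>i. hsum_nth x i = hsum_nth y i) \<Longrightarrow> x = y"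
  by (metis ext hsum_nth_inject)

lemma square_summable_hsum_nth: "(\<lambda>i. (norm (hsum_nth x i))\<^sup>2) summable_on UNIV"
  using hsum_nth[of x] by (simp add: square_summable_on_def)

lemma square_summable_add:
  fixes f g :: "'i \<Rightarrow> 'h::complex_inner"
  assumes "square_summable_on f I" "square_summable_on g I"
  shows "square_summable_on (\<lambda>i. f i + g i) I"
  unfolding square_summable_on_def
proof (rule summable_on_comparison_test)
  show "(\<lambda>i. 2 * (norm (f i))\<^sup>2 + 2 * (norm (g i))\<^sup>2) summable_on I"
    using assms unfolding square_summable_on_def
    by (intro summable_on_add summable_on_cmult_right)
  fix i
  have "(norm (f i + g i))\<^sup>2 \<le> (norm (f i) + norm (g i))\<^sup>2"
    by (intro power_mono norm_triangle_ineq norm_ge_zero)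
  also have "\<dots> \<le> 2 * (norm (f i))\<^sup>2 + 2 * (norm (g i))\<^sup>2"
    using sum_squares_bound[of "norm (f i)" "norm (g i)"] by (simp add: power2_sum)
  finally show "(norm (f i + g i))\<^sup>2 \<le> 2 * (norm (f i))\<^sup>2 + 2 * (norm (g i))\<^sup>2" .
qed auto

lemma square_summable_scaleC:
  fixes f :: "'i \<Rightarrow> 'h::complex_inner"
  assumes "square_summable_on f I"
  shows "square_summable_on (\<lambda>i. c *\<^sub>C f i) I"
  using assms unfolding square_summable_on_def norm_scaleC power_mult_distrib
  by (rule summable_on_cmult_right)

lemma summable_on_cinner:
  fixes f g :: "'i \<Rightarrow> 'h::complex_inner"
  assumes "square_summable_on f I" "square_summable_on g I"
  shows "(\<lambda>i. cinner (f i) (g i)) summable_on I"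
proof (rule abs_summable_summable, rule summable_on_comparison_test)
  show "(\<lambda>i. (norm (f i))\<^sup>2 + (norm (g i))\<^sup>2) summable_on I"
    using assms unfolding square_summable_on_def by (intro summable_on_add)
  fix i
  have "cmod (cinner (f i) (g i)) \<le> norm (f i) * norm (g i)" by (rule norm_cinner_le)
  also have "\<dots> \<le> (norm (f i))\<^sup>2 + (norm (g i))\<^sup>2"
    using sum_squares_bound[of "norm (f i)" "norm (g i)"]
      mult_nonneg_nonneg[OF norm_ge_zero[of "f i"] norm_ge_zero[of "g i"]] by linarith
  finally show "norm (cinner (f i) (g i)) \<le> (norm (f i))\<^sup>2 + (norm (g i))\<^sup>2" .
qed auto

lemma Re_infsum_cinner_self:
  fixes f :: "'i \<Rightarrow> 'h::complex_inner"
  assumes "square_summable_on f I"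
  shows "Re (\<Sum>\<^sub>\<infinity>i\<in>I. cinner (f i) (f i)) = (\<Sum>\<^sub>\<infinity>i\<in>I. (norm (f i))\<^sup>2)"
  unfolding infsum_Re[OF summable_on_cinner[OF assms assms], symmetric]
  by (simp only: cinner_self Re_complex_of_real)

instantiation hsum :: (type, complex_inner) complex_inner
begin

lift_definition zero_hsum :: "('a, 'b) hsum" is "\<lambda>_. 0"
  by (simp add: square_summable_on_def)
lift_definition plus_hsum :: "('a, 'b) hsum \<Rightarrow> ('a, 'b) hsum \<Rightarrow> ('a, 'b) hsum"
  is "\<lambda>f g i. f i + g i" by (rule square_summable_add)
lift_definition scaleC_hsum :: "complex \<Rightarrow> ('a, 'b) hsum \<Rightarrow> ('a, 'b) hsum"
  is "\<lambda>c f i. c *\<^sub>C f i" by (rule square_summable_scaleC)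
lift_definition uminus_hsum :: "('a, 'b) hsum \<Rightarrow> ('a, 'b) hsum" is "\<lambda>f i. - f i"
  by (simp add: square_summable_on_def)
definition minus_hsum :: "('a, 'b) hsum \<Rightarrow> ('a, 'b) hsum \<Rightarrow> ('a, 'b) hsum"
  where "minus_hsum x y = x + (- y)"
definition scaleR_hsum :: "real \<Rightarrow> ('a, 'b) hsum \<Rightarrow> ('a, 'b) hsum"
  where "scaleR_hsum r x = complex_of_real r *\<^sub>C x"
definition cinner_hsum :: "('a, 'b) hsum \<Rightarrow> ('a, 'b) hsum \<Rightarrow> complex"
  where "cinner_hsum x y = (\<Sum>\<^sub>\<infinity>i. cinner (hsum_nth x i) (hsum_nth y i))"
definition inner_hsum :: "('a, 'b) hsum \<Rightarrow> ('a, 'b) hsum \<Rightarrow> real"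
  where "inner_hsum x y = Re (cinner x y)" for x :: "('a, 'b) hsum"
definition norm_hsum :: "('a, 'b) hsum \<Rightarrow> real"
  where "norm_hsum x = sqrt (inner x x)" for x :: "('a, 'b) hsum"
definition sgn_hsum :: "('a, 'b) hsum \<Rightarrow> ('a, 'b) hsum"
  where "sgn_hsum x = scaleR (inverse (norm x)) x" for x :: "('a, 'b) hsum"
definition dist_hsum :: "('a, 'b) hsum \<Rightarrow> ('a, 'b) hsum \<Rightarrow> real"
  where "dist_hsum x y = norm (x - y)" for x :: "('a, 'b) hsum"
definition uniformity_hsum :: "(('a, 'b) hsum \<times> ('a, 'b) hsum) filter"
  where "uniformity_hsum = (INF e\<in>{0 <..}. principal {(x, y). dist x y < e})"
definition open_hsum :: "('a, 'b) hsum set \<Rightarrow> bool"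
  where "open_hsum U \<longleftrightarrow> (\<forall>x\<in>U. eventually (\<lambda>(x', y). x' = x \<longrightarrow> y \<in> U) uniformity)"

instance
proof
  fix x y z :: "('a, 'b) hsum" and r s :: real and c d :: complex and U :: "('a, 'b) hsum set"
  show "x + y + z = x + (y + z)" "x + y = y + x" "0 + x = x" "- x + x = 0"
    by (transfer, simp add: add_ac)+
  show "x - y = x + - y" by (rule minus_hsum_def)
  have C1: "c *\<^sub>C (x + y) = c *\<^sub>C x + c *\<^sub>C y" "(c + d) *\<^sub>C x = c *\<^sub>C x + d *\<^sub>C x"
      "c *\<^sub>C d *\<^sub>C x = (c * d) *\<^sub>C x" for c d and x y :: "('a, 'b) hsum"
    by (transfer, simp add: scaleC_add_right scaleC_add_left scaleC_scaleC)+
  show "c *\<^sub>C (x + y) = c *\<^sub>C x + c *\<^sub>C y" "(c + d) *\<^sub>C x = c *\<^sub>C x + d *\<^sub>C x"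
      "c *\<^sub>C d *\<^sub>C x = (c * d) *\<^sub>C x"
    by (rule C1)+
  show "complex_of_real r *\<^sub>C x = r *\<^sub>R x" by (simp add: scaleR_hsum_def)
  show "r *\<^sub>R (x + y) = r *\<^sub>R x + r *\<^sub>R y" "(r + s) *\<^sub>R x = r *\<^sub>R x + s *\<^sub>R x"
      "r *\<^sub>R s *\<^sub>R x = (r * s) *\<^sub>R x"
    by (simp_all add: scaleR_hsum_def C1)
  show "1 *\<^sub>R x = x"
    unfolding scaleR_hsum_def by transfer (simp add: scaleC_of_real del: of_real_1)
  show "sgn x = scaleR (inverse (norm x)) x" by (rule sgn_hsum_def)
  show "dist x y = norm (x - y)" by (rule dist_hsum_def)
  show "uniformity = (INF e\<in>{0 <..}. principal {(x, y::('a, 'b) hsum). dist x y < e})"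
    by (rule uniformity_hsum_def)
  show "open U \<longleftrightarrow> (\<forall>x\<in>U. \<forall>\<^sub>F (x', y) in uniformity. x' = x \<longrightarrow> y \<in> U)"
    by (rule open_hsum_def)
  show cc: "cinner x y = cnj (cinner y x)"
    unfolding cinner_hsum_def infsum_cnj[symmetric] by (intro infsum_cong cinner_commute)
  show ca: "cinner (x + y) z = cinner x z + cinner y z"
    unfolding cinner_hsum_def plus_hsum.rep_eq cinner_add_left
    by (intro infsum_add summable_on_cinner) (use hsum_nth in auto)
  have cs: "cinner (c *\<^sub>C x) y = c * cinner x y" for c
    unfolding cinner_hsum_def scaleC_hsum.rep_eq cinner_scaleC_left
    by (rule infsum_cmult_right')
  then show "cinner (c *\<^sub>C x) y = c * cinner x y" .
  show "inner x y = Re (cinner x y)" by (rule inner_hsum_def)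
  show "inner x y = inner y x" unfolding inner_hsum_def by (subst cc) simp
  show "inner (x + y) z = inner x z + inner y z" by (simp add: inner_hsum_def ca)
  show "inner (r *\<^sub>R x) y = r * inner x y"
    by (simp add: inner_hsum_def scaleR_hsum_def cs)
  have self: "inner x x = (\<Sum>\<^sub>\<infinity>i. (norm (hsum_nth x i))\<^sup>2)"
    unfolding inner_hsum_def cinner_hsum_def
    by (rule Re_infsum_cinner_self) (use hsum_nth[of x] in simp)
  show "0 \<le> inner x x" unfolding self by (rule infsum_nonneg) simp
  show "inner x x = 0 \<longleftrightarrow> x = 0"
  proof
    assume "inner x x = 0"
    then have "(norm (hsum_nth x i))\<^sup>2 = 0" for i
      unfolding self
      by (intro nonneg_infsum_le_0D[where A=UNIV]) (auto simp: square_summable_hsum_nth)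
    then show "x = 0" by (intro hsum_eqI) (simp add: zero_hsum.rep_eq)
  next
    assume "x = 0"
    then show "inner x x = 0" unfolding self by (simp add: zero_hsum.rep_eq)
  qed
  show "norm x = sqrt (inner x x)" by (rule norm_hsum_def)
qed

end

lemma hsum_nth_diff [simp]: "hsum_nth (x - y) i = hsum_nth x i - hsum_nth y i"
  unfolding minus_hsum_def plus_hsum.rep_eq uminus_hsum.rep_eq by simp

lemma hsum_nth_scaleR [simp]: "hsum_nth (r *\<^sub>R x) i = r *\<^sub>R hsum_nth x i"
  unfolding scaleR_hsum_def scaleC_hsum.rep_eq by (rule scaleC_of_real)

lemma norm_hsum_square: "(norm x)\<^sup>2 = (\<Sum>\<^sub>\<infinity>i. (norm (hsum_nth x i))\<^sup>2)"
  unfolding power2_norm_eq_inner[of x] inner_hsum_def[of x] cinner_hsum_def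
  by (rule Re_infsum_cinner_self) (use hsum_nth[of x] in simp)

lemma sum_norm_hsum_nth_le:
  assumes "finite F" shows "(\<Sum>i\<in>F. (norm (hsum_nth x i))\<^sup>2) \<le> (norm x)\<^sup>2"
  unfolding norm_hsum_square[of x]
  by (rule finite_sum_le_infsum) (use assms square_summable_hsum_nth in auto)

lemma norm_hsum_nth_le: "norm (hsum_nth x i) \<le> norm x"
proof (rule power2_le_imp_le)
  show "(norm (hsum_nth x i))\<^sup>2 \<le> (norm x)\<^sup>2"
    using sum_norm_hsum_nth_le[of "{i}" x] by simp
qed simp

instance hsum :: (type, chilbert_space) chilbert_space
proof
  fix X :: "nat \<Rightarrow> ('a, 'b) hsum"
  assume X: "Cauchy X"
  have "convergent (\<lambda>n. hsum_nth (X n) i)" for i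
  proof (rule Cauchy_convergent, rule metric_CauchyI)
    fix e :: real assume "0 < e"
    then obtain N where N: "\<forall>m\<ge>N. \<forall>n\<ge>N. dist (X m) (X n) < e"
      using metric_CauchyD[OF X] by blast
    have le: "dist (hsum_nth (X m) i) (hsum_nth (X n) i) \<le> dist (X m) (X n)" for m n
      using norm_hsum_nth_le[of "X m - X n" i] by (simp only: dist_norm hsum_nth_diff)
    show "\<exists>N. \<forall>m\<ge>N. \<forall>n\<ge>N. dist (hsum_nth (X m) i) (hsum_nth (X n) i) < e"
      using N le le_less_trans by blast
  qed
  then obtain g where g: "\<And>i. (\<lambda>n. hsum_nth (X n) i) \<longlonglongrightarrow> g i"
    unfolding convergent_def by metis
  have part: "(\<Sum>i\<in>F. (norm (hsum_nth (X n) i - g i))\<^sup>2) \<le> e\<^sup>2"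
    if N: "\<And>m n. m \<ge> N \<Longrightarrow> n \<ge> N \<Longrightarrow> dist (X m) (X n) < e" and "n \<ge> N" "finite F" for e N n F
  proof (rule tendsto_upperbound)
    show "(\<lambda>m. \<Sum>i\<in>F. (norm (hsum_nth (X n) i - hsum_nth (X m) i))\<^sup>2)
        \<longlonglongrightarrow> (\<Sum>i\<in>F. (norm (hsum_nth (X n) i - g i))\<^sup>2)"
      by (intro tendsto_intros g)
    have "(\<Sum>i\<in>F. (norm (hsum_nth (X n) i - hsum_nth (X m) i))\<^sup>2) \<le> e\<^sup>2" if "m \<ge> N" for m
    proof -
      have "(\<Sum>i\<in>F. (norm (hsum_nth (X n - X m) i))\<^sup>2) \<le> (norm (X n - X m))\<^sup>2"
        by (rule sum_norm_hsum_nth_le) fact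
      also have "\<dots> \<le> e\<^sup>2"
        using N[OF \<open>n \<ge> N\<close> that] by (intro power_mono) (auto simp: dist_norm)
      finally show ?thesis by simp
    qed
    then show "\<forall>\<^sub>F m in sequentially.
        (\<Sum>i\<in>F. (norm (hsum_nth (X n) i - hsum_nth (X m) i))\<^sup>2) \<le> e\<^sup>2"
      by (auto simp: eventually_sequentially)
  qed simp
  have sq: "square_summable_on (\<lambda>i. hsum_nth (X n) i - g i) UNIV"
    if N: "\<And>m n. m \<ge> N \<Longrightarrow> n \<ge> N \<Longrightarrow> dist (X m) (X n) < e" and "n \<ge> N" for e N n
    unfolding square_summable_on_def
  proof (rule nonneg_bdd_above_summable_on)
    show "bdd_above (sum (\<lambda>i. (norm (hsum_nth (X n) i - g i))\<^sup>2) ` {F. F \<subseteq> UNIV \<and> finite F})"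
      by (rule bdd_aboveI2[where M = "e\<^sup>2"]) (rule part[OF N \<open>n \<ge> N\<close>], simp_all)
  qed simp
  obtain N1 where N1: "\<And>m n. m \<ge> N1 \<Longrightarrow> n \<ge> N1 \<Longrightarrow> dist (X m) (X n) < 1"
    using metric_CauchyD[OF X zero_less_one] by blast
  define x where "x = X N1 - Abs_hsum (\<lambda>i. hsum_nth (X N1) i - g i)"
  have x: "hsum_nth x i = g i" for i
    unfolding x_def using sq[OF N1, of N1] by (simp add: Abs_hsum_inverse)
  have "X \<longlonglongrightarrow> x"
  proof (rule metric_LIMSEQ_I)
    fix r :: real assume "r > 0"
    then have "r / 2 > 0" by simp
    then obtain N where N: "\<And>m n. m \<ge> N \<Longrightarrow> n \<ge> N \<Longrightarrow> dist (X m) (X n) < r / 2"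
      using metric_CauchyD[OF X] by blast
    have "dist (X n) x < r" if "n \<ge> N" for n
    proof -
      have "(norm (X n - x))\<^sup>2 \<le> (r / 2)\<^sup>2"
        unfolding norm_hsum_square[of "X n - x"] hsum_nth_diff x
        by (rule infsum_le_finite_sums[OF sq[OF N that, unfolded square_summable_on_def] part[OF N that]])
      then have "norm (X n - x) \<le> r / 2"
        by (rule power2_le_imp_le) (use \<open>r / 2 > 0\<close> in linarith)
      then show ?thesis using \<open>r > 0\<close> by (simp add: dist_norm)
    qed
    then show "\<exists>N. \<forall>n\<ge>N. dist (X n) x < r" by blast
  qed
  then show "convergent X" by (rule convergentI)
qed

text \<open>
  For an index set \<open>I\<close> that is a term rather than a type, the direct sum over \<open>I\<close> is the closed
  subspace of all families supported in \<open>I\<close>.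
\<close>

definition hsum_on :: "'i set \<Rightarrow> ('i, 'h::complex_inner) hsum set"
  where "hsum_on I = {x. \<forall>i. i \<notin> I \<longrightarrow> hsum_nth x i = 0}"

text \<open>
  The family \<open>(f i)\<^sub>i\<^sub>\<in>\<^sub>I\<close> as an element of \<open>hsum_on I\<close>; meaningful only if \<open>square_summable_on f I\<close>.
\<close>

definition hfamily :: "'i set \<Rightarrow> ('i \<Rightarrow> 'h::complex_inner) \<Rightarrow> ('i, 'h) hsum"
  where "hfamily I f = Abs_hsum (\<lambda>i. if i \<in> I then f i else 0)"

lemma hsum_nth_hfamily:
  assumes "square_summable_on f I"
  shows "hsum_nth (hfamily I f) i = (if i \<in> I then f i else 0)"
proof -
  have "(\<lambda>i. (norm (if i \<in> I then f i else 0))\<^sup>2) summable_on UNIV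
      \<longleftrightarrow> (\<lambda>i. (norm (f i))\<^sup>2) summable_on I"
    by (rule summable_on_cong_neutral) auto
  then have "square_summable_on (\<lambda>i. if i \<in> I then f i else 0) UNIV"
    using assms unfolding square_summable_on_def by blast
  then show ?thesis unfolding hfamily_def by (simp add: Abs_hsum_inverse)
qed

lemma hfamily_in_hsum_on: "square_summable_on f I \<Longrightarrow> hfamily I f \<in> hsum_on I"
  by (simp add: hsum_on_def hsum_nth_hfamily)

lemma norm_hfamily:
  assumes "square_summable_on f I"
  shows "(norm (hfamily I f))\<^sup>2 = (\<Sum>\<^sub>\<infinity>i\<in>I. (norm (f i))\<^sup>2)"
  unfolding norm_hsum_square[of "hfamily I f"]
  by (rule infsum_cong_neutral) (auto simp: hsum_nth_hfamily[OF assms])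


section \<open>Operators on a closed subspace\<close>

text \<open>
  An operator on a closed subspace \<open>V\<close> is a function on the ambient type of which only the values
  on \<open>V\<close> matter; \<open>V = UNIV\<close> gives operators on the whole space.
\<close>

definition bounded_clinear_on :: "'a::complex_inner set \<Rightarrow> ('a \<Rightarrow> 'a) \<Rightarrow> bool"
  where "bounded_clinear_on V A \<longleftrightarrow>
    (\<forall>x\<in>V. A x \<in> V) \<and>
    (\<forall>x\<in>V. \<forall>y\<in>V. A (x + y) = A x + A y) \<and>
    (\<forall>c. \<forall>x\<in>V. A (c *\<^sub>C x) = c *\<^sub>C A x) \<and>
    (\<exists>K. \<forall>x\<in>V. norm (A x) \<le> K * norm x)"

definition opnorm_on :: "'a::complex_inner set \<Rightarrow> ('a \<Rightarrow> 'a) \<Rightarrow> real"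
  where "opnorm_on V A = (SUP x\<in>{x \<in> V. norm x \<le> 1}. norm (A x))"

definition adjoint_pair_on :: "'a::complex_inner set \<Rightarrow> ('a \<Rightarrow> 'a) \<Rightarrow> ('a \<Rightarrow> 'a) \<Rightarrow> bool"
  where "adjoint_pair_on V A B \<longleftrightarrow> (\<forall>x\<in>V. \<forall>y\<in>V. cinner (A x) y = cinner x (B y))"

definition bounded_selfadjoint_on :: "'a::complex_inner set \<Rightarrow> ('a \<Rightarrow> 'a) \<Rightarrow> bool"
  where "bounded_selfadjoint_on V A \<longleftrightarrow> bounded_clinear_on V A \<and> adjoint_pair_on V A A"

definition op_le_on :: "'a::complex_inner set \<Rightarrow> ('a \<Rightarrow> 'a) \<Rightarrow> ('a \<Rightarrow> 'a) \<Rightarrow> bool"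
  where "op_le_on V A B \<longleftrightarrow> (\<forall>x\<in>V. cinner (A x) x \<le> cinner (B x) x)"

definition cadjoint :: "('a::complex_inner \<Rightarrow> 'a) \<Rightarrow> 'a \<Rightarrow> 'a"
  where "cadjoint A = (THE B. adjoint_pair_on UNIV A B)"

lemma riesz_real:
  fixes f :: "'a::{real_inner, complete_space} \<Rightarrow> real"
  assumes "bounded_linear f"
  shows "\<exists>y. \<forall>x. f x = inner x y"
proof -
  interpret bounded_linear f by fact
  obtain K where K: "\<And>x. \<bar>f x\<bar> \<le> norm x * K"
    using bounded by (auto simp only: real_norm_def)
  define J where "J y = (norm y)\<^sup>2 - 2 * f y" for y
  have J_ge: "J y \<ge> - K\<^sup>2" for y
  proof -
    have "f y \<le> norm y * K" using K[of y] by linarith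
    moreover have "0 \<le> (norm y - K)\<^sup>2" by simp
    ultimately show ?thesis by (simp add: J_def power2_diff)
  qed
  define I where "I = (INF y. J y)"
  have bdd: "bdd_below (range J)" using J_ge by (intro bdd_belowI2)
  have I_le: "I \<le> J y" for y unfolding I_def using bdd by (intro cINF_lower) auto
  have "\<exists>y. J y < I + 1 / real (Suc n)" for n
    unfolding I_def using cInf_lessD[of "range J" "Inf (range J) + 1 / real (Suc n)"] by auto
  then obtain Y where Y: "\<And>n. J (Y n) < I + 1 / real (Suc n)" by metis
  have dist_le: "(dist a b)\<^sup>2 \<le> 2 * (J a - I) + 2 * (J b - I)" for a b
  proof -
    have "J a + J b - 2 * J ((1 / 2) *\<^sub>R (a + b)) = (dist a b)\<^sup>2 / 2"
      unfolding J_def scaleR add dist_norm power2_norm_eq_inner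
      by (simp add: inner_add inner_diff inner_commute[of b a] algebra_simps)
    then show ?thesis using I_le[of "(1 / 2) *\<^sub>R (a + b)"] by simp
  qed
  have "Cauchy Y"
  proof (rule metric_CauchyI)
    fix e :: real assume "0 < e"
    then obtain N where N: "1 / real (Suc N) < e\<^sup>2 / 4"
      by (metis nat_approx_posE zero_less_power zero_less_divide_iff zero_less_numeral)
    have "dist (Y m) (Y n) < e" if "m \<ge> N" "n \<ge> N" for m n
    proof (rule power2_less_imp_less)
      have "1 / real (Suc m) \<le> 1 / real (Suc N)" "1 / real (Suc n) \<le> 1 / real (Suc N)"
        using that by (auto intro!: divide_left_mono)
      then have "J (Y m) - I < e\<^sup>2 / 4" "J (Y n) - I < e\<^sup>2 / 4"
        using Y[of m] Y[of n] N by (smt (verit))+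
      then have "2 * (J (Y m) - I) + 2 * (J (Y n) - I) < e\<^sup>2"
        by argo
      with dist_le[of "Y m" "Y n"] show "(dist (Y m) (Y n))\<^sup>2 < e\<^sup>2"
        by (rule le_less_trans)
    qed (use \<open>0 < e\<close> in simp)
    then show "\<exists>N. \<forall>m\<ge>N. \<forall>n\<ge>N. dist (Y m) (Y n) < e" by blast
  qed
  then obtain y where y: "Y \<longlonglongrightarrow> y" using Cauchy_convergent convergent_def by blast
  have "(\<lambda>n. J (Y n)) \<longlonglongrightarrow> J y"
    unfolding J_def by (intro tendsto_intros y tendsto)
  moreover have "(\<lambda>n. I + 1 / real (Suc n)) \<longlonglongrightarrow> I + 0"
    by (intro tendsto_intros lim_1_over_n[THEN LIMSEQ_Suc])
  ultimately have "J y \<le> I + 0"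
    by (rule LIMSEQ_le) (use Y less_imp_le in blast)
  then have min: "J y \<le> J z" for z using I_le[of z] by simp
  have "f x = inner x y" for x
  proof (cases "x = 0")
    case True then show ?thesis by (simp add: zero)
  next
    case False
    define c where "c = inner x y - f x"
    define t where "t = - c / inner x x"
    have pos: "inner x x > 0" using False by simp
    have "J (y + t *\<^sub>R x) - J y = 2 * t * c + t\<^sup>2 * inner x x"
      unfolding J_def c_def scaleR add power2_norm_eq_inner
      by (simp add: inner_add inner_commute[of y x] power2_eq_square algebra_simps)
    also have "\<dots> = - c\<^sup>2 / inner x x"
      using pos by (simp add: t_def power2_eq_square field_simps)
    finally have "c\<^sup>2 / inner x x \<le> 0" using min[of "y + t *\<^sub>R x"] by simp
    then have "c = 0" using pos by (simp add: divide_le_0_iff)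
    then show ?thesis by (simp add: c_def)
  qed
  then show ?thesis by blast
qed

lemma adjoint_pair_on_unique:
  assumes "adjoint_pair_on UNIV A B" "adjoint_pair_on UNIV A B'"
  shows "B = B'"
proof
  fix y
  have "inner x (B y) = inner x (B' y)" for x
    using assms by (simp add: adjoint_pair_on_def inner_eq_Re_cinner)
  then have "inner (B y - B' y) (B y - B' y) = 0"
    by (simp only: inner_diff_right cancel_comm_monoid_add_class.diff_cancel)
  then show "B y = B' y" by simp
qed

lemma adjoint_pair_on_cadjoint:
  fixes A :: "'a::chilbert_space \<Rightarrow> 'a"
  assumes "bounded_clinear_on UNIV A"
  shows "adjoint_pair_on UNIV A (cadjoint A)"
proof -
  have add: "A (x + y) = A x + A y" and scale: "A (c *\<^sub>C x) = c *\<^sub>C A x" for c x y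
    using assms by (auto simp: bounded_clinear_on_def)
  obtain K where K: "norm (A x) \<le> K * norm x" for x
    using assms by (auto simp: bounded_clinear_on_def)
  have A: "bounded_linear A"
    by (rule bounded_linear_intro[of _ K])
       (simp_all add: add K mult.commute scale flip: scaleC_of_real)
  have "\<exists>z. \<forall>x. inner (A x) y = inner x z" for y
    by (rule riesz_real) (rule bounded_linear_compose[OF bounded_linear_inner_left A])
  then obtain B where B: "inner (A x) y = inner x (B y)" for x y by metis
  have "cinner (A x) y = cinner x (B y)" for x y
  proof (rule complex_eqI)
    show "Re (cinner (A x) y) = Re (cinner x (B y))"
      using B by (simp add: inner_eq_Re_cinner)
    have "Re (cinner (A (- \<i> *\<^sub>C x)) y) = Re (cinner (- \<i> *\<^sub>C x) (B y))"
      using B by (simp only: inner_eq_Re_cinner[symmetric])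
    then show "Im (cinner (A x) y) = Im (cinner x (B y))"
      by (simp add: scale cinner_scaleC_left)
  qed
  then have AB: "adjoint_pair_on UNIV A B" by (simp add: adjoint_pair_on_def)
  then have "cadjoint A = B"
    unfolding cadjoint_def
    by (rule the_equality[of "adjoint_pair_on UNIV A"]) (rule adjoint_pair_on_unique[OF _ AB])
  with AB show ?thesis by simp
qed


section \<open>Strongly continuous semigroups\<close>

definition c0_semigroup_on :: "'a::complex_inner set \<Rightarrow> (real \<Rightarrow> 'a \<Rightarrow> 'a) \<Rightarrow> bool"
  where "c0_semigroup_on V T \<longleftrightarrow>
    (\<forall>t\<ge>0. bounded_clinear_on V (T t)) \<and>
    (\<forall>x\<in>V. T 0 x = x) \<and>
    (\<forall>s\<ge>0. \<forall>t\<ge>0. \<forall>x\<in>V. T (s + t) x = T s (T t x)) \<and>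
    (\<forall>x\<in>V. ((\<lambda>t. T t x) \<longlongrightarrow> x) (at_right 0))"

text \<open>The operator \<open>A\<close> with domain \<open>D\<close> is the infinitesimal generator of \<open>T\<close>.\<close>

definition generates_on ::
    "'a::complex_inner set \<Rightarrow> 'a set \<Rightarrow> ('a \<Rightarrow> 'a) \<Rightarrow> (real \<Rightarrow> 'a \<Rightarrow> 'a) \<Rightarrow> bool"
  where "generates_on V D A T \<longleftrightarrow>
    c0_semigroup_on V T \<and>
    D = {x \<in> V. \<exists>y\<in>V. ((\<lambda>t. (T t x - x) /\<^sub>R t) \<longlongrightarrow> y) (at_right 0)} \<and>
    (\<forall>x\<in>D. ((\<lambda>t. (T t x - x) /\<^sub>R t) \<longlongrightarrow> A x) (at_right 0))"


section \<open>Hypocoercive operators\<close>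

definition skew_part :: "('a::complex_inner \<Rightarrow> 'a) \<Rightarrow> 'a \<Rightarrow> 'a"
  where "skew_part C = (\<lambda>x. (C x - cadjoint C x) /\<^sub>R 2)"

definition herm_part :: "('a::complex_inner \<Rightarrow> 'a) \<Rightarrow> 'a \<Rightarrow> 'a"
  where "herm_part C = (\<lambda>x. (C x + cadjoint C x) /\<^sub>R 2)"

definition accretive :: "('a::complex_inner \<Rightarrow> 'a) \<Rightarrow> bool"
  where "accretive C \<longleftrightarrow> op_le_on UNIV (\<lambda>x. 0) (herm_part C)"

definition hypocoercivity_condition :: "('a::complex_inner \<Rightarrow> 'a) \<Rightarrow> nat \<Rightarrow> bool"
  where "hypocoercivity_condition C m \<longleftrightarrow>
    (\<exists>\<kappa>>0. op_le_on UNIV (\<lambda>x. \<kappa> *\<^sub>R x)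
      (\<lambda>x. \<Sum>j\<le>m. (C ^^ j) (herm_part C ((cadjoint C ^^ j) x))))"

definition hypocoercive :: "('a::complex_inner \<Rightarrow> 'a) \<Rightarrow> bool"
  where "hypocoercive C \<longleftrightarrow>
    bounded_clinear_on UNIV C \<and> accretive C \<and> (\<exists>m. hypocoercivity_condition C m)"

definition hypocoercivity_index :: "('a::complex_inner \<Rightarrow> 'a) \<Rightarrow> nat"
  where "hypocoercivity_index C = (LEAST m. hypocoercivity_condition C m)"


section \<open>Direct sums of rescaled operators\<close>

definition scaled_op :: "('h::complex_inner \<Rightarrow> 'h) \<Rightarrow> real \<Rightarrow> 'h \<Rightarrow> 'h"
  where "scaled_op C \<eta> = (\<lambda>x. \<eta> *\<^sub>R skew_part C x + herm_part C x)"

definition sum_op :: "('h::complex_inner \<Rightarrow> 'h) \<Rightarrow> real set \<Rightarrow> (real, 'h) hsum \<Rightarrow> (real, 'h) hsum"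
  where "sum_op C E x = hfamily E (\<lambda>\<eta>. scaled_op C \<eta> (hsum_nth x \<eta>))"

definition sum_op_dom :: "('h::complex_inner \<Rightarrow> 'h) \<Rightarrow> real set \<Rightarrow> (real, 'h) hsum set"
  where "sum_op_dom C E =
    {x \<in> hsum_on E. square_summable_on (\<lambda>\<eta>. scaled_op C \<eta> (hsum_nth x \<eta>)) E}"

definition weight_op :: "('h::complex_inner \<Rightarrow> 'h) \<Rightarrow> nat \<Rightarrow> real \<Rightarrow> 'h \<Rightarrow> 'h"
  where "weight_op C m \<eta> = (\<lambda>x. \<Sum>j\<le>m.
    (1 / \<eta> ^ (2 * j)) *\<^sub>R ((cadjoint (scaled_op C \<eta>) ^^ j) ((scaled_op C \<eta> ^^ j) x)))"

definition sum_weight_op ::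
    "('h::complex_inner \<Rightarrow> 'h) \<Rightarrow> nat \<Rightarrow> real set \<Rightarrow> (real, 'h) hsum \<Rightarrow> (real, 'h) hsum"
  where "sum_weight_op C m E x = hfamily E (\<lambda>\<eta>. weight_op C m \<eta> (hsum_nth x \<eta>))"

end

theory Submission
  imports Defs
begin

text \<open>
  Write \<open>R\<close> for the Hermitian part of \<open>C\<close> and \<open>q x = \<langle>R x, x\<rangle>\<close>.  The hypocoercivity condition says that
  \<open>\<Sum>j\<le>m. q (C*\<^sup>j x)\<close> dominates a multiple of \<open>\<parallel>x\<parallel>\<^sup>2\<close>.  Since \<open>C*\<close> and \<open>- C\<^sub>\<eta> / \<eta>\<close> differ by \<open>(1 + 1 / \<eta>) R\<close>,
  a bounded multiple of \<open>R\<close>, and \<open>\<parallel>R x\<parallel>\<^sup>2\<close> is controlled by \<open>q x\<close>, the same holds for \<open>C\<^sub>\<eta> / \<eta>\<close> with a constant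
  independent of \<open>\<eta>\<close>.  This is the Lyapunov inequality for the weights.

  By the Banach-Steinhaus theorem orbits of the semigroup that start in the domain of the generator
  are differentiable, hence their components solve \<open>y' = - C\<^sub>\<eta> y\<close>, and \<open>\<parallel>y\<parallel>\<^sup>2\<close> decreases at the rate \<open>2 q y\<close>.
  Inserting the Taylor polynomial of \<open>y\<close> at \<open>0\<close>, the dissipation up to time \<open>t\<close> is at least of order
  \<open>t (\<bar>\<eta>\<bar> t)^(2m)\<close> as long as \<open>\<bar>\<eta>\<bar> t\<close> is small; for larger \<open>\<bar>\<eta>\<bar> t\<close> one adds up such windows.  For the opposite
  bound one starts at a unit vector on which \<open>\<Sum>j<m. q (C\<^sub>\<eta>\<^sup>j x)\<close> is almost \<open>0\<close>; it exists by minimality of \<open>m\<close>.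
\<close>

section \<open>Positive quadratic forms\<close>

lemma norm_funpow_le:
  fixes A :: "'a::real_normed_vector \<Rightarrow> 'a"
  assumes "0 \<le> K" "\<And>x. norm (A x) \<le> K * norm x"
  shows "norm ((A ^^ j) x) \<le> K ^ j * norm x"
proof (induction j)
  case (Suc j)
  have "norm (A ((A ^^ j) x)) \<le> K * norm ((A ^^ j) x)" by (rule assms)
  also have "\<dots> \<le> K * (K ^ j * norm x)" using Suc assms(1) by (intro mult_left_mono)
  finally show ?case by (simp add: mult_ac)
qed simp

text \<open>The dissipation estimates are real-linear in nature, so they are proved over a real
  inner product space; \<open>herm_part C\<close> is inserted later. The bound is put on the form,
  and \<open>norm_R_square_le\<close> recovers an operator bound from it.\<close>

locale pos_form =
  fixes R :: "'a::real_inner \<Rightarrow> 'a" and r :: real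
  assumes lin: "linear R"
    and sym: "inner (R x) y = inner x (R y)"
    and pos: "0 \<le> inner (R x) x"
    and r_pos: "0 < r"
    and bound: "inner (R x) x \<le> r * (norm x)\<^sup>2"
begin

definition q :: "'a \<Rightarrow> real" where "q x = inner (R x) x"

lemma q_nonneg [simp]: "0 \<le> q x"
  by (simp add: q_def pos)

lemma q_zero [simp]: "q 0 = 0"
  by (simp add: q_def)

lemma q_le: "q x \<le> r * (norm x)\<^sup>2"
  by (simp add: q_def bound)

lemma q_scaleR: "q (c *\<^sub>R x) = c\<^sup>2 * q x"
  by (simp add: q_def linear_scale[OF lin] power2_eq_square)

lemma q_uminus [simp]: "q (- x) = q x"
  using q_scaleR[of "-1" x] by simp

lemma q_add: "q (x + y) = q x + 2 * inner (R x) y + q y"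
  using sym[of y x] by (simp add: q_def linear_add[OF lin] inner_add inner_commute)

text \<open>Nonnegativity of \<open>q (x - y)\<close> bounds \<open>2 * inner (R x) y\<close> by
  \<open>q x + q y\<close>, so the form satisfies the same crude inequality as a squared
  norm.\<close>

lemma q_add_le: "q (x + y) \<le> 2 * q x + 2 * q y"
proof -
  have "q (x + - y) = q x - 2 * inner (R x) y + q y"
    by (simp only: q_add q_uminus inner_minus_right)
  then show ?thesis
    using q_nonneg[of "x + - y"] q_add[of x y] by linarith
qed

lemma q_diff_le: "q (x - y) \<le> 2 * q x + 2 * q y"
  using q_add_le[of x "- y"] by simp

text \<open>Peeling off one summand doubles the constant. All that matters later is that it depends
  on the number of summands only.\<close>

lemma q_sum_le:
  assumes "finite A"
  shows "q (\<Sum>i\<in>A. f i) \<le> 2 ^ card A * (\<Sum>i\<in>A. q (f i))"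
  using assms
proof (induction A)
  case (insert a A)
  have "q (\<Sum>i\<in>insert a A. f i) \<le> 2 * q (f a) + 2 * q (\<Sum>i\<in>A. f i)"
    using insert q_add_le by simp
  also have "\<dots> \<le> 2 * 2 ^ card A * q (f a) + 2 * (2 ^ card A * (\<Sum>i\<in>A. q (f i)))"
    using insert mult_right_mono[of "1::real" "2 ^ card A" "2 * q (f a)"] by simp
  also have "\<dots> = 2 ^ card (insert a A) * (\<Sum>i\<in>insert a A. q (f i))"
    using insert by (simp add: algebra_simps)
  finally show ?case .
qed simp

lemma norm_R_square_le: "(norm (R x))\<^sup>2 \<le> r * q x"
proof -
  \<comment> \<open>For real c, \<open>q (x - c R x)\<close> is at most
    \<open>q x - 2 c |R x|^2 + c^2 r |R x|^2\<close>, and \<open>c = 1 / r\<close> minimises this;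
    nonnegativity of the form then gives the claim.\<close>
  have "q (x + (- inverse r) *\<^sub>R R x) = q x - 2 * inverse r * (norm (R x))\<^sup>2 + (inverse r)\<^sup>2 * q (R x)"
    unfolding q_add q_scaleR by (simp add: power2_norm_eq_inner)
  moreover have "(inverse r)\<^sup>2 * q (R x) \<le> (inverse r)\<^sup>2 * (r * (norm (R x))\<^sup>2)"
    by (intro mult_left_mono q_le) simp
  moreover have "(inverse r)\<^sup>2 * (r * (norm (R x))\<^sup>2) = inverse r * (norm (R x))\<^sup>2"
    using r_pos by (simp add: power2_eq_square)
  ultimately have "inverse r * (norm (R x))\<^sup>2 \<le> q x"
    using q_nonneg[of "x + (- inverse r) *\<^sub>R R x"] by linarith
  then show ?thesis using r_pos by (simp add: field_simps)
qed

lemma continuous_on_q: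
  assumes "continuous_on S f"
  shows "continuous_on S (\<lambda>x. q (f x))"
proof -
  have "norm (R x) \<le> norm x * r" for x
  proof (rule power2_le_imp_le)
    have "(norm (R x))\<^sup>2 \<le> r * (r * (norm x)\<^sup>2)"
      by (rule order_trans[OF norm_R_square_le mult_left_mono[OF q_le]]) (use r_pos in simp)
    then show "(norm (R x))\<^sup>2 \<le> (norm x * r)\<^sup>2" by (simp add: power2_eq_square mult_ac)
  qed (use r_pos in simp)
  then have "bounded_linear R"
    by (intro bounded_linear_intro[of R r]) (simp_all add: linear_add[OF lin] linear_scale[OF lin])
  from bounded_linear.continuous_on[OF this assms] show ?thesis
    unfolding q_def by (rule continuous_on_inner) (rule assms)
qed

text \<open>The scalar \<theta> may vary with the pair, but only \<open>L\<close> and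
  \<open>M\<close> enter the constants below, which makes them uniform over families of operators.
  The norm bound is put on \<open>A\<close> because the recursion for differences of powers applies
  \<open>A\<close> to the difference.\<close>

definition perturbation :: "real \<Rightarrow> real \<Rightarrow> ('a \<Rightarrow> 'a) \<Rightarrow> ('a \<Rightarrow> 'a) \<Rightarrow> bool"
  where "perturbation L M A B \<longleftrightarrow> linear A \<and> (\<forall>x. norm (A x) \<le> L * norm x) \<and>
    (\<exists>\<theta>. \<bar>\<theta>\<bar> \<le> M \<and> (\<forall>x. A x = B x + \<theta> *\<^sub>R R x))"

text \<open>With \<open>d j = A\<^sup>j x - B\<^sup>j x\<close> one has \<open>d (j + 1) = A (d j) + \<theta> R B\<^sup>j x\<close>, and \<open>q\<close> controls the last term.\<close>

lemma norm_pow_diff_le: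
  assumes "0 \<le> L" "0 \<le> M"
  shows "\<exists>K\<ge>0. \<forall>A B x. perturbation L M A B \<longrightarrow>
      (norm ((A ^^ j) x - (B ^^ j) x))\<^sup>2 \<le> K * (\<Sum>i<j. q ((B ^^ i) x))"
proof (induction j)
  case 0
  then show ?case by auto
next
  case (Suc j)
  then obtain K where K: "K \<ge> 0" and le: "\<forall>A B x. perturbation L M A B \<longrightarrow>
      (norm ((A ^^ j) x - (B ^^ j) x))\<^sup>2 \<le> K * (\<Sum>i<j. q ((B ^^ i) x))"
    by blast
  let ?K = "2 * L\<^sup>2 * K + 2 * M\<^sup>2 * r"
  show ?case
  proof (intro exI[of _ ?K] conjI allI impI)
    show "?K \<ge> 0" using K r_pos by simp
  next
    fix A B :: "'a \<Rightarrow> 'a" and x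
    assume AB: "perturbation L M A B"
    then obtain \<theta> where A: "linear A" "\<And>x. norm (A x) \<le> L * norm x" and \<theta>: "\<bar>\<theta>\<bar> \<le> M"
      and eq: "\<And>x. A x = B x + \<theta> *\<^sub>R R x"
      unfolding perturbation_def by blast
    define d where "d = (A ^^ j) x - (B ^^ j) x"
    define e where "e = R ((B ^^ j) x)"
    have "(A ^^ Suc j) x - (B ^^ Suc j) x = A d + \<theta> *\<^sub>R e"
      unfolding d_def e_def linear_diff[OF A(1)] using eq[of "(B ^^ j) x"] by simp
    then have "norm ((A ^^ Suc j) x - (B ^^ Suc j) x) \<le> norm (A d) + \<bar>\<theta>\<bar> * norm e"
      by (metis norm_triangle_ineq norm_scaleR)
    also have "\<dots> \<le> L * norm d + M * norm e"
      using A(2) \<theta> by (intro add_mono mult_right_mono) auto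
    finally have "(norm ((A ^^ Suc j) x - (B ^^ Suc j) x))\<^sup>2 \<le> (L * norm d + M * norm e)\<^sup>2"
      by (intro power_mono) auto
    also have "\<dots> \<le> 2 * L\<^sup>2 * (norm d)\<^sup>2 + 2 * M\<^sup>2 * (norm e)\<^sup>2"
      using sum_squares_bound[of "L * norm d" "M * norm e"] by (simp add: power2_sum power_mult_distrib)
    also have "\<dots> \<le> 2 * L\<^sup>2 * (K * (\<Sum>i<j. q ((B ^^ i) x))) + 2 * M\<^sup>2 * (r * q ((B ^^ j) x))"
      unfolding d_def e_def using le AB norm_R_square_le[of "(B ^^ j) x"]
      by (intro add_mono mult_left_mono) auto
    also have "\<dots> \<le> ?K * (\<Sum>i<j. q ((B ^^ i) x)) + ?K * q ((B ^^ j) x)"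
    proof (intro add_mono)
      have "0 \<le> (\<Sum>i<j. q ((B ^^ i) x))" by (intro sum_nonneg) simp
      then have "2 * M\<^sup>2 * r * (\<Sum>i<j. q ((B ^^ i) x)) \<ge> 0" using r_pos by simp
      then show "2 * L\<^sup>2 * (K * (\<Sum>i<j. q ((B ^^ i) x))) \<le> ?K * (\<Sum>i<j. q ((B ^^ i) x))"
        by (simp add: algebra_simps)
      have "2 * L\<^sup>2 * K * q ((B ^^ j) x) \<ge> 0" using K by simp
      then show "2 * M\<^sup>2 * (r * q ((B ^^ j) x)) \<le> ?K * q ((B ^^ j) x)"
        by (simp add: algebra_simps)
    qed
    finally show "(norm ((A ^^ Suc j) x - (B ^^ Suc j) x))\<^sup>2 \<le> ?K * (\<Sum>i<Suc j. q ((B ^^ i) x))"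
      by (simp add: algebra_simps)
  qed
qed

text \<open>Split \<open>(A ^^ n) x\<close> into \<open>(B ^^ n) x\<close> and the difference of the
  two. By \<open>norm_pow_diff_le\<close> the difference is controlled by strictly lower powers of
  \<open>B\<close>, which already occur on the right. This transfers hypocoercivity between
  operators that differ by a multiple of \<open>R\<close>.\<close>

lemma sum_q_pow_le:
  assumes "0 \<le> L" "0 \<le> M"
  shows "\<exists>K>0. \<forall>A B x. perturbation L M A B \<longrightarrow>
      (\<Sum>j<n. q ((A ^^ j) x)) \<le> K * (\<Sum>j<n. q ((B ^^ j) x))"
proof (induction n)
  case 0
  then show ?case by (intro exI[of _ 1]) auto
next
  case (Suc n)
  then obtain K where K: "K > 0" and le: "\<forall>A B x. perturbation L M A B \<longrightarrow>
      (\<Sum>j<n. q ((A ^^ j) x)) \<le> K * (\<Sum>j<n. q ((B ^^ j) x))"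
    by blast
  obtain K' where K': "K' \<ge> 0" and le': "\<forall>A B x. perturbation L M A B \<longrightarrow>
      (norm ((A ^^ n) x - (B ^^ n) x))\<^sup>2 \<le> K' * (\<Sum>i<n. q ((B ^^ i) x))"
    using norm_pow_diff_le[OF assms, of n] by blast
  let ?K = "K + 2 + 2 * r * K'"
  show ?case
  proof (intro exI[of _ ?K] conjI allI impI)
    show "?K > 0" using K K' r_pos by (intro add_pos_nonneg) auto
  next
    fix A B :: "'a \<Rightarrow> 'a" and x
    assume AB: "perturbation L M A B"
    let ?S = "\<Sum>j<n. q ((B ^^ j) x)"
    have S: "0 \<le> ?S" by (intro sum_nonneg) simp
    have "q ((A ^^ n) x) \<le> 2 * q ((A ^^ n) x - (B ^^ n) x) + 2 * q ((B ^^ n) x)"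
      using q_add_le[of "(A ^^ n) x - (B ^^ n) x" "(B ^^ n) x"] by simp
    moreover have "q ((A ^^ n) x - (B ^^ n) x) \<le> r * (K' * ?S)"
      by (rule order_trans[OF q_le mult_left_mono[OF le'[rule_format, OF AB]]]) (use r_pos in simp)
    ultimately have 1: "q ((A ^^ n) x) \<le> 2 * r * K' * ?S + 2 * q ((B ^^ n) x)" by linarith
    have "0 \<le> (K + 2 * r * K') * q ((B ^^ n) x)" using K K' r_pos by simp
    then show "(\<Sum>j<Suc n. q ((A ^^ j) x)) \<le> ?K * (\<Sum>j<Suc n. q ((B ^^ j) x))"
      using 1 le[rule_format, OF AB, of x] S unfolding sum.lessThan_Suc distrib_left distrib_right
      by linarith
  qed
qed

end

section \<open>Lower bounds for the form integrated along polynomial curves\<close>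

lemma integral_half_stretch:
  fixes f :: "real \<Rightarrow> real"
  assumes t: "0 \<le> t" and f: "continuous_on {0..t} f"
  shows "integral {0..t} (\<lambda>s. f (s / 2)) = 2 * integral {0..t/2} f"
proof (rule integral_unique)
  have "f integrable_on {0..t/2}"
    by (rule integrable_continuous_real[OF continuous_on_subset[OF f]]) (use t in auto)
  from has_integral_stretch_real[OF integrable_integral[OF this], of "1/2"]
  show "((\<lambda>s. f (s / 2)) has_integral 2 * integral {0..t/2} f) {0..t}"
    using t by (simp add: image_mult_atLeastAtMost_if' mult.commute)
qed

lemma has_integral_power:
  fixes t :: real
  assumes "0 \<le> t"
  shows "((\<lambda>s. s ^ k) has_integral t ^ (k + 1) / real (k + 1)) {0..t}"
proof -
  have "((\<lambda>s. s ^ k) has_integral t ^ (k + 1) / real (k + 1) - 0 ^ (k + 1) / real (k + 1)) {0..t}"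
  proof (rule fundamental_theorem_of_calculus[OF assms])
    fix s :: real
    have "((\<lambda>s. s ^ (k + 1) / real (k + 1)) has_real_derivative
        real (k + 1) * s ^ (k + 1 - 1) / real (k + 1)) (at s within {0..t})"
      by (intro DERIV_cdivide) (rule DERIV_cong[OF DERIV_pow], simp)
    then show "((\<lambda>s. s ^ (k + 1) / real (k + 1)) has_vector_derivative s ^ k) (at s within {0..t})"
      by (simp add: has_real_derivative_iff_has_vector_derivative del: of_nat_add of_nat_Suc)
  qed
  then show ?thesis by simp
qed

context pos_form
begin

text \<open>
  The combination \<open>p s - 2^n p (s / 2)\<close> removes the leading coefficient of a polynomial \<open>p\<close> of
  degree \<open>n\<close> and keeps the others bounded away from \<open>0\<close>, which makes an induction on the degree possible.
\<close>

lemma integral_q_poly_ge: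
  "\<exists>c>0. \<forall>w t. 0 \<le> t \<longrightarrow>
    c * (\<Sum>j\<le>m. t ^ (2 * j + 1) * q (w j)) \<le> integral {0..t} (\<lambda>s. q (\<Sum>j\<le>m. s ^ j *\<^sub>R w j))"
proof (induction m)
  case 0
  show ?case by (intro exI[of _ 1]) simp
next
  case (Suc m)
  then obtain c where c: "0 < c" and IH: "\<And>w t. 0 \<le> t \<Longrightarrow> c * (\<Sum>j\<le>m. t ^ (2 * j + 1) * q (w j))
      \<le> integral {0..t} (\<lambda>s. q (\<Sum>j\<le>m. s ^ j *\<^sub>R w j))"
    by auto
  define n where "n = Suc m"
  \<comment> \<open>\<open>K\<close> will bound the contribution \<open>Z\<close> of the lower
    coefficients in terms of the integral \<open>I\<close>, and \<open>K'\<close> the contribution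
    of the leading coefficient.\<close>
  define K where "K = (2 + 4 ^ (n + 1)) / c"
  define K' where "K' = (2 * n + 1) * (2 + 2 * 2 ^ n * K)"
  have K: "0 < K" using c by (simp add: K_def add_pos_pos)
  have K': "0 < K'" using K by (simp add: K'_def add_pos_pos)
  show ?case
  proof (intro exI[of _ "1 / (K + K')"] conjI allI impI)
    show "0 < 1 / (K + K')" using K K' by simp
  next
    fix w :: "nat \<Rightarrow> 'a" and t :: real
    assume t: "0 \<le> t"
    define p where "p s = (\<Sum>j\<le>n. s ^ j *\<^sub>R w j)" for s
    define l where "l s = (\<Sum>j\<le>m. s ^ j *\<^sub>R w j)" for s
    define I where "I = integral {0..t} (\<lambda>s. q (p s))"
    define Z where "Z = (\<Sum>j\<le>m. t ^ (2 * j + 1) * q (w j))"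
    have Z0: "0 \<le> Z" unfolding Z_def using t by (intro sum_nonneg) simp
    have p_eq: "p s = l s + s ^ n *\<^sub>R w n" for s by (simp add: p_def l_def n_def)
    have cont_p: "continuous_on A (\<lambda>s. q (p s))" for A
      unfolding p_def by (intro continuous_on_q continuous_intros)
    have cont_p2: "continuous_on A (\<lambda>s. q (p (s / 2)))" for A
      unfolding p_def by (intro continuous_on_q continuous_intros) simp
    have I0: "0 \<le> I" unfolding I_def
      by (intro integral_nonneg integrable_continuous_real cont_p) simp
    \<comment> \<open>The factor vanishes for \<open>j = n\<close>, so the combination below has
      degree \<open>m\<close> and falls under the induction hypothesis.\<close>
    define w' where "w' j = (1 - 2 ^ n / 2 ^ j) *\<^sub>R w j" for j
    have g: "p s - 2 ^ n *\<^sub>R p (s / 2) = (\<Sum>j\<le>m. s ^ j *\<^sub>R w' j)" for s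
    proof -
      have "p s - 2 ^ n *\<^sub>R p (s / 2) = (\<Sum>j\<le>n. s ^ j *\<^sub>R w' j)"
        unfolding p_def scaleR_sum_right sum_subtractf[symmetric] w'_def
        by (intro sum.cong refl) (simp add: algebra_simps power_divide)
      then show ?thesis by (simp add: n_def w'_def)
    qed
    \<comment> \<open>For \<open>j < n\<close> the number \<open>1 - 2^(n - j)\<close> has modulus
      at least 1, so no lower coefficient is lost.\<close>
    have "q (w j) \<le> q (w' j)" if "j \<le> m" for j
    proof -
      have "(2::real) ^ Suc j \<le> 2 ^ n" using that by (intro power_increasing) (auto simp: n_def)
      then have "1 \<le> \<bar>1 - (2::real) ^ n / 2 ^ j\<bar>" by (simp add: field_simps)
      then have "1 \<le> (1 - (2::real) ^ n / 2 ^ j)\<^sup>2"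
        by (metis one_le_power power2_abs)
      from mult_right_mono[OF this q_nonneg[of "w j"]] show ?thesis
        by (simp add: w'_def q_scaleR)
    qed
    then have "c * Z \<le> c * (\<Sum>j\<le>m. t ^ (2 * j + 1) * q (w' j))"
      unfolding Z_def using t c by (intro mult_left_mono sum_mono) auto
    also have "\<dots> \<le> integral {0..t} (\<lambda>s. q (p s - 2 ^ n *\<^sub>R p (s / 2)))"
      unfolding g by (rule IH[OF t])
    also have "\<dots> \<le> integral {0..t} (\<lambda>s. 2 * q (p s) + 2 * 4 ^ n * q (p (s / 2)))"
    proof (intro integral_le integrable_continuous_real)
      fix s
      have "(2 ^ n)\<^sup>2 = (4::real) ^ n" by (simp add: power2_eq_square flip: power_mult_distrib)
      then show "q (p s - 2 ^ n *\<^sub>R p (s / 2)) \<le> 2 * q (p s) + 2 * 4 ^ n * q (p (s / 2))"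
        using q_diff_le[of "p s" "2 ^ n *\<^sub>R p (s / 2)"] by (simp add: q_scaleR)
    next
      show "continuous_on {0..t} (\<lambda>s. q (p s - 2 ^ n *\<^sub>R p (s / 2)))"
        unfolding g by (intro continuous_on_q continuous_intros)
    qed (intro continuous_intros cont_p cont_p2)
    also have "\<dots> = 2 * I + 2 * 4 ^ n * integral {0..t} (\<lambda>s. q (p (s / 2)))"
      unfolding I_def
      by (subst integral_add)
         (auto intro!: integrable_continuous_real cont_p cont_p2 continuous_intros)
    also have "integral {0..t} (\<lambda>s. q (p (s / 2))) = 2 * integral {0..t/2} (\<lambda>s. q (p s))"
      by (rule integral_half_stretch[OF t cont_p])
    also have "integral {0..t/2} (\<lambda>s. q (p s)) \<le> I"
      unfolding I_def using t
      by (intro integral_subset_le integrable_continuous_real cont_p) auto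
    finally have "c * Z \<le> (2 + 4 ^ (n + 1)) * I" by (simp add: algebra_simps)
    then have Z: "Z \<le> K * I" using c by (simp add: K_def field_simps)
    \<comment> \<open>The leading term is \<open>p s - l s\<close>. The form of \<open>p\<close>
      integrates to \<open>I\<close>, and that of the lower part \<open>l\<close> is bounded through
      \<open>Z\<close>, hence through \<open>I\<close> again.\<close>
    have "t ^ (2 * n + 1) / (2 * n + 1) * q (w n) = integral {0..t} (\<lambda>s. s ^ (2 * n) * q (w n))"
      using integral_unique[OF has_integral_power[OF t, of "2 * n"]] by simp
    also have "\<dots> \<le> integral {0..t} (\<lambda>s. 2 * q (p s) + 2 * 2 ^ n * (\<Sum>j\<le>m. t ^ (2 * j) * q (w j)))"
    proof (intro integral_le integrable_continuous_real)
      fix s assume s: "s \<in> {0..t}"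
      have "s ^ (2 * n) * q (w n) = q (p s - l s)"
        by (simp add: p_eq q_scaleR power_mult mult.commute[of 2] power_even_eq)
      also have "\<dots> \<le> 2 * q (p s) + 2 * q (l s)" by (rule q_diff_le)
      also have "q (l s) \<le> 2 ^ n * (\<Sum>j\<le>m. q (s ^ j *\<^sub>R w j))"
        unfolding l_def using q_sum_le[of "{..m}" "\<lambda>j. s ^ j *\<^sub>R w j"] by (simp add: n_def)
      also have "(\<Sum>j\<le>m. q (s ^ j *\<^sub>R w j)) \<le> (\<Sum>j\<le>m. t ^ (2 * j) * q (w j))"
      proof (intro sum_mono)
        fix j
        have "(s ^ j)\<^sup>2 \<le> t ^ (2 * j)"
          using power_mono[of s t "2 * j"] s by (simp add: power_even_eq)
        then show "q (s ^ j *\<^sub>R w j) \<le> t ^ (2 * j) * q (w j)"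
          unfolding q_scaleR by (intro mult_right_mono) auto
      qed
      finally show "s ^ (2 * n) * q (w n) \<le> 2 * q (p s) + 2 * 2 ^ n * (\<Sum>j\<le>m. t ^ (2 * j) * q (w j))"
        by simp
    qed (intro continuous_intros cont_p)+
    also have "\<dots> = 2 * I + t * (2 * 2 ^ n * (\<Sum>j\<le>m. t ^ (2 * j) * q (w j)))"
      unfolding I_def using t
      by (subst integral_add)
         (auto intro!: integrable_continuous_real cont_p continuous_intros)
    also have "\<dots> = 2 * I + 2 * 2 ^ n * Z"
      by (simp add: Z_def sum_distrib_left mult_ac)
    also have "\<dots> \<le> 2 * I + 2 * 2 ^ n * (K * I)" using Z by simp
    also have "\<dots> = (2 + 2 * 2 ^ n * K) * I" by (simp add: algebra_simps)
    finally have "t ^ (2 * n + 1) * q (w n) \<le> K' * I"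
      unfolding K'_def by (simp add: field_simps)
    then have "Z + t ^ (2 * n + 1) * q (w n) \<le> (K + K') * I"
      using Z by (simp add: algebra_simps)
    moreover have "(\<Sum>j\<le>Suc m. t ^ (2 * j + 1) * q (w j)) = Z + t ^ (2 * n + 1) * q (w n)"
      by (simp add: Z_def n_def)
    moreover have "integral {0..t} (\<lambda>s. q (\<Sum>j\<le>Suc m. s ^ j *\<^sub>R w j)) = I"
      unfolding I_def p_def n_def ..
    ultimately show "1 / (K + K') * (\<Sum>j\<le>Suc m. t ^ (2 * j + 1) * q (w j))
        \<le> integral {0..t} (\<lambda>s. q (\<Sum>j\<le>Suc m. s ^ j *\<^sub>R w j))"
      using K K' by (simp only:) (simp add: field_simps)
  qed
qed

end

section \<open>Linear differential equations\<close>

text \<open>The derivative is taken within the half line since semigroup orbits live on nonnegative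
  times; at 0 it is the right derivative.\<close>

definition solves :: "('a::real_normed_vector \<Rightarrow> 'a) \<Rightarrow> (real \<Rightarrow> 'a) \<Rightarrow> bool"
  where "solves A y \<longleftrightarrow> (\<forall>t\<ge>0. (y has_vector_derivative A (y t)) (at t within {0..}))"

lemma solves_shift:
  assumes "solves A y" "0 \<le> s"
  shows "solves A (\<lambda>t. y (s + t))"
  unfolding solves_def
proof (intro allI impI)
  fix t :: real
  assume "0 \<le> t"
  then have "(y has_vector_derivative A (y (s + t))) (at (s + t) within {0..})"
    using assms by (simp add: solves_def)
  then have "(y has_vector_derivative A (y (s + t))) (at (s + t) within (+) s ` {0..})"
    by (rule has_vector_derivative_within_subset) (use assms(2) in auto)
  moreover have "((+) s has_vector_derivative 1) (at t within {0..})"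
    by (auto intro!: derivative_eq_intros)
  ultimately have "(y \<circ> (+) s has_vector_derivative 1 *\<^sub>R A (y (s + t))) (at t within {0..})"
    by (intro vector_diff_chain_within)
  then show "((\<lambda>t. y (s + t)) has_vector_derivative A (y (s + t))) (at t within {0..})"
    by (simp add: o_def)
qed

text \<open>Iterated, this says that all \<open>(A ^^ j) (y t)\<close> solve the same equation; it
  drives both the Taylor estimate and the Lyapunov functional.\<close>

lemma solves_image:
  assumes "solves A y" "bounded_linear A"
  shows "solves A (\<lambda>t. A (y t))"
  using assms by (simp add: solves_def bounded_linear.has_vector_derivative)

lemma solves_at:
  assumes "solves A y" "0 < t"
  shows "(y has_vector_derivative A (y t)) (at t)"
proof -
  have "(y has_vector_derivative A (y t)) (at t within {0<..})"
    by (rule has_vector_derivative_within_subset[of _ _ _ "{0..}"]) (use assms in \<open>auto simp: solves_def\<close>)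
  then show ?thesis
    using at_within_open[of t "{0<..}"] assms(2) by simp
qed

lemma solves_continuous_on:
  assumes "solves A y"
  shows "continuous_on {0..} y"
  using assms unfolding solves_def continuous_on_eq_continuous_within
  by (auto intro: has_vector_derivative_continuous)

lemma solves_norm_square_deriv:
  fixes y :: "real \<Rightarrow> 'a::real_inner"
  assumes "solves A y" "0 < t"
  shows "((\<lambda>t. (norm (y t))\<^sup>2) has_real_derivative 2 * inner (A (y t)) (y t)) (at t)"
  unfolding power2_norm_eq_inner has_real_derivative_iff_has_vector_derivative
  using solves_at[OF assms]
  by (auto intro!: derivative_eq_intros simp: has_vector_derivative_def inner_commute algebra_simps)

lemma solves_norm_square_integral:
  fixes y :: "real \<Rightarrow> 'a::real_inner"
  assumes "solves A y" "0 \<le> t"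
  shows "((\<lambda>s. 2 * inner (A (y s)) (y s)) has_integral (norm (y t))\<^sup>2 - (norm (y 0))\<^sup>2) {0..t}"
proof (rule fundamental_theorem_of_calculus_interior)
  show "continuous_on {0..t} (\<lambda>t. (norm (y t))\<^sup>2)"
    by (intro continuous_intros continuous_on_subset[OF solves_continuous_on[OF assms(1)]]) auto
qed (use assms solves_norm_square_deriv[OF assms(1)] in \<open>auto simp: has_real_derivative_iff_has_vector_derivative\<close>)

text \<open>The derivative of the remainder after \<open>n + 1\<close> terms of \<open>y\<close> is
  the remainder after \<open>n\<close> terms of the solution \<open>A y\<close>, which allows an
  induction over all solutions at once. The factor \<open>1 / n!\<close> is given up, as only the
  power of \<open>t\<close> matters.\<close>

lemma solves_taylor:
  fixes A :: "'a::real_normed_vector \<Rightarrow> 'a"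
  assumes A: "bounded_linear A" "\<And>x. norm (A x) \<le> L * norm x" and L: "0 \<le> L"
    and y: "solves A y" "\<And>t. 0 \<le> t \<Longrightarrow> norm (y t) \<le> M"
    and t: "0 \<le> t"
  shows "norm (y t - (\<Sum>j<n. t ^ j *\<^sub>R ((A ^^ j) (y 0) /\<^sub>R fact j))) \<le> M * (L * t) ^ n"
  using y t
proof (induction n arbitrary: y M t)
  case 0
  then show ?case by simp
next
  case (Suc n)
  define e where "e t = y t - (\<Sum>j<Suc n. t ^ j *\<^sub>R ((A ^^ j) (y 0) /\<^sub>R fact j))" for t
  define e' where "e' t = A (y t) - (\<Sum>j<n. t ^ j *\<^sub>R ((A ^^ j) (A (y 0)) /\<^sub>R fact j))" for t
  have M: "0 \<le> M" using Suc.prems(2)[of 0] norm_ge_zero order_trans by blast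
  have bound: "norm (e' s) \<le> L * M * (L * s) ^ n" if "0 \<le> s" for s
    unfolding e'_def
  proof (rule Suc.IH[OF solves_image[OF Suc.prems(1) A(1)] _ that])
    fix t :: real
    assume "0 \<le> t"
    then show "norm (A (y t)) \<le> L * M"
      using A(2)[of "y t"] mult_left_mono[OF Suc.prems(2) L] by force
  qed
  have e0: "e 0 = 0" unfolding e_def by (subst sum.lessThan_Suc_shift) simp
  have deriv: "(e has_vector_derivative e' s) (at s)" if "0 < s" for s
  proof -
    have term_deriv: "((\<lambda>t. t ^ Suc j *\<^sub>R ((A ^^ Suc j) (y 0) /\<^sub>R fact (Suc j))) has_vector_derivative
        s ^ j *\<^sub>R ((A ^^ j) (A (y 0)) /\<^sub>R fact j)) (at s)" for j
      by (auto intro!: derivative_eq_intros simp: funpow_swap1 has_vector_derivative_def field_simps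
          simp del: of_nat_Suc power_Suc)
    have "((\<lambda>t. y t - (y 0 + (\<Sum>j<n. t ^ Suc j *\<^sub>R ((A ^^ Suc j) (y 0) /\<^sub>R fact (Suc j))))) has_vector_derivative
        A (y s) - (0 + (\<Sum>j<n. s ^ j *\<^sub>R ((A ^^ j) (A (y 0)) /\<^sub>R fact j)))) (at s)"
      by (intro has_vector_derivative_diff has_vector_derivative_add has_vector_derivative_const
          has_vector_derivative_sum term_deriv solves_at[OF Suc.prems(1) that])
    moreover have "e = (\<lambda>t. y t - (y 0 + (\<Sum>j<n. t ^ Suc j *\<^sub>R ((A ^^ Suc j) (y 0) /\<^sub>R fact (Suc j)))))"
      unfolding e_def by (subst sum.lessThan_Suc_shift) simp
    ultimately show ?thesis by (simp only: e'_def add_0)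
  qed
  show ?case
  proof (cases "t = 0")
    case True
    then show ?thesis using e0 unfolding e_def by simp
  next
    case False
    then have "0 < t" using Suc.prems by simp
    \<comment> \<open>Mean value inequality against \<open>M (L s)^(n + 1)\<close>, whose derivative
      is \<open>n + 1\<close> times the available bound on \<open>e'\<close>.\<close>
    have "norm (e t - e 0) \<le> M * (L * t) ^ Suc n - M * (L * 0) ^ Suc n"
    proof (rule differentiable_bound_general[OF \<open>0 < t\<close>, where \<phi> = "\<lambda>s. M * (L * s) ^ Suc n"])
      show "continuous_on {0..t} e"
        unfolding e_def
        by (intro continuous_intros continuous_on_subset[OF solves_continuous_on[OF Suc.prems(1)]]) auto
      fix s assume s: "0 < s" "s < t"
      show "(e has_vector_derivative e' s) (at s)" using deriv s by simp
      show "((\<lambda>s. M * (L * s) ^ Suc n) has_vector_derivative real (Suc n) * (L * M * (L * s) ^ n)) (at s)"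
        unfolding has_real_derivative_iff_has_vector_derivative[symmetric]
        by (auto intro!: derivative_eq_intros simp del: of_nat_Suc power_Suc)
      have "1 * (L * M * (L * s) ^ n) \<le> real (Suc n) * (L * M * (L * s) ^ n)"
        using s L M by (intro mult_right_mono) auto
      then show "norm (e' s) \<le> real (Suc n) * (L * M * (L * s) ^ n)"
        using bound[of s] s by simp
    qed (intro continuous_intros)
    then show ?thesis using e0 unfolding e_def by simp
  qed
qed

section \<open>Dissipative generators\<close>

context pos_form
begin

definition dissipative :: "('a \<Rightarrow> 'a) \<Rightarrow> bool"
  where "dissipative A \<longleftrightarrow> bounded_linear A \<and> (\<forall>x. inner (A x) x = - q x)"

text \<open>
  This is used with \<open>h = \<bar>\<eta>\<bar>\<close> and \<open>A = - C\<^sub>\<eta>\<close>.  All constants obtained below depend only on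
  \<open>K\<close>, \<open>\<kappa>\<close>, \<open>m\<close> and \<open>r\<close>, so they serve all summands of the direct sum at once.
\<close>

definition coercive_generator :: "real \<Rightarrow> real \<Rightarrow> nat \<Rightarrow> real \<Rightarrow> ('a \<Rightarrow> 'a) \<Rightarrow> bool"
  where "coercive_generator K \<kappa> m h A \<longleftrightarrow> dissipative A \<and>
    (\<forall>x. norm (A x) \<le> h * K * norm x) \<and>
    (\<forall>x. \<kappa> * (norm x)\<^sup>2 \<le> (\<Sum>j\<le>m. q ((A ^^ j) x) / h ^ (2 * j)))"

section \<open>Energy balance along solutions and uniform decay estimates\<close>

lemma continuous_on_q_solves:
  assumes "solves A y" "S \<subseteq> {0..}"
  shows "continuous_on S (\<lambda>s. q (y s))"
  by (intro continuous_on_q continuous_on_subset[OF solves_continuous_on[OF assms(1)] assms(2)])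

lemma integrable_q_solves:
  assumes "solves A y"
  shows "(\<lambda>s. q (y s)) integrable_on {0..t}"
  by (rule integrable_continuous_real[OF continuous_on_q_solves[OF assms]]) auto

lemma solves_energy:
  assumes "dissipative A" "solves A y" "0 \<le> t"
  shows "(norm (y t))\<^sup>2 = (norm (y 0))\<^sup>2 - 2 * integral {0..t} (\<lambda>s. q (y s))"
proof -
  have "((\<lambda>s. - 2 * q (y s)) has_integral (norm (y t))\<^sup>2 - (norm (y 0))\<^sup>2) {0..t}"
    using solves_norm_square_integral[OF assms(2,3)] assms(1) by (simp add: dissipative_def)
  moreover have "((\<lambda>s. - 2 * q (y s)) has_integral - 2 * integral {0..t} (\<lambda>s. q (y s))) {0..t}"
    by (rule has_integral_mult_right[OF integrable_integral[OF integrable_q_solves[OF assms(2)]]])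
  ultimately have "(norm (y t))\<^sup>2 - (norm (y 0))\<^sup>2 = - 2 * integral {0..t} (\<lambda>s. q (y s))"
    by (rule has_integral_unique)
  then show ?thesis by simp
qed

lemma solves_norm_le:
  assumes "dissipative A" "solves A y" "0 \<le> t"
  shows "norm (y t) \<le> norm (y 0)"
proof (rule power2_le_imp_le)
  have "0 \<le> integral {0..t} (\<lambda>s. q (y s))"
    by (rule integral_nonneg[OF integrable_q_solves[OF assms(2)]]) simp
  then show "(norm (y t))\<^sup>2 \<le> (norm (y 0))\<^sup>2"
    using solves_energy[OF assms] by simp
qed simp

lemma solves_norm_antimono:
  assumes "dissipative A" "solves A y" "0 \<le> s" "s \<le> t"
  shows "norm (y t) \<le> norm (y s)"
  using solves_norm_le[OF assms(1) solves_shift[OF assms(2,3)], of "t - s"] assms(4) by simp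

text \<open>Let \<open>u = h t\<close>. Along the Taylor polynomial of degree \<open>m\<close>,
  \<open>integral_q_poly_ge\<close> and coercivity give dissipation of order
  \<open>t u^(2m)\<close>. The Taylor error changes the dissipation only by order
  \<open>t u^(2m+2)\<close>, which is absorbed once \<open>u\<close> is below a threshold \<rho>
  that depends on the constants alone.\<close>

lemma dissipation_short_time:
  assumes K: "0 \<le> K" and \<kappa>: "0 < \<kappa>"
  shows "\<exists>c>0. \<exists>\<rho>>0. \<forall>h A y t. 1 \<le> h \<longrightarrow> coercive_generator K \<kappa> m h A \<longrightarrow> solves A y \<longrightarrow>
    0 \<le> t \<longrightarrow> h * t \<le> \<rho> \<longrightarrow>
    c * t * (h * t) ^ (2 * m) * (norm (y 0))\<^sup>2 \<le> integral {0..t} (\<lambda>s. q (y s))"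
proof -
  obtain c where c: "0 < c" and poly: "\<And>w t. 0 \<le> t \<Longrightarrow> c * (\<Sum>j\<le>m. t ^ (2 * j + 1) * q (w j))
      \<le> integral {0..t} (\<lambda>s. q (\<Sum>j\<le>m. s ^ j *\<^sub>R w j))"
    using integral_q_poly_ge[of m] by auto
  \<comment> \<open>The main term comes out as \<open>4 c'\<close>: with the integral counted twice,
    a share \<open>2 c'\<close> absorbs the Taylor error and \<open>2 c'\<close> remains. The
    summand 1 in \<open>D\<close> keeps it positive when \<open>K = 0\<close>, and \<rho> is chosen
    so that \<open>D u^2\<close> stays below \<open>c'\<close>.\<close>
  define c' where "c' = c * \<kappa> / (4 * (fact m)\<^sup>2)"
  define D where "D = r * K ^ (2 * m + 2) + 1"
  define \<rho> where "\<rho> = min 1 (sqrt (c' / D))"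
  have c': "0 < c'" using c \<kappa> by (simp add: c'_def)
  have D: "0 < D" "r * K ^ (2 * m + 2) \<le> D"
    unfolding D_def using r_pos K by (auto intro: add_nonneg_pos)
  have \<rho>: "0 < \<rho>" "\<rho> \<le> 1" using c' D by (auto simp: \<rho>_def)
  have \<rho>_sq: "D * \<rho>\<^sup>2 \<le> c'"
  proof -
    have "\<rho>\<^sup>2 \<le> (sqrt (c' / D))\<^sup>2" using \<rho> by (intro power_mono) (auto simp: \<rho>_def)
    then show ?thesis using c' D by (simp add: field_simps)
  qed
  show ?thesis
  proof (rule exI[of _ c'], rule conjI, fact, rule exI[of _ \<rho>], intro conjI allI impI)
    show "0 < \<rho>" by fact
  next
    fix h t :: real and A y
    assume h: "1 \<le> h" and A: "coercive_generator K \<kappa> m h A" and y: "solves A y"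
      and t: "0 \<le> t" "h * t \<le> \<rho>"
    have diss: "dissipative A" and lin: "bounded_linear A"
      and bnd: "\<And>x. norm (A x) \<le> h * K * norm x"
      and coer: "\<And>x. \<kappa> * (norm x)\<^sup>2 \<le> (\<Sum>j\<le>m. q ((A ^^ j) x) / h ^ (2 * j))"
      using A by (auto simp: coercive_generator_def dissipative_def)
    define x where "x = y 0"
    define u where "u = h * t"
    have u: "0 \<le> u" "u \<le> \<rho>" "u \<le> 1" using h t \<rho> by (auto simp: u_def)
    define w where "w j = (A ^^ j) x /\<^sub>R fact j" for j
    define p where "p s = (\<Sum>j\<le>m. s ^ j *\<^sub>R w j)" for s
    define X where "X = (norm x)\<^sup>2"
    have X: "0 \<le> X" by (simp add: X_def)
    have "4 * c' * t * u ^ (2 * m) * X \<le> 4 * c' * t * u ^ (2 * m) * ((\<Sum>j\<le>m. q ((A ^^ j) x) / h ^ (2 * j)) / \<kappa>)"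
      using coer[of x] \<kappa> c' t u by (intro mult_left_mono) (auto simp: X_def field_simps)
    also have "\<dots> = c * (\<Sum>j\<le>m. t * u ^ (2 * m) * (q ((A ^^ j) x) / h ^ (2 * j)) / (fact m)\<^sup>2)"
      using \<kappa> by (simp add: c'_def field_simps sum_distrib_left sum_divide_distrib)
    also have "\<dots> \<le> c * (\<Sum>j\<le>m. t ^ (2 * j + 1) * q (w j))"
    proof (intro mult_left_mono sum_mono)
      fix j assume "j \<in> {..m}"
      then have j: "j \<le> m" by simp
      \<comment> \<open>As \<open>u\<close> is at most 1 and \<open>j \<le> m\<close>, passing from
        \<open>u^(2m)\<close> to \<open>u^(2j)\<close> and from \<open>m!\<close> to
        \<open>j!\<close> can only increase the term.\<close>
      have "t * u ^ (2 * m) * (q ((A ^^ j) x) / h ^ (2 * j)) / (fact m)\<^sup>2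
          \<le> t * u ^ (2 * j) * (q ((A ^^ j) x) / h ^ (2 * j)) / (fact j)\<^sup>2"
        using j t u h
        by (intro frac_le mult_mono mult_left_mono power_decreasing power_mono fact_mono) auto
      also have "\<dots> = t ^ (2 * j + 1) * q (w j)"
        using h by (simp add: u_def w_def q_scaleR power_mult_distrib power_inverse field_simps)
      finally show "t * u ^ (2 * m) * (q ((A ^^ j) x) / h ^ (2 * j)) / (fact m)\<^sup>2 \<le> t ^ (2 * j + 1) * q (w j)" .
    qed (use c in simp)
    also have "\<dots> \<le> integral {0..t} (\<lambda>s. q (p s))"
      unfolding p_def by (rule poly) (rule t)
    also have "\<dots> \<le> integral {0..t} (\<lambda>s. 2 * q (y s) + 2 * (D * u ^ (2 * m + 2) * X))"
    proof (intro integral_le integrable_continuous_real)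
      fix s assume s: "s \<in> {0..t}"
      have "norm (p s - y s) \<le> norm x * (h * K * s) ^ Suc m"
        using solves_taylor[OF lin bnd _ y, of "norm x" s "Suc m"] solves_norm_le[OF diss y] s h K
        by (simp add: p_def w_def x_def norm_minus_commute lessThan_Suc_atMost)
      also have "\<dots> \<le> norm x * (K * u) ^ Suc m"
        using s h K by (intro mult_left_mono power_mono) (auto simp: u_def mult_ac intro!: mult_left_mono)
      finally have "(norm (p s - y s))\<^sup>2 \<le> (norm x * (K * u) ^ Suc m)\<^sup>2"
        by (intro power_mono) auto
      then have "r * (norm (p s - y s))\<^sup>2 \<le> r * (norm x * (K * u) ^ Suc m)\<^sup>2"
        using r_pos by simp
      also have "\<dots> = r * K ^ (2 * m + 2) * u ^ (2 * m + 2) * X"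
        by (simp add: X_def power_mult_distrib power2_eq_square power_add power_mult mult_ac power_even_eq)
      also have "\<dots> \<le> D * u ^ (2 * m + 2) * X"
        using D u X by (intro mult_right_mono) auto
      finally have "q (p s - y s) \<le> D * u ^ (2 * m + 2) * X"
        using q_le[of "p s - y s"] by linarith
      then show "q (p s) \<le> 2 * q (y s) + 2 * (D * u ^ (2 * m + 2) * X)"
        using q_add_le[of "p s - y s" "y s"] by simp
    next
      show "continuous_on {0..t} (\<lambda>s. q (p s))"
        unfolding p_def by (intro continuous_on_q continuous_intros)
      show "continuous_on {0..t} (\<lambda>s. 2 * q (y s) + 2 * (D * u ^ (2 * m + 2) * X))"
        by (intro continuous_intros continuous_on_q_solves[OF y]) auto
    qed
    also have "\<dots> = 2 * integral {0..t} (\<lambda>s. q (y s)) + t * (2 * (D * u ^ (2 * m + 2) * X))"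
      using t by (subst integral_add)
        (auto intro!: integrable_continuous_real continuous_intros continuous_on_q_solves[OF y])
    finally have main: "4 * c' * t * u ^ (2 * m) * X
        \<le> 2 * integral {0..t} (\<lambda>s. q (y s)) + t * (2 * (D * u ^ (2 * m + 2) * X))" .
    have "D * u\<^sup>2 \<le> c'"
      using \<rho>_sq mult_left_mono[OF power_mono[OF u(2,1), of 2], of D] D by linarith
    then have "(D * u\<^sup>2) * (t * u ^ (2 * m) * X) \<le> c' * (t * u ^ (2 * m) * X)"
      using t u X by (intro mult_right_mono) auto
    then have "t * (D * u ^ (2 * m + 2) * X) \<le> c' * t * u ^ (2 * m) * X"
      by (simp add: power_add mult_ac power2_eq_square)
    with main show "c' * t * (h * t) ^ (2 * m) * (norm (y 0))\<^sup>2 \<le> integral {0..t} (\<lambda>s. q (y s))"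
      unfolding X_def x_def u_def by linarith
  qed
qed

text \<open>Instead of the geometric factor of \<open>n\<close> windows, the induction carries the
  weaker factor \<open>1 + \<gamma> n w\<close>, which depends on the elapsed time only. Its
  increment \<open>\<gamma> w\<close> is paid by the loss in one window, using that the norm does
  not increase.\<close>

lemma window_decay:
  assumes A: "dissipative A" and y: "solves A y" and w: "0 \<le> w" and \<gamma>: "0 \<le> \<gamma>"
    and step: "\<And>s. 0 \<le> s \<Longrightarrow> (norm (y (s + w)))\<^sup>2 \<le> (norm (y s))\<^sup>2 - \<gamma> * w * (norm (y s))\<^sup>2"
  shows "(1 + \<gamma> * (real n * w)) * (norm (y (real n * w)))\<^sup>2 \<le> (norm (y 0))\<^sup>2"
proof (induction n)
  case 0
  then show ?case by simp
next
  case (Suc n)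
  let ?N = "\<lambda>n. (norm (y (real n * w)))\<^sup>2"
  have "?N (Suc n) \<le> ?N n"
    using w by (intro power_mono solves_norm_antimono[OF A y]) (auto simp: mult_right_mono)
  then have "\<gamma> * w * (1 + \<gamma> * (real n * w)) * ?N (Suc n) \<le> \<gamma> * w * (1 + \<gamma> * (real n * w)) * ?N n"
    using \<gamma> w by (intro mult_left_mono) auto
  moreover have "(1 + \<gamma> * (real n * w)) * ?N (Suc n) \<le> (1 + \<gamma> * (real n * w)) * (?N n - \<gamma> * w * ?N n)"
    using step[of "real n * w"] \<gamma> w by (intro mult_left_mono) (auto simp: algebra_simps)
  moreover have "0 \<le> (\<gamma> * w) * (\<gamma> * (real n * w)) * ?N (Suc n)" using \<gamma> w by simp
  ultimately show ?case using Suc by (simp add: algebra_simps)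
qed

text \<open>
  For \<open>h t\<close> beyond the range \<open>\<rho>\<close> of the Taylor estimate, the dissipation over about \<open>h t / \<rho>\<close>
  windows of length \<open>\<rho> / h\<close> adds up to a multiple of \<open>t\<close>, which is at least that multiple of \<open>t^(2m+1)\<close>.
\<close>

lemma short_time_decay:
  assumes K: "0 \<le> K" and \<kappa>: "0 < \<kappa>"
  shows "\<exists>c>0. \<exists>\<tau>>0. c * \<tau> ^ (2 * m + 1) \<le> 1 \<and> (\<forall>h A y t. 1 \<le> h \<longrightarrow> coercive_generator K \<kappa> m h A \<longrightarrow>
    solves A y \<longrightarrow> 0 \<le> t \<longrightarrow> t \<le> \<tau> \<longrightarrow>
    (norm (y t))\<^sup>2 \<le> (1 - c * t ^ (2 * m + 1)) * (norm (y 0))\<^sup>2)"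
proof -
  obtain c0 \<rho> where c0: "0 < c0" and \<rho>: "0 < \<rho>"
    and short: "\<And>h A y t. 1 \<le> h \<Longrightarrow> coercive_generator K \<kappa> m h A \<Longrightarrow> solves A y \<Longrightarrow>
      0 \<le> t \<Longrightarrow> h * t \<le> \<rho> \<Longrightarrow>
      c0 * t * (h * t) ^ (2 * m) * (norm (y 0))\<^sup>2 \<le> integral {0..t} (\<lambda>s. q (y s))"
    using dissipation_short_time[OF K \<kappa>, of m] by blast
  \<comment> \<open>\<open>k\<close> is the guaranteed dissipation per unit time and unit energy
    over a window with \<open>h w = \<rho>\<close>. The two bounds on \<open>c\<close> serve the
    cases \<open>h t \<le> \<rho>\<close> and \<open>h t > \<rho>\<close>.\<close>
  define k where "k = c0 * \<rho> ^ (2 * m)"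
  define c where "c = min (2 * c0) (k / 2)"
  \<comment> \<open>The bound 1 gives \<open>t^(2m+1) \<le> t\<close>, the bound
    \<open>1 / k\<close> linearises \<open>1 / (1 + k t)\<close>, and \<open>1 / c\<close> keeps the
    final decay factor nonnegative.\<close>
  define \<tau> where "\<tau> = min (min 1 (1 / k)) (1 / c)"
  have k: "0 < k" using c0 \<rho> by (simp add: k_def)
  have c: "0 < c" "c \<le> 2 * c0" "c \<le> k / 2" using c0 k by (auto simp: c_def)
  have \<tau>: "0 < \<tau>" "\<tau> \<le> 1" "\<tau> \<le> 1 / k" "\<tau> \<le> 1 / c" using k c by (auto simp: \<tau>_def)
  have pow_le: "t ^ (2 * m + 1) \<le> t" if "0 \<le> t" "t \<le> \<tau>" for t
    using power_decreasing[of 1 "2 * m + 1" t] that \<tau> by simp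
  show ?thesis
  proof (rule exI[of _ c], rule conjI, fact, rule exI[of _ \<tau>], intro conjI allI impI)
    show "0 < \<tau>" by fact
    have "c * \<tau> ^ (2 * m + 1) \<le> c * (1 / c)"
      using pow_le[of \<tau>] \<tau> c by (intro mult_left_mono) linarith+
    then show "c * \<tau> ^ (2 * m + 1) \<le> 1" using c by simp
  next
    fix h t :: real and A y
    assume h: "1 \<le> h" and A: "coercive_generator K \<kappa> m h A" and y: "solves A y"
      and t: "0 \<le> t" "t \<le> \<tau>"
    have diss: "dissipative A" using A by (simp add: coercive_generator_def)
    have Y: "0 \<le> (norm (y 0))\<^sup>2" by simp
    show "(norm (y t))\<^sup>2 \<le> (1 - c * t ^ (2 * m + 1)) * (norm (y 0))\<^sup>2"
    proof (cases "h * t \<le> \<rho>")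
      case True
      have "t ^ (2 * m) \<le> (h * t) ^ (2 * m)"
        using h t mult_right_mono[of 1 h t] by (intro power_mono) auto
      then have "c * (t * t ^ (2 * m)) \<le> 2 * c0 * (t * (h * t) ^ (2 * m))"
        using c t c0 h by (intro mult_mono) auto
      then have "c * t ^ (2 * m + 1) * (norm (y 0))\<^sup>2 \<le> 2 * (c0 * t * (h * t) ^ (2 * m) * (norm (y 0))\<^sup>2)"
        using mult_right_mono[OF _ Y] by fastforce
      then show ?thesis
        using short[OF h A y t(1) True] solves_energy[OF diss y t(1)]
        unfolding left_diff_distrib by linarith
    next
      case False
      define w where "w = \<rho> / h"
      have w: "0 < w" "h * w = \<rho>" "w < t" using \<rho> h False by (auto simp: w_def field_simps)
      define n where "n = nat \<lfloor>t / w\<rfloor>"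
      have "1 \<le> t / w" using w by simp
      then have "1 \<le> \<lfloor>t / w\<rfloor>" by simp
      then have n: "real n \<le> t / w" "t / w < real n + 1" "1 \<le> real n"
        unfolding n_def by linarith+
      have nw: "real n * w \<le> t" using n(1) w by (simp add: pos_le_divide_eq)
      have "t < (real n + 1) * w" using n(2) w by (simp add: pos_divide_less_eq)
      \<comment> \<open>At least one full window fits into the time \<open>t\<close>, so the
        leftover is shorter than the part covered and at least half of \<open>t\<close> is
        used.\<close>
      then have nw2: "t / 2 \<le> real n * w"
        using mult_right_mono[OF n(3) less_imp_le[OF w(1)]] by (simp only: distrib_right)
      have "(norm (y (s + w)))\<^sup>2 \<le> (norm (y s))\<^sup>2 - (2 * k) * w * (norm (y s))\<^sup>2" if "0 \<le> s" for s
        using short[OF h A solves_shift[OF y that], of w] solves_energy[OF diss solves_shift[OF y that], of w] w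
        by (simp add: k_def mult_ac)
      from window_decay[OF diss y _ _ this, of n]
      have "(1 + 2 * k * (real n * w)) * (norm (y (real n * w)))\<^sup>2 \<le> (norm (y 0))\<^sup>2"
        using w k by simp
      moreover have "(1 + k * t) * (norm (y t))\<^sup>2 \<le> (1 + 2 * k * (real n * w)) * (norm (y (real n * w)))\<^sup>2"
        using nw k w t mult_left_mono[OF nw2, of "2 * k"]
        by (intro mult_mono power_mono solves_norm_antimono[OF diss y]) auto
      ultimately have *: "(1 + k * t) * (norm (y t))\<^sup>2 \<le> (norm (y 0))\<^sup>2" by linarith
      have kt: "0 \<le> k * t" "k * t \<le> 1"
        using k t \<tau> mult_left_mono[of t "1 / k" k] by auto
      \<comment> \<open>For \<open>k t\<close> in the unit interval, \<open>1 / (1 + k t)\<close> is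
        at most \<open>1 - k t / 2\<close>.\<close>
      have "0 \<le> (k * t) * (1 - k * t)" by (rule mult_nonneg_nonneg[OF kt(1)]) (use kt in simp)
      then have "1 \<le> (1 - k * t / 2) * (1 + k * t)" by (simp add: algebra_simps)
      from mult_right_mono[OF this, of "(norm (y t))\<^sup>2"]
      have "(norm (y t))\<^sup>2 \<le> (1 - k * t / 2) * ((1 + k * t) * (norm (y t))\<^sup>2)"
        by (simp add: mult_ac)
      also have "\<dots> \<le> (1 - k * t / 2) * (norm (y 0))\<^sup>2"
        using * kt by (intro mult_left_mono) auto
      also have "\<dots> \<le> (1 - c * t ^ (2 * m + 1)) * (norm (y 0))\<^sup>2"
        using mult_mono[OF c(3) pow_le[OF t]] k t by (intro mult_right_mono) auto
      finally show ?thesis .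
    qed
  qed
qed

text \<open>The first \<open>m\<close> Taylor terms contribute to the form at most a multiple of
  \<delta>. The remainder has size \<open>(L t)^m\<close>, so its form is of order
  \<open>t^(2m)\<close>, and integration over time supplies the last power of
  \<open>t\<close>.\<close>

lemma slow_decay:
  assumes A: "dissipative A" and L: "0 \<le> L" "\<And>x. norm (A x) \<le> L * norm x"
    and y: "solves A y" "norm (y 0) = 1" and \<delta>: "(\<Sum>j<m. q ((A ^^ j) (y 0))) \<le> \<delta>"
    and t: "0 \<le> t" "t \<le> 1"
  shows "1 - 4 * 2 ^ m * \<delta> - 4 * r * L ^ (2 * m) * t ^ (2 * m + 1) \<le> (norm (y t))\<^sup>2"
proof -
  have "integral {0..t} (\<lambda>s. q (y s)) \<le> integral {0..t} (\<lambda>s. 2 * 2 ^ m * \<delta> + 2 * (r * L ^ (2 * m) * t ^ (2 * m)))"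
  proof (intro integral_le integrable_continuous_real continuous_on_q_solves[OF y(1)] continuous_intros)
    fix s assume s: "s \<in> {0..t}"
    define p where "p = (\<Sum>j<m. s ^ j *\<^sub>R ((A ^^ j) (y 0) /\<^sub>R fact j))"
    have "norm (y s - p) \<le> 1 * (L * s) ^ m"
      unfolding p_def using A solves_norm_le[OF A y(1)] y(2) s
      by (intro solves_taylor[OF _ L(2,1) y(1)]) (auto simp: dissipative_def)
    also have "\<dots> \<le> L ^ m * t ^ m"
      using s L by (simp add: power_mult_distrib mult_left_mono power_mono)
    finally have "(norm (y s - p))\<^sup>2 \<le> (L ^ m * t ^ m)\<^sup>2" by (intro power_mono) auto
    then have "r * (norm (y s - p))\<^sup>2 \<le> r * (L ^ (2 * m) * t ^ (2 * m))"
      using r_pos by (simp add: power_mult_distrib power_even_eq)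
    then have 1: "q (y s - p) \<le> r * L ^ (2 * m) * t ^ (2 * m)"
      using q_le[of "y s - p"] by simp
    have "q p \<le> 2 ^ m * (\<Sum>j<m. q (s ^ j *\<^sub>R ((A ^^ j) (y 0) /\<^sub>R fact j)))"
      unfolding p_def using q_sum_le[of "{..<m}"] by simp
    also have "\<dots> \<le> 2 ^ m * (\<Sum>j<m. q ((A ^^ j) (y 0)))"
    proof (intro mult_left_mono sum_mono)
      fix j
      have "(s ^ j * inverse (fact j))\<^sup>2 \<le> 1"
        using s t by (intro power_le_one mult_le_one) (auto simp: inverse_le_1_iff power_le_one)
      from mult_right_mono[OF this q_nonneg[of "(A ^^ j) (y 0)"]]
      show "q (s ^ j *\<^sub>R ((A ^^ j) (y 0) /\<^sub>R fact j)) \<le> q ((A ^^ j) (y 0))"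
        by (simp add: q_scaleR power_mult_distrib mult_ac)
    qed simp
    also have "\<dots> \<le> 2 ^ m * \<delta>" using \<delta> by simp
    finally show "q (y s) \<le> 2 * 2 ^ m * \<delta> + 2 * (r * L ^ (2 * m) * t ^ (2 * m))"
      using q_add_le[of p "y s - p"] 1 by simp
  qed auto
  also have "\<dots> = t * (2 * 2 ^ m * \<delta>) + 2 * r * L ^ (2 * m) * t ^ (2 * m + 1)"
    using t by (simp add: algebra_simps)
  also have "\<dots> \<le> 2 * 2 ^ m * \<delta> + 2 * r * L ^ (2 * m) * t ^ (2 * m + 1)"
  proof -
    have "0 \<le> \<delta>" by (rule order_trans[OF _ \<delta>]) (intro sum_nonneg, simp)
    then show ?thesis using t mult_right_mono[of t 1 "2 * 2 ^ m * \<delta>"] by simp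
  qed
  finally show ?thesis using solves_energy[OF A y(1) t(1)] y(2) by simp
qed

text \<open>The functional \<open>V\<close>, the sum of \<open>|A^j y|^2 / h^(2j)\<close>, lies
  between \<open>|y|^2\<close> and \<open>M |y|^2\<close> with \<open>M\<close> free of
  \<open>h\<close>, because the powers of \<open>h\<close> cancel. Its derivative is minus twice the
  coercive sum, hence at most \<open>- 2 \<kappa> |y|^2\<close>.\<close>

lemma exponential_decay:
  assumes K: "0 \<le> K" and \<kappa>: "0 < \<kappa>"
  shows "\<exists>M>0. \<exists>\<omega>>0. \<forall>h A y t. 1 \<le> h \<longrightarrow> coercive_generator K \<kappa> m h A \<longrightarrow> solves A y \<longrightarrow> 0 \<le> t \<longrightarrow>
    (norm (y t))\<^sup>2 \<le> M * exp (- \<omega> * t) * (norm (y 0))\<^sup>2"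
proof -
  define M where "M = (\<Sum>j\<le>m. K ^ (2 * j))"
  have M1: "1 \<le> M"
    unfolding M_def using K member_le_sum[of 0 "{..m}" "\<lambda>j. K ^ (2 * j)"] by simp
  define \<omega> where "\<omega> = 2 * \<kappa> / M"
  have M: "0 < M" and \<omega>: "0 < \<omega>" using M1 \<kappa> by (auto simp: \<omega>_def)
  show ?thesis
  proof (rule exI[of _ M], rule conjI, fact, rule exI[of _ \<omega>], intro conjI allI impI)
    show "0 < \<omega>" by fact
  next
    fix h t :: real and A y
    assume h: "1 \<le> h" and A: "coercive_generator K \<kappa> m h A" and y: "solves A y" and t: "0 \<le> t"
    have diss: "dissipative A" and lin: "bounded_linear A"
      and bnd: "\<And>x. norm (A x) \<le> h * K * norm x"
      and coer: "\<And>x. \<kappa> * (norm x)\<^sup>2 \<le> (\<Sum>j\<le>m. q ((A ^^ j) x) / h ^ (2 * j))"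
      using A by (auto simp: coercive_generator_def dissipative_def)
    have pow: "solves A (\<lambda>t. (A ^^ j) (y t))" for j
      by (induction j) (auto intro: y solves_image lin)
    have bnd_pow: "norm ((A ^^ j) x) \<le> (h * K) ^ j * norm x" for j x
      using h K by (intro norm_funpow_le bnd) simp
    define V where "V t = (\<Sum>j\<le>m. (norm ((A ^^ j) (y t)))\<^sup>2 / h ^ (2 * j))" for t
    have V_ge: "(norm (y t))\<^sup>2 \<le> V t" for t
      unfolding V_def using h member_le_sum[of 0 "{..m}" "\<lambda>j. (norm ((A ^^ j) (y t)))\<^sup>2 / h ^ (2 * j)"] by simp
    have V_le: "V t \<le> M * (norm (y t))\<^sup>2" for t
      unfolding V_def M_def sum_distrib_right
    proof (intro sum_mono)
      fix j
      have "(norm ((A ^^ j) (y t)))\<^sup>2 \<le> ((h * K) ^ j * norm (y t))\<^sup>2"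
        by (intro power_mono bnd_pow) simp
      also have "\<dots> = h ^ (2 * j) * (K ^ (2 * j) * (norm (y t))\<^sup>2)"
        by (simp add: power_mult_distrib power_even_eq)
      finally show "(norm ((A ^^ j) (y t)))\<^sup>2 / h ^ (2 * j) \<le> K ^ (2 * j) * (norm (y t))\<^sup>2"
        using h by (simp add: divide_le_eq mult_ac)
    qed
    define V' where "V' t = (\<Sum>j\<le>m. - 2 * q ((A ^^ j) (y t)) / h ^ (2 * j))" for t
    have V': "(V has_real_derivative V' s) (at s)" if "0 < s" for s
      unfolding V_def V'_def
    proof (intro DERIV_sum DERIV_cdivide)
      fix j
      show "((\<lambda>t. (norm ((A ^^ j) (y t)))\<^sup>2) has_real_derivative - 2 * q ((A ^^ j) (y s))) (at s)"
        using solves_norm_square_deriv[OF pow[of j] that] diss by (simp add: dissipative_def)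
    qed
    have V'_le: "V' s \<le> - \<omega> * V s" for s
    proof -
      have "\<omega> * V s \<le> 2 * \<kappa> * (norm (y s))\<^sup>2"
        using V_le[of s] M1 \<kappa> by (simp add: \<omega>_def field_simps)
      moreover have "V' s = - 2 * (\<Sum>j\<le>m. q ((A ^^ j) (y s)) / h ^ (2 * j))"
        by (simp add: V'_def sum_distrib_left sum_negf)
      ultimately show ?thesis using coer[of "y s"] by simp
    qed
    \<comment> \<open>Gronwall's argument: the differential inequality makes
      \<open>exp (\<omega> t) V t\<close> nonincreasing.\<close>
    have "exp (\<omega> * t) * V t \<le> exp (\<omega> * 0) * V 0"
    proof (rule DERIV_nonpos_imp_decreasing_open[OF t])
      fix s assume s: "0 < s" "s < t"
      have "((\<lambda>t. exp (\<omega> * t) * V t) has_real_derivative exp (\<omega> * s) * (\<omega> * V s + V' s)) (at s)"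
        using V'[OF s(1)] by (auto intro!: derivative_eq_intros simp: algebra_simps)
      moreover have "exp (\<omega> * s) * (\<omega> * V s + V' s) \<le> 0"
        using V'_le[of s] by (intro mult_nonneg_nonpos) auto
      ultimately show "\<exists>d. ((\<lambda>t. exp (\<omega> * t) * V t) has_real_derivative d) (at s) \<and> d \<le> 0" by blast
    next
      show "continuous_on {0..t} (\<lambda>t. exp (\<omega> * t) * V t)"
        unfolding V_def
        by (intro continuous_intros continuous_on_subset[OF solves_continuous_on[OF pow]])
           (use h in auto)
    qed
    then have "V t \<le> exp (- \<omega> * t) * V 0"
      by (simp add: exp_minus field_simps)
    also have "\<dots> \<le> exp (- \<omega> * t) * (M * (norm (y 0))\<^sup>2)"
      by (intro mult_left_mono V_le) simp
    finally show "(norm (y t))\<^sup>2 \<le> M * exp (- \<omega> * t) * (norm (y 0))\<^sup>2"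
      using V_ge[of t] by (simp add: mult_ac)
  qed
qed

end

section \<open>Strongly continuous semigroups\<close>

text \<open>By Baire's theorem one of the closed sets \<open>S k\<close>, which cover the space,
  contains a ball. Writing a small vector as the difference of \<open>a + z\<close> and the centre
  \<open>a\<close> moves the bound to a ball around 0.\<close>

theorem banach_steinhaus_sequence:
  fixes F :: "nat \<Rightarrow> 'a::{real_normed_vector,complete_space} \<Rightarrow> 'b::real_normed_vector"
  assumes lin: "\<And>n. bounded_linear (F n)" and bdd: "\<And>x. \<exists>B. \<forall>n. norm (F n x) \<le> B"
  shows "\<exists>B. \<forall>n x. norm (F n x) \<le> B * norm x"
proof -
  define S where "S k = {x. \<forall>n. norm (F n x) \<le> real k}" for k
  have closed: "closed (S k)" for k
    unfolding S_def
    by (intro closed_Collect_all closed_Collect_le continuous_intros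
        linear_continuous_on[OF lin] continuous_on_norm)
  have "(\<Union>k. S k) = UNIV"
  proof (intro set_eqI iffI UNIV_I)
    fix x
    obtain B where "\<And>n. norm (F n x) \<le> B" using bdd by blast
    moreover obtain k where "B \<le> real k" using real_arch_simple by blast
    ultimately have "x \<in> S k" unfolding S_def using order_trans by blast
    then show "x \<in> (\<Union>k. S k)" by blast
  qed
  moreover have "completely_metrizable_space (euclidean :: 'a topology)"
    by (rule completely_metrizable_space_euclidean)
  ultimately obtain k where "interior (S k) \<noteq> {}"
    using Baire_category_alt[of "euclidean :: 'a topology" "range S"] closed by fastforce
  then obtain a e where e: "0 < e" and ball: "cball a e \<subseteq> S k"
    by (metis equals0I mem_interior_cball)
  have "norm (F n x) \<le> (2 * real k / e) * norm x" for n x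
  proof (cases "x = 0")
    case True
    then show ?thesis by (simp add: linear_simps[OF lin])
  next
    case False
    define z where "z = (e / norm x) *\<^sub>R x"
    have "a + z \<in> S k" "a \<in> S k"
      using ball False e by (auto simp: z_def dist_norm subset_eq)
    then have "norm (F n (a + z)) \<le> real k" "norm (F n a) \<le> real k"
      by (auto simp: S_def)
    then have "norm (F n z) \<le> 2 * real k"
      using norm_triangle_ineq4[of "F n (a + z)" "F n a"] by (simp add: linear_simps[OF lin])
    then show ?thesis
      using False e by (simp add: z_def linear_simps[OF lin] field_simps)
  qed
  then show ?thesis by blast
qed

text \<open>Only the values of \<open>T t\<close> on \<open>V\<close> are specified. Composing with
  a bounded linear \<open>p\<close> into \<open>V\<close> yields a genuine bounded linear map on the
  whole type, to which Banach-Steinhaus applies.\<close>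

lemma c0_semigroup_bounded_linear:
  fixes T :: "real \<Rightarrow> 'a::complex_inner \<Rightarrow> 'a"
  assumes T: "c0_semigroup_on V T" and t: "0 \<le> t"
    and p: "bounded_linear p" "\<And>x. p x \<in> V"
  shows "bounded_linear (\<lambda>x. T t (p x))"
proof -
  have "bounded_clinear_on V (T t)" using T t by (simp add: c0_semigroup_on_def)
  then have add: "\<And>x y. x \<in> V \<Longrightarrow> y \<in> V \<Longrightarrow> T t (x + y) = T t x + T t y"
    and scale: "\<And>c x. x \<in> V \<Longrightarrow> T t (c *\<^sub>C x) = c *\<^sub>C T t x"
    and "\<exists>K. \<forall>x\<in>V. norm (T t x) \<le> K * norm x"
    by (simp_all add: bounded_clinear_on_def)
  then obtain K where K: "\<And>x. x \<in> V \<Longrightarrow> norm (T t x) \<le> K * norm x" by blast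
  obtain P where P: "\<And>x. norm (p x) \<le> norm x * P" using bounded_linear.bounded[OF p(1)] by blast
  show ?thesis
  proof (rule bounded_linear_intro)
    fix x y r
    show "T t (p (x + y)) = T t (p x) + T t (p y)"
      using add p by (simp add: linear_simps[OF p(1)])
    show "T t (p (r *\<^sub>R x)) = r *\<^sub>R T t (p x)"
      using scale[of "p x" "complex_of_real r"] p by (simp add: linear_simps[OF p(1)] scaleC_of_real)
    have "norm (T t (p x)) \<le> \<bar>K\<bar> * norm (p x)"
      using K[OF p(2), of x] mult_right_mono[OF abs_ge_self[of K] norm_ge_zero[of "p x"]] by linarith
    also have "\<dots> \<le> \<bar>K\<bar> * (norm x * P)" by (intro mult_left_mono P) simp
    finally show "norm (T t (p x)) \<le> norm x * (\<bar>K\<bar> * P)" by (simp add: mult_ac)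
  qed
qed

text \<open>Otherwise there are times \<open>t n\<close> tending to 0 at which
  \<open>T (t n)\<close> stretches some vector of \<open>V\<close> by more than \<open>n\<close>.
  Strong continuity makes these operators pointwise bounded, which contradicts
  Banach-Steinhaus.\<close>

lemma c0_semigroup_bounded_near_0:
  fixes T :: "real \<Rightarrow> 'a::chilbert_space \<Rightarrow> 'a"
  assumes T: "c0_semigroup_on V T"
    and p: "bounded_linear p" "\<And>x. p x \<in> V" "\<And>x. x \<in> V \<Longrightarrow> p x = x"
  shows "\<exists>\<delta>>0. \<exists>M. \<forall>t x. 0 \<le> t \<longrightarrow> t \<le> \<delta> \<longrightarrow> x \<in> V \<longrightarrow> norm (T t x) \<le> M * norm x"
proof (rule ccontr)
  assume "\<not> ?thesis"
  then have "\<exists>t x. 0 \<le> t \<and> t \<le> 1 / real (Suc n) \<and> x \<in> V \<and> real n * norm x < norm (T t x)" for n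
    by (metis divide_pos_pos not_le of_nat_0_less_iff zero_less_Suc zero_less_one)
  then obtain t x where t: "\<And>n. 0 \<le> t n" "\<And>n. t n \<le> 1 / real (Suc n)"
    and x: "\<And>n. x n \<in> V" "\<And>n. real n * norm (x n) < norm (T (t n) (x n))"
    by metis
  have "t \<longlonglongrightarrow> 0"
    by (rule real_tendsto_sandwich[OF _ _ tendsto_const lim_1_over_n[THEN LIMSEQ_Suc]])
       (use t in auto)
  have "\<exists>B. \<forall>n. norm (T (t n) (p z)) \<le> B" for z
  proof -
    have T0: "T 0 (p z) = p z" and lim: "((\<lambda>t. T t (p z)) \<longlongrightarrow> p z) (at_right 0)"
      using T p by (auto simp: c0_semigroup_on_def)
    have "((\<lambda>t. T t (p z)) \<longlongrightarrow> T 0 (p z)) (at 0 within {0..})"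
      using lim T0 by (simp add: at_within_Ici_at_right)
    \<comment> \<open>Continuity at 0, including the value there, is used because some
      \<open>t n\<close> may equal 0.\<close>
    then have "continuous (at 0 within {0..}) (\<lambda>t. T t (p z))"
      by (simp add: continuous_within)
    from continuous_within_tendsto_compose'[OF this _ \<open>t \<longlonglongrightarrow> 0\<close>]
    have "(\<lambda>n. T (t n) (p z)) \<longlonglongrightarrow> T 0 (p z)" using t by simp
    then have "Bseq (\<lambda>n. T (t n) (p z))" by (rule convergent_imp_Bseq[OF convergentI])
    then show ?thesis unfolding Bseq_def by blast
  qed
  then obtain B where B: "\<And>n z. norm (T (t n) (p z)) \<le> B * norm z"
    using banach_steinhaus_sequence[of "\<lambda>n z. T (t n) (p z)"] c0_semigroup_bounded_linear[OF T t(1) p(1,2)]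
    by blast
  obtain n where n: "B \<le> real n" using real_arch_simple by blast
  have "norm (T (t n) (x n)) \<le> B * norm (x n)" using B[of n "x n"] p(3)[OF x(1)] by simp
  also have "\<dots> \<le> real n * norm (x n)" using n by (intro mult_right_mono) auto
  finally show False using x(2)[of n] by simp
qed

text \<open>The bound near 0 is propagated by the semigroup law in steps of length \<delta>.\<close>

lemma c0_semigroup_locally_bounded:
  fixes T :: "real \<Rightarrow> 'a::chilbert_space \<Rightarrow> 'a"
  assumes T: "c0_semigroup_on V T"
    and p: "bounded_linear p" "\<And>x. p x \<in> V" "\<And>x. x \<in> V \<Longrightarrow> p x = x"
  shows "\<exists>M. \<forall>t x. 0 \<le> t \<longrightarrow> t \<le> a \<longrightarrow> x \<in> V \<longrightarrow> norm (T t x) \<le> M * norm x"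
proof -
  obtain \<delta> M where \<delta>: "0 < \<delta>" and M: "\<And>t x. 0 \<le> t \<Longrightarrow> t \<le> \<delta> \<Longrightarrow> x \<in> V \<Longrightarrow> norm (T t x) \<le> M * norm x"
    using c0_semigroup_bounded_near_0[OF T p] by blast
  have semi: "\<And>s t x. 0 \<le> s \<Longrightarrow> 0 \<le> t \<Longrightarrow> x \<in> V \<Longrightarrow> T (s + t) x = T s (T t x)"
    and inV: "\<And>t x. 0 \<le> t \<Longrightarrow> x \<in> V \<Longrightarrow> T t x \<in> V"
    using T by (auto simp: c0_semigroup_on_def bounded_clinear_on_def)
  have "\<exists>M'. \<forall>t x. 0 \<le> t \<longrightarrow> t \<le> real n * \<delta> \<longrightarrow> x \<in> V \<longrightarrow> norm (T t x) \<le> M' * norm x" for n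
  proof (induction n)
    case 0
    have "T 0 x = x" if "x \<in> V" for x using T that by (simp add: c0_semigroup_on_def)
    then show ?case by (intro exI[of _ 1]) auto
  next
    case (Suc n)
    then obtain M' where M': "\<And>t x. 0 \<le> t \<Longrightarrow> t \<le> real n * \<delta> \<Longrightarrow> x \<in> V \<Longrightarrow> norm (T t x) \<le> M' * norm x"
      by blast
    have "norm (T t x) \<le> max M (\<bar>M'\<bar> * M) * norm x" if t: "0 \<le> t" "t \<le> real (Suc n) * \<delta>" and x: "x \<in> V" for t x
    proof (cases "t \<le> \<delta>")
      case True
      have "M * norm x \<le> max M (\<bar>M'\<bar> * M) * norm x" by (intro mult_right_mono) auto
      then show ?thesis using M[OF t(1) True x] by linarith
    next
      case False
      then have "T t x = T (t - \<delta>) (T \<delta> x)" using semi[of "t - \<delta>" \<delta> x] \<delta> x by simp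
      also have "norm \<dots> \<le> M' * norm (T \<delta> x)"
        using False \<delta> t x by (intro M' inV) (auto simp: algebra_simps)
      also have "\<dots> \<le> \<bar>M'\<bar> * (M * norm x)"
        using M[of \<delta> x] \<delta> x by (intro mult_mono) auto
      also have "\<dots> \<le> max M (\<bar>M'\<bar> * M) * norm x"
        unfolding mult.assoc[symmetric] by (intro mult_right_mono) auto
      finally show ?thesis .
    qed
    then show ?case by blast
  qed
  moreover obtain n where "a \<le> real n * \<delta>"
    using real_arch_simple[of "a / \<delta>"] \<delta> by (auto simp: field_simps)
  ultimately show ?thesis by (meson order_trans)
qed

text \<open>Since \<open>T t\<close> commutes with the difference quotients at 0, the orbit stays in
  the domain and has right derivative \<open>T t (A x)\<close>. A left derivative at
  \<open>t\<close> means factoring out \<open>T s\<close> with varying \<open>s < t\<close>, for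
  which a bound uniform in \<open>s\<close> is required; this is where local boundedness
  enters.\<close>

lemma generated_semigroup_deriv:
  fixes T :: "real \<Rightarrow> 'a::chilbert_space \<Rightarrow> 'a"
  assumes gen: "generates_on V D A T" and cl: "closed V" "\<And>x y. x \<in> V \<Longrightarrow> y \<in> V \<Longrightarrow> x + y \<in> V"
      "\<And>c x. x \<in> V \<Longrightarrow> c *\<^sub>C x \<in> V"
    and p: "bounded_linear p" "\<And>x. p x \<in> V" "\<And>x. x \<in> V \<Longrightarrow> p x = x"
    and x: "x \<in> D" and t: "0 \<le> t"
  shows "T t x \<in> D \<and> ((\<lambda>t. T t x) has_vector_derivative A (T t x)) (at t within {0..})"
proof -
  have T: "c0_semigroup_on V T"
    and D: "D = {x \<in> V. \<exists>y\<in>V. ((\<lambda>t. (T t x - x) /\<^sub>R t) \<longlongrightarrow> y) (at_right 0)}"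
    and A: "\<And>x. x \<in> D \<Longrightarrow> ((\<lambda>t. (T t x - x) /\<^sub>R t) \<longlongrightarrow> A x) (at_right 0)"
    using gen unfolding generates_on_def by blast+
  have semi: "\<And>s t x. 0 \<le> s \<Longrightarrow> 0 \<le> t \<Longrightarrow> x \<in> V \<Longrightarrow> T (s + t) x = T s (T t x)"
    and inV: "\<And>t x. 0 \<le> t \<Longrightarrow> x \<in> V \<Longrightarrow> T t x \<in> V"
    and lim0: "\<And>x. x \<in> V \<Longrightarrow> ((\<lambda>t. T t x) \<longlongrightarrow> x) (at_right 0)"
    using T by (auto simp: c0_semigroup_on_def bounded_clinear_on_def)
  have xV: "x \<in> V" using x D by blast
  obtain z where z: "z \<in> V" "((\<lambda>t. (T t x - x) /\<^sub>R t) \<longlongrightarrow> z) (at_right 0)"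
    using x D by blast
  \<comment> \<open>That \<open>A\<close> maps the domain into \<open>V\<close> follows from
    uniqueness of limits, as the domain is defined by a limit in \<open>V\<close>.\<close>
  have AxV: "A x \<in> V"
    using tendsto_unique[OF _ z(2) A[OF x]] z(1) by simp
  have sub: "u - v \<in> V" if "u \<in> V" "v \<in> V" for u v
    using cl(2)[OF that(1) cl(3)[OF that(2), of "complex_of_real (-1)"]] unfolding scaleC_of_real by simp
  have scale: "r *\<^sub>R u \<in> V" if "u \<in> V" for r u
    using cl(3)[OF that, of "complex_of_real r"] by (simp add: scaleC_of_real)
  define G where "G s u = T s (p u)" for s u
  have G: "bounded_linear (G s)" if "0 \<le> s" for s
    unfolding G_def by (rule c0_semigroup_bounded_linear[OF T that p(1,2)])
  have GT: "G s u = T s u" if "u \<in> V" for s u using p(3)[OF that] by (simp add: G_def)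
  have T_diff: "T s (u - v) = T s u - T s v" and T_scale: "T s (r *\<^sub>R u) = r *\<^sub>R T s u"
    if "0 \<le> s" "u \<in> V" "v \<in> V" for s u v r
    using linear_diff[OF bounded_linear.linear[OF G[OF that(1)]], of u v]
      linear_scale[OF bounded_linear.linear[OF G[OF that(1)]], of r u]
      GT that sub scale by auto
  have right: "((\<lambda>h. (T h (T t x) - T t x) /\<^sub>R h) \<longlongrightarrow> T t (A x)) (at_right 0)"
  proof (rule Lim_transform_eventually)
    show "((\<lambda>h. G t ((T h x - x) /\<^sub>R h)) \<longlongrightarrow> T t (A x)) (at_right 0)"
      using bounded_linear.tendsto[OF G[OF t] A[OF x]] GT[OF AxV] by simp
    show "\<forall>\<^sub>F h in at_right 0. G t ((T h x - x) /\<^sub>R h) = (T h (T t x) - T t x) /\<^sub>R h"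
      using eventually_at_right_less
    proof eventually_elim
      case (elim h)
      have "T h (T t x) = T t (T h x)"
        using semi[of h t x] semi[of t h x] elim t xV by (simp add: add.commute)
      then show ?case
        using elim t xV by (simp add: GT scale sub inV T_diff T_scale)
    qed
  qed
  have TD: "T t x \<in> D"
    using right inV[OF t xV] inV[OF t AxV] unfolding D by blast
  have AT: "A (T t x) = T t (A x)"
    using tendsto_unique[OF _ A[OF TD] right] by simp
  obtain M where M: "\<And>s u. 0 \<le> s \<Longrightarrow> s \<le> t + 1 \<Longrightarrow> u \<in> V \<Longrightarrow> norm (T s u) \<le> M * norm u"
    using c0_semigroup_locally_bounded[OF T p, of "t + 1"] by blast
  define M' where "M' = max M 0"
  have M': "norm (T s u) \<le> M' * norm u" if "0 \<le> s" "s \<le> t + 1" "u \<in> V" for s u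
    using M[OF that] mult_right_mono[of M M' "norm u"] by (simp add: M'_def)
  \<comment> \<open>\<open>\<phi> h\<close> is the error of the difference quotient at 0, and
    \<open>\<psi> h\<close> a single modulus that covers errors on both sides of
    \<open>t\<close>.\<close>
  define \<phi> where "\<phi> h = (T h x - x) /\<^sub>R h - A x" for h
  define \<psi> where "\<psi> h = M' * (norm (\<phi> h) + norm (T h (A x) - A x))" for h
  have "(\<psi> \<longlongrightarrow> M' * (norm (A x - A x) + norm (A x - A x))) (at_right 0)"
    unfolding \<psi>_def \<phi>_def by (intro tendsto_intros A[OF x] lim0 AxV)
  then have \<psi>_lim: "(\<psi> \<longlongrightarrow> 0) (at_right 0)" by simp
  have \<phi>V: "\<phi> h \<in> V" if "0 \<le> h" for h
    unfolding \<phi>_def using that xV AxV by (intro sub scale inV)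
  have hphi: "T h x = x + h *\<^sub>R (\<phi> h + A x)" if "0 < h" for h
    using that by (simp add: \<phi>_def)
  have bound: "norm (T s x - (T t x + (s - t) *\<^sub>R T t (A x))) \<le> \<bar>s - t\<bar> * \<psi> \<bar>s - t\<bar>"
    if s: "0 \<le> s" "s \<le> t + 1" "s \<noteq> t" for s
  proof (cases "t < s")
    case True
    define h where "h = s - t"
    have h: "0 < h" using True by (simp add: h_def)
    have "T s x = T t (T h x)" using semi[of t h x] t h xV by (simp add: h_def)
    \<comment> \<open>Everything is written with differences and scalar multiples so that
      \<open>T_diff\<close> and \<open>T_scale\<close> apply.\<close>
    also have "T h x = x - (- h) *\<^sub>R (\<phi> h - (- 1) *\<^sub>R A x)" using hphi[OF h] by simp
    also have "T t \<dots> = T t x - (- h) *\<^sub>R (T t (\<phi> h) - (- 1) *\<^sub>R T t (A x))"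
      using t h xV AxV by (simp only: T_diff T_scale sub scale \<phi>V less_imp_le)
    finally have "T s x - (T t x + h *\<^sub>R T t (A x)) = h *\<^sub>R T t (\<phi> h)"
      by (simp add: algebra_simps)
    then have "norm (T s x - (T t x + (s - t) *\<^sub>R T t (A x))) = \<bar>s - t\<bar> * norm (T t (\<phi> h))"
      using h by (simp add: h_def)
    also have "\<dots> \<le> \<bar>s - t\<bar> * (M' * norm (\<phi> h))"
      using t h by (intro mult_left_mono M' \<phi>V) auto
    also have "\<dots> \<le> \<bar>s - t\<bar> * \<psi> h"
      unfolding \<psi>_def by (intro mult_left_mono) (auto simp: M'_def)
    finally show ?thesis using h by (simp add: h_def)
  next
    case False
    define h where "h = t - s"
    have h: "0 < h" using False s by (simp add: h_def)
    have Tt: "T t u = T s (T h u)" if "u \<in> V" for u using semi[of s h u] s h that by (simp add: h_def)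
    \<comment> \<open>With \<open>T t = T s T h\<close> on \<open>V\<close>, the error to the left
      of \<open>t\<close> becomes \<open>h\<close> times \<open>T s e\<close>, and both parts of
      \<open>e\<close> vanish as \<open>h\<close> tends to 0.\<close>
    define e where "e = (T h (A x) - A x) - \<phi> h"
    have eV: "e \<in> V" unfolding e_def using h AxV by (intro sub inV \<phi>V) auto
    have "T s x - (T t x + (s - t) *\<^sub>R T t (A x)) = (T s x - T s (T h x)) - (- h) *\<^sub>R T s (T h (A x))"
      using Tt[OF xV] Tt[OF AxV] by (simp add: h_def algebra_simps)
    also have "\<dots> = T s ((x - T h x) - (- h) *\<^sub>R T h (A x))"
      using s h xV AxV by (simp only: T_diff T_scale sub scale inV less_imp_le)
    also have "(x - T h x) - (- h) *\<^sub>R T h (A x) = h *\<^sub>R e"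
      using hphi[OF h] by (simp add: e_def algebra_simps)
    also have "T s (h *\<^sub>R e) = h *\<^sub>R T s e" using T_scale[OF s(1) eV eV] .
    finally have "norm (T s x - (T t x + (s - t) *\<^sub>R T t (A x))) = \<bar>s - t\<bar> * norm (T s e)"
      using h by (simp add: h_def)
    also have "\<dots> \<le> \<bar>s - t\<bar> * (M' * norm e)"
      by (intro mult_left_mono M' s eV) simp
    also have "\<dots> \<le> \<bar>s - t\<bar> * \<psi> h"
      unfolding \<psi>_def e_def using norm_triangle_ineq4[of "T h (A x) - A x" "\<phi> h"]
      by (intro mult_left_mono) (auto simp: M'_def)
    finally show ?thesis using h by (simp add: h_def)
  qed
  have "((\<lambda>t. T t x) has_vector_derivative T t (A x)) (at t within {0..})"
    unfolding has_vector_derivative_def has_derivative_within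
  proof (intro conjI bounded_linear_scaleR_left)
    show "((\<lambda>s. (1 / norm (s - t)) *\<^sub>R (T s x - (T t x + (s - t) *\<^sub>R T t (A x)))) \<longlongrightarrow> 0) (at t within {0..})"
    proof (rule Lim_null_comparison)
      have "filterlim (\<lambda>s. \<bar>s - t\<bar>) (at_right 0) (at t within {0..})"
        unfolding filterlim_at by (auto intro!: tendsto_eq_intros simp: eventually_at_filter)
      then show "((\<lambda>s. \<psi> \<bar>s - t\<bar>) \<longlongrightarrow> 0) (at t within {0..})"
        by (rule filterlim_compose[OF \<psi>_lim])
      have "\<forall>\<^sub>F s in at t within {0..}. s < t + 1"
        by (rule order_tendstoD(2)[OF tendsto_ident_at]) simp
      moreover have "\<forall>\<^sub>F s in at t within {0..}. s \<in> {0..} \<and> s \<noteq> t"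
        by (auto simp: eventually_at_filter)
      ultimately show "\<forall>\<^sub>F s in at t within {0..}.
          norm ((1 / norm (s - t)) *\<^sub>R (T s x - (T t x + (s - t) *\<^sub>R T t (A x)))) \<le> \<psi> \<bar>s - t\<bar>"
      proof eventually_elim
        case (elim s)
        then show ?case using bound[of s] by (simp add: divide_simps mult_ac)
      qed
    qed
  qed
  then show ?thesis using TD AT by simp
qed

section \<open>Accretive operators\<close>

lemma cinner_sum_left: "cinner (\<Sum>i\<in>A. f i) y = (\<Sum>i\<in>A. cinner (f i) y)"
  for y :: "'a::complex_inner"
proof -
  have "cinner 0 y = 0" using cinner_scaleC_left[of 0 0 y] scaleC_of_real[of 0 "0::'a"] by simp
  then show ?thesis by (induction A rule: infinite_finite_induct) (simp_all add: cinner_add_left)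
qed

lemma cinner_scaleR_left: "cinner (r *\<^sub>R x) y = complex_of_real r * cinner x y"
  for x :: "'a::complex_inner"
  by (simp add: cinner_scaleC_left flip: scaleC_of_real)

lemma cinner_scaleR_right: "cinner x (r *\<^sub>R y) = complex_of_real r * cinner x y"
  for x :: "'a::complex_inner"
  by (simp add: cinner_scaleC_right flip: scaleC_of_real)

lemma cinner_sum_right: "cinner x (\<Sum>i\<in>A. f i) = (\<Sum>i\<in>A. cinner x (f i))"
  for x :: "'a::complex_inner"
proof -
  have "cinner x (\<Sum>i\<in>A. f i) = cnj (cinner (\<Sum>i\<in>A. f i) x)" by (rule cinner_commute)
  also have "\<dots> = (\<Sum>i\<in>A. cnj (cinner (f i) x))" by (simp add: cinner_sum_left cnj_sum)
  also have "\<dots> = (\<Sum>i\<in>A. cinner x (f i))" by (intro sum.cong refl cinner_commute[symmetric])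
  finally show ?thesis .
qed

lemma cinner_symmetric_eq_of_real:
  assumes "adjoint_pair_on UNIV A A"
  shows "cinner (A x) x = complex_of_real (inner (A x) x)"
proof -
  have "cinner (A x) x = cnj (cinner (A x) x)"
    using assms cinner_commute[of x "A x"] by (simp add: adjoint_pair_on_def)
  then show ?thesis by (simp add: complex_eq_iff inner_eq_Re_cinner)
qed

lemma adjoint_pair_on_cadjoint':
  fixes A :: "'a::chilbert_space \<Rightarrow> 'a"
  assumes "bounded_clinear_on UNIV A"
  shows "cinner (A x) y = cinner x (cadjoint A y)" "cinner (cadjoint A x) y = cinner x (A y)"
proof -
  show *: "cinner (A x) y = cinner x (cadjoint A y)" for x y
    using adjoint_pair_on_cadjoint[OF assms] by (simp add: adjoint_pair_on_def)
  show "cinner (cadjoint A x) y = cinner x (A y)"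
    by (metis * cinner_commute)
qed

lemma cinner_eqI:
  fixes y z :: "'a::complex_inner"
  assumes "\<And>x. cinner x y = cinner x z"
  shows "y = z"
proof -
  have "inner (y - z) y = inner (y - z) z"
    using assms[of "y - z"] by (simp add: inner_eq_Re_cinner)
  then have "inner (y - z) (y - z) = 0" by (simp only: inner_diff_right[of _ y z] diff_self)
  then show ?thesis by simp
qed

lemma cadjoint_bound:
  fixes A :: "'a::chilbert_space \<Rightarrow> 'a"
  assumes A: "bounded_clinear_on UNIV A" and K: "\<And>x. norm (A x) \<le> K * norm x"
  shows "norm (cadjoint A y) \<le> K * norm y"
proof (cases "cadjoint A y = 0")
  case True
  then show ?thesis using order_trans[OF norm_ge_zero K[of y]] by simp
next
  case False
  have "(norm (cadjoint A y))\<^sup>2 = inner (A (cadjoint A y)) y"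
    by (simp add: power2_norm_eq_inner inner_eq_Re_cinner adjoint_pair_on_cadjoint'[OF A])
  also have "\<dots> \<le> norm (A (cadjoint A y)) * norm y" by (rule norm_cauchy_schwarz)
  also have "\<dots> \<le> K * norm (cadjoint A y) * norm y" by (intro mult_right_mono K) simp
  finally show ?thesis using False by (simp add: power2_eq_square)
qed

lemma bounded_clinear_on_cadjoint:
  fixes A :: "'a::chilbert_space \<Rightarrow> 'a"
  assumes A: "bounded_clinear_on UNIV A"
  shows "bounded_clinear_on UNIV (cadjoint A)"
proof -
  obtain K where "\<And>x. norm (A x) \<le> K * norm x" using A by (auto simp: bounded_clinear_on_def)
  from cadjoint_bound[OF A this] have "\<exists>K. \<forall>y. norm (cadjoint A y) \<le> K * norm y" by blast
  moreover have "cadjoint A (x + y) = cadjoint A x + cadjoint A y" for x y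
    by (rule cinner_eqI) (simp add: cinner_add_right flip: adjoint_pair_on_cadjoint'[OF A])
  moreover have "cadjoint A (c *\<^sub>C x) = c *\<^sub>C cadjoint A x" for c x
    by (rule cinner_eqI) (simp add: cinner_scaleC_right flip: adjoint_pair_on_cadjoint'[OF A])
  ultimately show ?thesis by (simp add: bounded_clinear_on_def)
qed

lemma bounded_clinear_on_linear:
  assumes "bounded_clinear_on UNIV A"
  shows "bounded_linear A"
proof -
  obtain K where K: "\<And>x. norm (A x) \<le> K * norm x" using assms by (auto simp: bounded_clinear_on_def)
  show ?thesis
    by (rule bounded_linear_intro[of _ K])
       (use assms K in \<open>auto simp: bounded_clinear_on_def mult.commute simp flip: scaleC_of_real\<close>)
qed

lemma bounded_clinear_on_lincomb:
  fixes A B :: "'a::complex_inner \<Rightarrow> 'a"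
  assumes A: "bounded_clinear_on UNIV A" and B: "bounded_clinear_on UNIV B"
  shows "bounded_clinear_on UNIV (\<lambda>x. r *\<^sub>R A x + s *\<^sub>R B x)"
proof -
  have "bounded_linear (\<lambda>x. r *\<^sub>R A x + s *\<^sub>R B x)"
    by (intro bounded_linear_add bounded_linear_const_scaleR bounded_clinear_on_linear assms)
  then obtain K where "\<And>x. norm (r *\<^sub>R A x + s *\<^sub>R B x) \<le> norm x * K"
    using bounded_linear.bounded by blast
  then have "\<exists>K. \<forall>x. norm (r *\<^sub>R A x + s *\<^sub>R B x) \<le> K * norm x" by (metis mult.commute)
  then show ?thesis
    using assms unfolding bounded_clinear_on_def
    by (auto simp: scaleC_add_right scaleC_scaleC mult.commute scaleR_add_right simp flip: scaleC_of_real)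
qed

lemma cinner_funpow:
  fixes A B :: "'a::complex_inner \<Rightarrow> 'a"
  assumes "\<And>x y. cinner (A x) y = cinner x (B y)"
  shows "cinner ((A ^^ j) x) y = cinner x ((B ^^ j) y)"
  by (induction j arbitrary: y) (simp_all add: assms funpow_swap1[of B])

lemma funpow_scaleR:
  fixes A :: "'a::real_vector \<Rightarrow> 'a"
  assumes "linear A"
  shows "((\<lambda>x. c *\<^sub>R A x) ^^ j) x = c ^ j *\<^sub>R (A ^^ j) x"
  by (induction j) (simp_all add: linear_scale[OF assms])

lemma linear_funpow:
  fixes A :: "'a::real_vector \<Rightarrow> 'a"
  assumes "linear A"
  shows "linear (A ^^ j)"
  by (induction j) (simp_all only: funpow.simps linear_id linear_compose[OF _ assms])

locale accretive_operator =
  fixes C :: "'h::chilbert_space \<Rightarrow> 'h" and K :: real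
  assumes clin: "bounded_clinear_on UNIV C" and accretive: "accretive C"
    and K_pos: "0 < K" and norm_le: "norm (C x) \<le> K * norm x"
begin

lemma herm_diff_skew: "herm_part C x - skew_part C x = cadjoint C x"
proof -
  have "(2::real) *\<^sub>R (herm_part C x - skew_part C x) = 2 *\<^sub>R cadjoint C x"
    unfolding skew_part_def herm_part_def scaleR_diff_right by (simp add: scaleR_2)
  then show ?thesis by (simp only: scaleR_cancel_left) simp
qed

lemma clin_cadjoint: "bounded_clinear_on UNIV (cadjoint C)"
  by (rule bounded_clinear_on_cadjoint[OF clin])

lemma clin_skew: "bounded_clinear_on UNIV (skew_part C)"
  using bounded_clinear_on_lincomb[OF clin clin_cadjoint, of "inverse 2" "- inverse 2"]
  by (simp add: skew_part_def[abs_def] scaleR_diff_right)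

lemma clin_herm: "bounded_clinear_on UNIV (herm_part C)"
  using bounded_clinear_on_lincomb[OF clin clin_cadjoint, of "inverse 2" "inverse 2"]
  by (simp add: herm_part_def[abs_def] scaleR_add_right)

lemma norm_cadjoint_le: "norm (cadjoint C x) \<le> K * norm x"
  by (rule cadjoint_bound[OF clin norm_le])

lemma norm_skew_le: "norm (skew_part C x) \<le> K * norm x"
  using norm_triangle_ineq4[of "C x" "cadjoint C x"] norm_le[of x] norm_cadjoint_le[of x]
  by (simp add: skew_part_def)

lemma norm_herm_le: "norm (herm_part C x) \<le> K * norm x"
  using norm_triangle_ineq[of "C x" "cadjoint C x"] norm_le[of x] norm_cadjoint_le[of x]
  by (simp add: herm_part_def)

lemma inner_cadjoint: "inner (C x) y = inner x (cadjoint C y)"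
  by (simp add: inner_eq_Re_cinner adjoint_pair_on_cadjoint'[OF clin])

lemma inner_skew: "inner (skew_part C x) x = 0"
proof -
  have "inner (C x) x = inner (cadjoint C x) x"
    unfolding inner_cadjoint by (rule inner_commute)
  then show ?thesis by (simp add: skew_part_def inner_diff_left)
qed

lemma adjoint_pair_herm: "adjoint_pair_on UNIV (herm_part C) (herm_part C)"
  by (simp add: adjoint_pair_on_def herm_part_def cinner_scaleR_left cinner_scaleR_right
      cinner_add_left cinner_add_right adjoint_pair_on_cadjoint'[OF clin])

sublocale pos_form "herm_part C" K
proof (rule pos_form.intro)
  show "linear (herm_part C)" by (rule bounded_linear.linear[OF bounded_clinear_on_linear[OF clin_herm]])
  show "inner (herm_part C x) y = inner x (herm_part C y)" for x y
    using adjoint_pair_herm by (simp add: inner_eq_Re_cinner adjoint_pair_on_def)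
  show "0 \<le> inner (herm_part C x) x" for x
  proof -
    have "cinner 0 x \<le> cinner (herm_part C x) x"
      using accretive by (simp add: accretive_def op_le_on_def)
    then have "inner 0 x \<le> inner (herm_part C x) x"
      unfolding inner_eq_Re_cinner less_eq_complex_def by blast
    then show ?thesis by simp
  qed
  show "inner (herm_part C x) x \<le> K * (norm x)\<^sup>2" for x
    using norm_cauchy_schwarz[of "herm_part C x" x] mult_right_mono[OF norm_herm_le[of x] norm_ge_zero[of x]]
    by (simp add: power2_eq_square)
qed (rule K_pos)

text \<open>Moving \<open>C ^^ j\<close> across the inner product turns each summand into
  \<open>q ((cadjoint C ^^ j) x)\<close>. Both sides are then real, so the complex order reduces to
  the real one. Powers of the adjoint appear here, and the later comparisons start from
  them.\<close>

lemma hypocoercivity_condition_iff: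
  "hypocoercivity_condition C m \<longleftrightarrow>
    (\<exists>\<kappa>>0. \<forall>x. \<kappa> * (norm x)\<^sup>2 \<le> (\<Sum>j\<le>m. q ((cadjoint C ^^ j) x)))"
proof -
  have 1: "cinner (\<kappa> *\<^sub>R x) x = complex_of_real (\<kappa> * (norm x)\<^sup>2)" for \<kappa> x
    by (simp add: cinner_scaleR_left cinner_self)
  have 2: "cinner (\<Sum>j\<le>m. (C ^^ j) (herm_part C ((cadjoint C ^^ j) x))) x
      = complex_of_real (\<Sum>j\<le>m. q ((cadjoint C ^^ j) x))" for x
    by (simp add: cinner_sum_left cinner_funpow[OF adjoint_pair_on_cadjoint'(1)[OF clin]]
        cinner_symmetric_eq_of_real[OF adjoint_pair_herm] q_def)
  show ?thesis
    unfolding hypocoercivity_condition_def op_le_on_def 1 2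
    by (simp add: less_eq_complex_def)
qed

section \<open>The rescaled operators: uniform coercivity and almost undamped vectors\<close>

abbreviation A :: "real \<Rightarrow> 'h \<Rightarrow> 'h"
  where "A \<eta> \<equiv> (\<lambda>x. - scaled_op C \<eta> x)"

lemma clin_scaled: "bounded_clinear_on UNIV (scaled_op C \<eta>)"
  using bounded_clinear_on_lincomb[OF clin_skew clin_herm, of \<eta> 1]
  by (simp add: scaled_op_def[abs_def])

lemma linear_scaled: "linear (scaled_op C \<eta>)"
  by (rule bounded_linear.linear[OF bounded_clinear_on_linear[OF clin_scaled]])

text \<open>The Hermitian part is not rescaled, but \<open>1 \<le> \<bar>\<eta>\<bar>\<close> lets
  its bound be absorbed; the factor \<open>2 * K\<close> is then independent of \<eta>.\<close>

lemma norm_scaled_le: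
  assumes "1 \<le> \<bar>\<eta>\<bar>"
  shows "norm (scaled_op C \<eta> x) \<le> \<bar>\<eta>\<bar> * (2 * K) * norm x"
proof -
  have "norm (scaled_op C \<eta> x) \<le> \<bar>\<eta>\<bar> * norm (skew_part C x) + norm (herm_part C x)"
    unfolding scaled_op_def by (metis norm_triangle_ineq norm_scaleR)
  also have "\<dots> \<le> \<bar>\<eta>\<bar> * (K * norm x) + K * norm x"
    by (intro add_mono mult_left_mono norm_skew_le norm_herm_le) simp
  also have "\<dots> \<le> \<bar>\<eta>\<bar> * (K * norm x) + \<bar>\<eta>\<bar> * (K * norm x)"
    using mult_right_mono[OF assms, of "K * norm x"] K_pos by simp
  finally show ?thesis by (simp add: mult_ac)
qed

lemma dissipative_scaled: "dissipative (A \<eta>)"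
  unfolding dissipative_def
  using bounded_linear_minus[OF bounded_clinear_on_linear[OF clin_scaled]]
  by (simp add: scaled_op_def inner_add_left inner_diff_left inner_skew q_def)

lemma q_funpow_scaleR:
  fixes B :: "'h \<Rightarrow> 'h"
  assumes "linear B"
  shows "q (((\<lambda>x. c *\<^sub>R B x) ^^ j) x) = c ^ (2 * j) * q ((B ^^ j) x)"
  by (simp add: funpow_scaleR[OF assms] q_scaleR power_even_eq)

lemma q_funpow_minus: "q ((A \<eta> ^^ j) x) = q ((scaled_op C \<eta> ^^ j) x)"
  using q_funpow_scaleR[OF linear_scaled, where c = "-1" and j = j and x = x] by simp

lemma coercive_scaled:
  assumes "hypocoercivity_condition C m"
  shows "\<exists>\<kappa>>0. \<forall>\<eta>. 1 \<le> \<bar>\<eta>\<bar> \<longrightarrow> coercive_generator (2 * K) \<kappa> m \<bar>\<eta>\<bar> (A \<eta>)"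
proof -
  obtain \<kappa> where \<kappa>: "0 < \<kappa>" "\<And>x. \<kappa> * (norm x)\<^sup>2 \<le> (\<Sum>j\<le>m. q ((cadjoint C ^^ j) x))"
    using assms unfolding hypocoercivity_condition_iff by blast
  obtain k where k: "0 < k" and le: "\<And>A B x. perturbation K 2 A B \<Longrightarrow>
      (\<Sum>j<Suc m. q ((A ^^ j) x)) \<le> k * (\<Sum>j<Suc m. q ((B ^^ j) x))"
    using sum_q_pow_le[of K 2 "Suc m"] K_pos by auto
  have "coercive_generator (2 * K) (\<kappa> / k) m \<bar>\<eta>\<bar> (A \<eta>)" if \<eta>: "1 \<le> \<bar>\<eta>\<bar>" for \<eta>
    unfolding coercive_generator_def
  proof (intro conjI allI dissipative_scaled)
    show "norm (A \<eta> x) \<le> \<bar>\<eta>\<bar> * (2 * K) * norm x" for x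
      using norm_scaled_le[OF \<eta>] by simp
    fix x
    \<comment> \<open>This multiple has the same skew part as \<open>cadjoint C\<close>, so the two
      differ by \<open>(1 + 1 / \<eta>)\<close> times the Hermitian part, a coefficient of modulus
      at most 2.\<close>
    define B where "B = (\<lambda>x. (- 1 / \<eta>) *\<^sub>R scaled_op C \<eta> x)"
    have "perturbation K 2 (cadjoint C) B"
      unfolding perturbation_def
    proof (intro conjI allI exI[of _ "1 + 1 / \<eta>"] norm_cadjoint_le)
      show "linear (cadjoint C)"
        by (rule bounded_linear.linear[OF bounded_clinear_on_linear[OF clin_cadjoint]])
      have "\<bar>1 / \<eta>\<bar> \<le> 1" using \<eta> by (simp add: divide_le_eq)
      then show "\<bar>1 + 1 / \<eta>\<bar> \<le> 2" by linarith
      have "\<eta> \<noteq> 0" using \<eta> by auto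
      then show "cadjoint C x = B x + (1 + 1 / \<eta>) *\<^sub>R herm_part C x" for x
        unfolding herm_diff_skew[symmetric] B_def scaled_op_def by (simp add: algebra_simps)
    qed
    from le[OF this, of x] have "\<kappa> * (norm x)\<^sup>2 \<le> k * (\<Sum>j\<le>m. q ((B ^^ j) x))"
      using \<kappa>(2)[of x] unfolding lessThan_Suc_atMost by linarith
    also have "(\<Sum>j\<le>m. q ((B ^^ j) x)) = (\<Sum>j\<le>m. q ((A \<eta> ^^ j) x) / \<bar>\<eta>\<bar> ^ (2 * j))"
      unfolding B_def q_funpow_minus q_funpow_scaleR[OF linear_scaled]
      by (intro sum.cong refl) (simp add: power_divide power_mult)
    finally show "\<kappa> / k * (norm x)\<^sup>2 \<le> (\<Sum>j\<le>m. q ((A \<eta> ^^ j) x) / \<bar>\<eta>\<bar> ^ (2 * j))"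
      using k by (simp add: field_simps)
  qed
  then show ?thesis using divide_pos_pos[OF \<kappa>(1) k] by blast
qed

text \<open>Minimality of \<open>m\<close> makes the sum over powers \<open>j < m\<close> of the
  adjoint fail every lower bound. The comparison is now run in the other direction, from \<eta>
  times the adjoint to \<open>A \<eta>\<close>; its constant may depend on \<eta>, since a single
  \<eta> is fixed.\<close>

lemma almost_null_vector:
  assumes nonzero: "\<exists>x::'h. x \<noteq> 0" and least: "\<And>n. n < m \<Longrightarrow> \<not> hypocoercivity_condition C n"
    and \<eta>: "1 \<le> \<bar>\<eta>\<bar>" and \<delta>: "0 < \<delta>"
  shows "\<exists>x. norm x = 1 \<and> (\<Sum>j<m. q ((A \<eta> ^^ j) x)) \<le> \<delta>"
proof -
  have "\<exists>x. x \<noteq> 0 \<and> (\<Sum>j<m. q ((A \<eta> ^^ j) x)) \<le> \<delta> * (norm x)\<^sup>2"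
  proof (cases m)
    \<comment> \<open>The sum is empty, so any nonzero vector will do.\<close>
    case 0
    then show ?thesis using nonzero \<delta> by auto
  next
    case (Suc n)
    obtain k where k: "0 < k" and le: "\<And>A B x. perturbation (\<bar>\<eta>\<bar> * (2 * K)) \<bar>1 + \<eta>\<bar> A B \<Longrightarrow>
      (\<Sum>j<m. q ((A ^^ j) x)) \<le> k * (\<Sum>j<m. q ((B ^^ j) x))"
      using sum_q_pow_le[of "\<bar>\<eta>\<bar> * (2 * K)" "\<bar>1 + \<eta>\<bar>" m] K_pos by auto
    \<comment> \<open>The denominator compensates for the comparison constant \<open>k\<close> and
      for the largest power of \<eta> produced by rescaling the adjoint.\<close>
    define e where "e = \<delta> / (k * \<bar>\<eta>\<bar> ^ (2 * m))"
    have e: "0 < e" using \<delta> k \<eta> by (auto simp: e_def intro!: divide_pos_pos mult_pos_pos)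
    then obtain x where x: "(\<Sum>j\<le>n. q ((cadjoint C ^^ j) x)) < e * (norm x)\<^sup>2"
      using least[of n] Suc unfolding hypocoercivity_condition_iff by (auto simp: not_le)
    have lin: "linear (cadjoint C)"
      by (rule bounded_linear.linear[OF bounded_clinear_on_linear[OF clin_cadjoint]])
    define B where "B = (\<lambda>x. \<eta> *\<^sub>R cadjoint C x)"
    have "perturbation (\<bar>\<eta>\<bar> * (2 * K)) \<bar>1 + \<eta>\<bar> (A \<eta>) B"
      unfolding perturbation_def
    proof (intro conjI allI exI[of _ "- (1 + \<eta>)"])
      show "linear (A \<eta>)" using linear_scaled by (rule linear_compose_neg)
      show "norm (A \<eta> x) \<le> \<bar>\<eta>\<bar> * (2 * K) * norm x" for x
        using norm_scaled_le[OF \<eta>] by simp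
      show "A \<eta> x = B x + - (1 + \<eta>) *\<^sub>R herm_part C x" for x
        unfolding B_def herm_diff_skew[symmetric] scaled_op_def by (simp add: algebra_simps)
    qed simp
    from le[OF this, of x] have "(\<Sum>j<m. q ((A \<eta> ^^ j) x)) \<le> k * (\<Sum>j<m. q ((B ^^ j) x))" .
    also have "\<dots> \<le> k * (\<Sum>j<m. \<bar>\<eta>\<bar> ^ (2 * m) * q ((cadjoint C ^^ j) x))"
    proof (intro mult_left_mono sum_mono)
      fix j assume "j \<in> {..<m}"
      then have "\<bar>\<eta>\<bar> ^ (2 * j) \<le> \<bar>\<eta>\<bar> ^ (2 * m)" using \<eta> by (intro power_increasing) auto
      then have "\<eta> ^ (2 * j) \<le> \<bar>\<eta>\<bar> ^ (2 * m)" by (simp add: power_mult)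
      then show "q ((B ^^ j) x) \<le> \<bar>\<eta>\<bar> ^ (2 * m) * q ((cadjoint C ^^ j) x)"
        unfolding B_def q_funpow_scaleR[OF lin] by (intro mult_right_mono) auto
    qed (use k in simp)
    also have "\<dots> = (k * \<bar>\<eta>\<bar> ^ (2 * m)) * (\<Sum>j\<le>n. q ((cadjoint C ^^ j) x))"
      by (simp add: sum_distrib_left Suc lessThan_Suc_atMost mult_ac)
    also have "\<dots> \<le> (k * \<bar>\<eta>\<bar> ^ (2 * m)) * (e * (norm x)\<^sup>2)"
      using x k by (intro mult_left_mono) auto
    also have "\<dots> = \<delta> * (norm x)\<^sup>2" using k \<eta> by (auto simp: e_def)
    finally have "(\<Sum>j<m. q ((A \<eta> ^^ j) x)) \<le> \<delta> * (norm x)\<^sup>2" .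
    moreover have "0 \<le> (\<Sum>j\<le>n. q ((cadjoint C ^^ j) x))" by (intro sum_nonneg) simp
    with x have "x \<noteq> 0" by auto
    ultimately show ?thesis by blast
  qed
  then obtain x where x: "x \<noteq> 0" "(\<Sum>j<m. q ((A \<eta> ^^ j) x)) \<le> \<delta> * (norm x)\<^sup>2" by blast
  define z where "z = inverse (norm x) *\<^sub>R x"
  have "linear (A \<eta> ^^ j)" for j
    by (intro linear_funpow linear_compose_neg linear_scaled)
  then have "(\<Sum>j<m. q ((A \<eta> ^^ j) z)) = (inverse (norm x))\<^sup>2 * (\<Sum>j<m. q ((A \<eta> ^^ j) x))"
    by (simp add: z_def linear_scale q_scaleR sum_distrib_left)
  also have "\<dots> \<le> (inverse (norm x))\<^sup>2 * (\<delta> * (norm x)\<^sup>2)"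
    using x by (intro mult_left_mono) auto
  also have "\<dots> = \<delta>" using x(1) by (simp add: power2_eq_square field_simps)
  finally show ?thesis using x by (intro exI[of _ z]) (simp add: z_def)
qed

section \<open>The weight operators on a single summand\<close>

lemma cinner_weight:
  "cinner (weight_op C m \<eta> x) y
    = (\<Sum>j\<le>m. complex_of_real (1 / \<eta> ^ (2 * j)) * cinner ((scaled_op C \<eta> ^^ j) x) ((scaled_op C \<eta> ^^ j) y))"
  unfolding weight_op_def
  by (simp add: cinner_sum_left cinner_scaleR_left cinner_funpow[OF adjoint_pair_on_cadjoint'(2)[OF clin_scaled]])

lemma cinner_weight_symmetric: "cinner (weight_op C m \<eta> x) y = cinner x (weight_op C m \<eta> y)"
  unfolding cinner_weight
  by (simp add: weight_op_def cinner_sum_right cinner_scaleR_right cinner_funpow[OF adjoint_pair_on_cadjoint'(1)[OF clin_scaled]])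

lemma inner_weight:
  "inner (weight_op C m \<eta> x) y
    = (\<Sum>j\<le>m. inner ((scaled_op C \<eta> ^^ j) x) ((scaled_op C \<eta> ^^ j) y) / \<eta> ^ (2 * j))"
  unfolding inner_eq_Re_cinner cinner_weight by simp

lemma inner_weight_ge: "(norm x)\<^sup>2 \<le> inner (weight_op C m \<eta> x) x"
  unfolding inner_weight power2_norm_eq_inner
  using member_le_sum[of 0 "{..m}" "\<lambda>j. inner ((scaled_op C \<eta> ^^ j) x) ((scaled_op C \<eta> ^^ j) x) / \<eta> ^ (2 * j)"]
  by (simp add: power_mult)

text \<open>Because \<open>C\<^sub>\<eta>\<close> commutes with its own powers, the j-th term is the
  inner product of \<open>C\<^sub>\<eta> z\<close> and \<open>z\<close> with
  \<open>z = C\<^sub>\<eta>^j x\<close>; only \<open>q z\<close> survives, and the terms add up to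
  the coercive sum.\<close>

lemma weight_lyapunov:
  assumes "coercive_generator L \<kappa> m \<bar>\<eta>\<bar> (A \<eta>)"
  shows "\<kappa> * (norm x)\<^sup>2 \<le> inner (scaled_op C \<eta> x) (weight_op C m \<eta> x)"
proof -
  have "inner (scaled_op C \<eta> x) x = q x" for x
    using dissipative_scaled[of \<eta>] by (simp add: dissipative_def)
  then have "inner (weight_op C m \<eta> x) (scaled_op C \<eta> x) = (\<Sum>j\<le>m. q ((A \<eta> ^^ j) x) / \<bar>\<eta>\<bar> ^ (2 * j))"
    unfolding inner_weight q_funpow_minus funpow_swap1[symmetric]
    by (simp add: power_mult inner_commute)
  then show ?thesis using assms by (simp add: coercive_generator_def inner_commute)
qed

text \<open>The \<open>2 j\<close> factors of size \<open>\<bar>\<eta>\<bar> * (2 * K)\<close>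
  produce exactly the power of \<eta> that the weight divides out, so the bound is uniform in
  \<eta>.\<close>

lemma norm_weight_le:
  assumes "1 \<le> \<bar>\<eta>\<bar>"
  shows "norm (weight_op C m \<eta> x) \<le> (\<Sum>j\<le>m. (2 * K) ^ (2 * j)) * norm x"
  unfolding weight_op_def sum_distrib_right
proof (intro sum_norm_le)
  fix j
  let ?L = "\<bar>\<eta>\<bar> * (2 * K)"
  have L: "0 \<le> ?L" using K_pos by simp
  have "norm ((cadjoint (scaled_op C \<eta>) ^^ j) ((scaled_op C \<eta> ^^ j) x)) \<le> ?L ^ j * norm ((scaled_op C \<eta> ^^ j) x)"
    by (intro norm_funpow_le L cadjoint_bound[OF clin_scaled] norm_scaled_le assms)
  also have "\<dots> \<le> ?L ^ j * (?L ^ j * norm x)"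
    using L by (intro mult_left_mono norm_funpow_le norm_scaled_le assms) auto
  also have "\<dots> = ?L ^ (2 * j) * norm x" by (simp only: mult.assoc[symmetric] mult_2 power_add)
  also have "?L ^ (2 * j) = \<eta> ^ (2 * j) * (2 * K) ^ (2 * j)"
    unfolding power_mult_distrib[of "\<bar>\<eta>\<bar>"] by (simp add: power_even_abs)
  finally have "norm ((cadjoint (scaled_op C \<eta>) ^^ j) ((scaled_op C \<eta> ^^ j) x)) \<le> \<eta> ^ (2 * j) * ((2 * K) ^ (2 * j) * norm x)"
    by (simp only: mult.assoc)
  moreover have "0 < \<eta> ^ (2 * j)" using assms by (auto simp: power_mult zero_less_power)
  ultimately show "norm ((1 / \<eta> ^ (2 * j)) *\<^sub>R (cadjoint (scaled_op C \<eta>) ^^ j) ((scaled_op C \<eta> ^^ j) x))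
      \<le> (2 * K) ^ (2 * j) * norm x"
    by (simp add: divide_le_eq mult_ac)
qed

text \<open>Linearity comes for free from symmetry: tested against any vector, the operator can be
  moved to the other side.\<close>

lemma weight_add: "weight_op C m \<eta> (x + y) = weight_op C m \<eta> x + weight_op C m \<eta> y"
  by (rule cinner_eqI) (simp add: cinner_add_left cinner_add_right flip: cinner_weight_symmetric)

lemma weight_scaleC: "weight_op C m \<eta> (c *\<^sub>C x) = c *\<^sub>C weight_op C m \<eta> x"
  by (rule cinner_eqI) (simp add: cinner_scaleC_right flip: cinner_weight_symmetric)

end

section \<open>Direct sums\<close>

lemma bounded_linear_hsum_nth: "bounded_linear (\<lambda>x. hsum_nth x i)"
  by (rule bounded_linear_intro[of _ 1]) (simp_all add: plus_hsum.rep_eq norm_hsum_nth_le)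

lemma square_summable_on_hsum_nth: "square_summable_on (hsum_nth x) I"
  unfolding square_summable_on_def
  by (rule summable_on_subset_banach[OF square_summable_hsum_nth]) simp

lemma hsum_on_add: "x \<in> hsum_on I \<Longrightarrow> y \<in> hsum_on I \<Longrightarrow> x + y \<in> hsum_on I"
  by (simp add: hsum_on_def plus_hsum.rep_eq)

lemma hsum_on_diff: "x \<in> hsum_on I \<Longrightarrow> y \<in> hsum_on I \<Longrightarrow> x - y \<in> hsum_on I"
  by (simp add: hsum_on_def)

lemma hsum_on_scaleC:
  fixes x :: "('i, 'h::complex_inner) hsum"
  shows "x \<in> hsum_on I \<Longrightarrow> c *\<^sub>C x \<in> hsum_on I"
  using norm_scaleC[of c "0::'h"] by (simp add: hsum_on_def scaleC_hsum.rep_eq)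

lemma closed_hsum_on: "closed (hsum_on I :: ('i, 'h::complex_inner) hsum set)"
proof -
  have "closed {x :: ('i, 'h) hsum. hsum_nth x i = 0}" for i
    by (intro closed_Collect_eq linear_continuous_on bounded_linear_hsum_nth continuous_on_const)
  moreover have "hsum_on I = (\<Inter>i\<in>-I. {x :: ('i, 'h) hsum. hsum_nth x i = 0})"
    by (auto simp: hsum_on_def)
  ultimately show ?thesis by auto
qed

text \<open>The orthogonal projection onto \<open>hsum_on I\<close>. It serves as the map
  \<open>p\<close> in the semigroup lemmas and, for finite \<open>I\<close>, as a
  truncation.\<close>

definition hsum_restrict :: "'i set \<Rightarrow> ('i, 'h::complex_inner) hsum \<Rightarrow> ('i, 'h) hsum"
  where "hsum_restrict I x = hfamily I (hsum_nth x)"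

lemma hsum_nth_restrict [simp]: "hsum_nth (hsum_restrict I x) i = (if i \<in> I then hsum_nth x i else 0)"
  by (simp add: hsum_restrict_def hsum_nth_hfamily square_summable_on_hsum_nth)

lemma hsum_restrict_in: "hsum_restrict I x \<in> hsum_on I"
  by (simp add: hsum_on_def)

lemma hsum_restrict_eq: "x \<in> hsum_on I \<Longrightarrow> hsum_restrict I x = x"
  by (rule hsum_eqI) (simp add: hsum_on_def)

lemma norm_hsum_mono:
  assumes "0 \<le> c" "\<And>i. (norm (hsum_nth x i))\<^sup>2 \<le> c * (norm (hsum_nth y i))\<^sup>2"
  shows "(norm x)\<^sup>2 \<le> c * (norm y)\<^sup>2"
  unfolding norm_hsum_square[of x] norm_hsum_square[of y] infsum_cmult_right'[symmetric]
  by (intro infsum_mono summable_on_cmult_right square_summable_hsum_nth assms)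

lemma norm_hsum_restrict_le: "norm (hsum_restrict I x) \<le> norm x"
proof (rule power2_le_imp_le)
  show "(norm (hsum_restrict I x))\<^sup>2 \<le> (norm x)\<^sup>2"
    using norm_hsum_mono[of 1 "hsum_restrict I x" x] by simp
qed simp

lemma bounded_linear_hsum_restrict: "bounded_linear (hsum_restrict I)"
  by (rule bounded_linear_intro[of _ 1])
     (auto intro!: hsum_eqI norm_hsum_restrict_le simp: plus_hsum.rep_eq)

lemma summable_on_cinner_hsum: "(\<lambda>i. cinner (hsum_nth x i) (hsum_nth y i)) summable_on UNIV"
  using hsum_nth[of x] hsum_nth[of y] by (intro summable_on_cinner) auto

lemma summable_on_inner_hsum: "(\<lambda>i. inner (hsum_nth x i) (hsum_nth y i)) summable_on UNIV"
  unfolding inner_eq_Re_cinner by (intro summable_on_Re summable_on_cinner_hsum)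

lemma inner_hsum_eq: "inner x y = (\<Sum>\<^sub>\<infinity>i. inner (hsum_nth x i) (hsum_nth y i))"
  unfolding inner_eq_Re_cinner[of "hsum_nth x _"]
  by (simp add: inner_hsum_def cinner_hsum_def infsum_Re[OF summable_on_cinner_hsum])

lemma inner_hsum_mono:
  assumes "\<And>i. c * (norm (hsum_nth x i))\<^sup>2 \<le> inner (hsum_nth y i) (hsum_nth z i)"
  shows "c * (norm x)\<^sup>2 \<le> inner y z"
  unfolding norm_hsum_square[of x] inner_hsum_eq infsum_cmult_right'[symmetric]
  by (intro infsum_mono summable_on_cmult_right square_summable_hsum_nth summable_on_inner_hsum assms)

text \<open>The squared norms of the truncations converge to that of \<open>x\<close>, and by
  Pythagoras the defect is the squared distance.\<close>

lemma hsum_restrict_finite_approx: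
  assumes "0 < e"
  shows "\<exists>F. finite F \<and> norm (x - hsum_restrict F x) < e"
proof -
  have "((\<lambda>F. \<Sum>i\<in>F. (norm (hsum_nth x i))\<^sup>2) \<longlongrightarrow> (norm x)\<^sup>2) (finite_subsets_at_top UNIV)"
    using has_sum_infsum[OF square_summable_hsum_nth[of x]] unfolding has_sum_def norm_hsum_square[of x] .
  then have "\<forall>\<^sub>F F in finite_subsets_at_top UNIV. (norm x)\<^sup>2 - e\<^sup>2 < (\<Sum>i\<in>F. (norm (hsum_nth x i))\<^sup>2)"
    using assms by (intro order_tendstoD(1)) auto
  then obtain F where F: "finite F" "(norm x)\<^sup>2 - e\<^sup>2 < (\<Sum>i\<in>F. (norm (hsum_nth x i))\<^sup>2)"
    unfolding eventually_finite_subsets_at_top by auto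
  let ?y = "hsum_restrict F x"
  have "inner (x - ?y) ?y = 0"
    unfolding inner_hsum_eq by (intro infsum_0) simp
  then have "(norm (x - ?y))\<^sup>2 = (norm x)\<^sup>2 - (norm ?y)\<^sup>2"
    unfolding power2_norm_eq_inner by (simp add: inner_diff_left inner_diff_right inner_commute)
  moreover have "(norm ?y)\<^sup>2 = (\<Sum>i\<in>F. (norm (hsum_nth x i))\<^sup>2)"
    using norm_hfamily[OF square_summable_on_hsum_nth[of x F]] F(1) by (simp add: hsum_restrict_def)
  ultimately have "(norm (x - ?y))\<^sup>2 < e\<^sup>2" using F(2) by simp
  then have "norm (x - ?y) < e" by (rule power2_less_imp_less) (use assms in simp)
  then show ?thesis using F(1) by blast
qed

locale direct_sum_semigroup = accretive_operator C K
  for C :: "'h::chilbert_space \<Rightarrow> 'h" and K +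
  fixes E :: "real set" and T :: "real \<Rightarrow> (real, 'h) hsum \<Rightarrow> (real, 'h) hsum"
  assumes E_ge: "\<eta> \<in> E \<Longrightarrow> 1 \<le> \<bar>\<eta>\<bar>"
    and gen: "generates_on (hsum_on E) (sum_op_dom C E) (\<lambda>x. - sum_op C E x) T"
begin

section \<open>The semigroup on the direct sum, reduced to its components\<close>

lemma semigroup: "c0_semigroup_on (hsum_on E) T"
  using gen by (simp add: generates_on_def)

lemma scaled_zero [simp]: "scaled_op C \<eta> 0 = 0"
  by (rule linear_0[OF linear_scaled])

lemma weight_zero [simp]: "weight_op C m \<eta> 0 = 0"
  using inner_weight[of m \<eta> 0 "weight_op C m \<eta> 0"] linear_0[OF linear_funpow[OF linear_scaled]] by simp

lemma hsum_nth_sum_op: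
  assumes "x \<in> sum_op_dom C E"
  shows "hsum_nth (sum_op C E x) \<eta> = (if \<eta> \<in> E then scaled_op C \<eta> (hsum_nth x \<eta>) else 0)"
  using assms by (simp add: sum_op_def sum_op_dom_def hsum_nth_hfamily)

text \<open>The domain thus contains all truncations, which are dense, and all vectors placed in a
  single summand.\<close>

lemma finite_support_in_dom:
  assumes "x \<in> hsum_on E" "finite F" "\<And>i. i \<notin> F \<Longrightarrow> hsum_nth x i = 0"
  shows "x \<in> sum_op_dom C E"
proof -
  have "(\<lambda>\<eta>. (norm (scaled_op C \<eta> (hsum_nth x \<eta>)))\<^sup>2) summable_on E
      \<longleftrightarrow> (\<lambda>\<eta>. (norm (scaled_op C \<eta> (hsum_nth x \<eta>)))\<^sup>2) summable_on (E \<inter> F)"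
    using assms(3) by (intro summable_on_cong_neutral) auto
  then show ?thesis
    using assms(1,2) by (simp add: sum_op_dom_def square_summable_on_def)
qed

text \<open>Coordinate maps are bounded, so differentiating an orbit in the domain coordinatewise
  replaces the possibly unbounded generator by bounded operators.\<close>

lemma component_solves:
  assumes x: "x \<in> sum_op_dom C E" and \<eta>: "\<eta> \<in> E"
  shows "solves (A \<eta>) (\<lambda>t. hsum_nth (T t x) \<eta>)"
  unfolding solves_def
proof (intro allI impI)
  fix t :: real
  assume t: "0 \<le> t"
  have 1: "T t x \<in> sum_op_dom C E"
    and 2: "((\<lambda>t. T t x) has_vector_derivative - sum_op C E (T t x)) (at t within {0..})"
    using generated_semigroup_deriv[OF gen closed_hsum_on hsum_on_add hsum_on_scaleC
        bounded_linear_hsum_restrict hsum_restrict_in hsum_restrict_eq x t] by blast+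
  from bounded_linear.has_vector_derivative[OF bounded_linear_hsum_nth 2, of \<eta>]
  show "((\<lambda>t. hsum_nth (T t x) \<eta>) has_vector_derivative - scaled_op C \<eta> (hsum_nth (T t x) \<eta>)) (at t within {0..})"
    using \<eta> by (simp add: uminus_hsum.rep_eq hsum_nth_sum_op[OF 1])
qed

lemma semigroup_bounded:
  assumes "0 \<le> t"
  shows "\<exists>B\<ge>0. \<forall>x\<in>hsum_on E. norm (T t x) \<le> B * norm x"
proof -
  have "bounded_clinear_on (hsum_on E) (T t)"
    using semigroup assms by (simp add: c0_semigroup_on_def)
  then obtain B where B: "\<And>x. x \<in> hsum_on E \<Longrightarrow> norm (T t x) \<le> B * norm x"
    unfolding bounded_clinear_on_def by metis
  show ?thesis
  proof (intro exI[of _ "\<bar>B\<bar>"] conjI ballI)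
    fix x :: "(real, 'h) hsum"
    assume "x \<in> hsum_on E"
    then show "norm (T t x) \<le> \<bar>B\<bar> * norm x"
      using B[of x] mult_right_mono[OF abs_ge_self[of B] norm_ge_zero[of x]] by linarith
  qed simp
qed

lemma opnorm_ge:
  assumes "0 \<le> t" "x \<in> hsum_on E" "norm x \<le> 1"
  shows "norm (T t x) \<le> opnorm_on (hsum_on E) (T t)"
  unfolding opnorm_on_def
proof (rule cSUP_upper)
  obtain B where B: "0 \<le> B" "\<And>x. x \<in> hsum_on E \<Longrightarrow> norm (T t x) \<le> B * norm x"
    using semigroup_bounded[OF assms(1)] by blast
  have "norm (T t x) \<le> B" if "x \<in> hsum_on E" "norm x \<le> 1" for x
    using B(2)[OF that(1)] mult_left_mono[OF that(2) B(1)] by simp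
  then show "bdd_above ((\<lambda>x. norm (T t x)) ` {x \<in> hsum_on E. norm x \<le> 1})"
    by (intro bdd_aboveI2[where M = B]) auto
qed (use assms in simp)

lemma opnorm_nonneg:
  assumes "0 \<le> t"
  shows "0 \<le> opnorm_on (hsum_on E) (T t)"
  by (rule order_trans[OF norm_ge_zero opnorm_ge[OF assms, of 0]]) (simp_all add: hsum_on_def zero_hsum.rep_eq)

text \<open>For vectors in the domain the componentwise estimates add up. The general case follows
  by truncation, with the boundedness of the single operator \<open>T t\<close> controlling the
  error.\<close>

lemma opnorm_le:
  assumes t: "0 \<le> t" and c: "0 \<le> c"
    and le: "\<And>\<eta> y. \<eta> \<in> E \<Longrightarrow> solves (A \<eta>) y \<Longrightarrow> (norm (y t))\<^sup>2 \<le> c * (norm (y 0))\<^sup>2"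
  shows "(opnorm_on (hsum_on E) (T t))\<^sup>2 \<le> c"
proof -
  have T0: "T 0 x = x" and TV: "T t x \<in> hsum_on E"
    and add: "y \<in> hsum_on E \<Longrightarrow> T t (x + y) = T t x + T t y" if "x \<in> hsum_on E" for x y
    using semigroup t that by (auto simp: c0_semigroup_on_def bounded_clinear_on_def)
  have dom: "norm (T t x) \<le> sqrt c * norm x" if x: "x \<in> sum_op_dom C E" for x
  proof (rule power2_le_imp_le)
    have xV: "x \<in> hsum_on E" using x by (simp add: sum_op_dom_def)
    have "(norm (T t x))\<^sup>2 \<le> c * (norm x)\<^sup>2"
    proof (rule norm_hsum_mono[OF c])
      fix \<eta>
      show "(norm (hsum_nth (T t x) \<eta>))\<^sup>2 \<le> c * (norm (hsum_nth x \<eta>))\<^sup>2"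
      proof (cases "\<eta> \<in> E")
        case True
        then show ?thesis using le[OF True component_solves[OF x True]] T0[OF xV] by simp
      next
        case False
        then show ?thesis using TV[OF xV] c by (simp add: hsum_on_def)
      qed
    qed
    then show "(norm (T t x))\<^sup>2 \<le> (sqrt c * norm x)\<^sup>2" using c by (simp add: power_mult_distrib)
  qed (use c in simp)
  have all: "norm (T t x) \<le> sqrt c * norm x" if x: "x \<in> hsum_on E" for x
  proof (rule field_le_epsilon)
    fix e :: real
    assume e: "0 < e"
    obtain B where B: "0 \<le> B" "\<And>x. x \<in> hsum_on E \<Longrightarrow> norm (T t x) \<le> B * norm x"
      using semigroup_bounded[OF t] by blast
    \<comment> \<open>The denominator \<open>B + 1\<close> stays positive even if
      \<open>B = 0\<close>.\<close>
    obtain F where F: "finite F" "norm (x - hsum_restrict F x) < e / (B + 1)"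
      using hsum_restrict_finite_approx[of "e / (B + 1)" x] e B(1) by auto
    let ?y = "hsum_restrict F x"
    have y: "?y \<in> hsum_on E" using x by (simp add: hsum_on_def)
    have "norm (T t x) \<le> norm (T t (x - ?y)) + norm (T t ?y)"
      using add[OF hsum_on_diff[OF x y] y] norm_triangle_ineq[of "T t (x - ?y)" "T t ?y"] by simp
    also have "norm (T t (x - ?y)) \<le> B * norm (x - ?y)"
      by (rule B(2)[OF hsum_on_diff[OF x y]])
    also have "B * norm (x - ?y) \<le> (B + 1) * (e / (B + 1))"
      using F(2) B(1) by (intro mult_mono) auto
    also have "\<dots> = e" using B(1) by simp
    also have "norm (T t ?y) \<le> sqrt c * norm ?y"
      by (rule dom, rule finite_support_in_dom[OF y F(1)]) simp
    also have "sqrt c * norm ?y \<le> sqrt c * norm x"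
      using c by (intro mult_left_mono norm_hsum_restrict_le) simp
    finally show "norm (T t x) \<le> sqrt c * norm x + e" by simp
  qed
  have "opnorm_on (hsum_on E) (T t) \<le> sqrt c"
    unfolding opnorm_on_def
  proof (rule cSUP_least)
    have "(0 :: (real, 'h) hsum) \<in> {x \<in> hsum_on E. norm x \<le> 1}" by (simp add: hsum_on_def zero_hsum.rep_eq)
    then show "{x :: (real, 'h) hsum. x \<in> hsum_on E \<and> norm x \<le> 1} \<noteq> {}" by blast
    fix x :: "(real, 'h) hsum"
    assume "x \<in> {x \<in> hsum_on E. norm x \<le> 1}"
    then show "norm (T t x) \<le> sqrt c"
      using all[of x] mult_left_mono[of "norm x" 1 "sqrt c"] c by simp
  qed
  from power_mono[OF this opnorm_nonneg[OF t], of 2] show ?thesis using c by simp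
qed

section \<open>The weight operator on the direct sum\<close>

lemma square_summable_weight:
  "square_summable_on (\<lambda>\<eta>. weight_op C m \<eta> (hsum_nth x \<eta>)) E"
  unfolding square_summable_on_def
proof (rule summable_on_comparison_test)
  let ?W = "\<Sum>j\<le>m. (2 * K) ^ (2 * j)"
  show "(\<lambda>\<eta>. ?W\<^sup>2 * (norm (hsum_nth x \<eta>))\<^sup>2) summable_on E"
    using square_summable_on_hsum_nth[of x E] unfolding square_summable_on_def
    by (rule summable_on_cmult_right)
  fix \<eta> assume "\<eta> \<in> E"
  then show "(norm (weight_op C m \<eta> (hsum_nth x \<eta>)))\<^sup>2 \<le> ?W\<^sup>2 * (norm (hsum_nth x \<eta>))\<^sup>2"
    unfolding power_mult_distrib[symmetric] by (intro power_mono norm_weight_le E_ge) auto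
qed simp

lemma hsum_nth_sum_weight:
  "hsum_nth (sum_weight_op C m E x) \<eta> = (if \<eta> \<in> E then weight_op C m \<eta> (hsum_nth x \<eta>) else 0)"
  by (simp add: sum_weight_op_def hsum_nth_hfamily square_summable_weight)

lemma norm_sum_weight_le:
  "norm (sum_weight_op C m E x) \<le> (\<Sum>j\<le>m. (2 * K) ^ (2 * j)) * norm x" (is "_ \<le> ?W * _")
proof (rule power2_le_imp_le)
  have W: "0 \<le> ?W" using K_pos by (intro sum_nonneg) simp
  then show "0 \<le> ?W * norm x" by simp
  show "(norm (sum_weight_op C m E x))\<^sup>2 \<le> (?W * norm x)\<^sup>2"
    unfolding power_mult_distrib[of ?W]
  proof (rule norm_hsum_mono)
    fix \<eta>
    show "(norm (hsum_nth (sum_weight_op C m E x) \<eta>))\<^sup>2 \<le> ?W\<^sup>2 * (norm (hsum_nth x \<eta>))\<^sup>2"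
    proof (cases "\<eta> \<in> E")
      case True
      then show ?thesis
        unfolding hsum_nth_sum_weight power_mult_distrib[symmetric] if_P[OF True]
        by (intro power_mono norm_weight_le E_ge) auto
    qed (simp add: hsum_nth_sum_weight)
  qed simp
qed

lemma sum_weight_symmetric:
  assumes "x \<in> hsum_on E" "y \<in> hsum_on E"
  shows "cinner (sum_weight_op C m E x) y = cinner x (sum_weight_op C m E y)"
  unfolding cinner_hsum_def hsum_nth_sum_weight
  by (intro infsum_cong) (use assms in \<open>auto simp: cinner_weight_symmetric hsum_on_def\<close>)

lemma bounded_selfadjoint_sum_weight: "bounded_selfadjoint_on (hsum_on E) (sum_weight_op C m E)"
  unfolding bounded_selfadjoint_on_def bounded_clinear_on_def adjoint_pair_on_def
proof (intro conjI ballI allI)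
  fix x y :: "(real, 'h) hsum" and c
  show "sum_weight_op C m E x \<in> hsum_on E"
    unfolding sum_weight_op_def by (rule hfamily_in_hsum_on[OF square_summable_weight])
  show "sum_weight_op C m E (x + y) = sum_weight_op C m E x + sum_weight_op C m E y"
    by (rule hsum_eqI) (simp add: hsum_nth_sum_weight plus_hsum.rep_eq weight_add)
  have "c *\<^sub>C (0::'h) = 0" using norm_scaleC[of c "0::'h"] by simp
  then show "sum_weight_op C m E (c *\<^sub>C x) = c *\<^sub>C sum_weight_op C m E x"
    by (intro hsum_eqI) (simp add: hsum_nth_sum_weight scaleC_hsum.rep_eq weight_scaleC)
  show "\<exists>B. \<forall>x\<in>hsum_on E. norm (sum_weight_op C m E x) \<le> B * norm x"
    using norm_sum_weight_le by blast
  assume "x \<in> hsum_on E" "y \<in> hsum_on E"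
  then show "cinner (sum_weight_op C m E x) y = cinner x (sum_weight_op C m E y)"
    by (rule sum_weight_symmetric)
qed

lemma sum_weight_ge: "op_le_on (hsum_on E) (\<lambda>x. x) (sum_weight_op C m E)"
  unfolding op_le_on_def
proof
  fix x :: "(real, 'h) hsum"
  assume x: "x \<in> hsum_on E"
  let ?W = "sum_weight_op C m E"
  \<comment> \<open>The complex order also demands equal imaginary parts; here they vanish by
    symmetry.\<close>
  have "cinner (?W x) x = cnj (cinner (?W x) x)"
    using sum_weight_symmetric[OF x x] cinner_commute[of x "?W x"] by simp
  then have "Im (cinner (?W x) x) = 0" by (simp add: complex_eq_iff)
  moreover have "1 * (norm x)\<^sup>2 \<le> inner (?W x) x"
  proof (rule inner_hsum_mono)
    fix \<eta>
    show "1 * (norm (hsum_nth x \<eta>))\<^sup>2 \<le> inner (hsum_nth (?W x) \<eta>) (hsum_nth x \<eta>)"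
      using inner_weight_ge[of "hsum_nth x \<eta>" m \<eta>] x by (auto simp: hsum_nth_sum_weight hsum_on_def)
  qed
  ultimately show "cinner x x \<le> cinner (?W x) x"
    unfolding cinner_self less_eq_complex_def by (simp add: inner_eq_Re_cinner)
qed

text \<open>The two inner products are conjugate, so they add up to twice a real part, to which
  \<open>weight_lyapunov\<close> contributes summand by summand.\<close>

lemma sum_weight_lyapunov:
  assumes \<kappa>: "\<And>\<eta>. \<eta> \<in> E \<Longrightarrow> coercive_generator L \<kappa> m \<bar>\<eta>\<bar> (A \<eta>)" and x: "x \<in> sum_op_dom C E"
  shows "cinner (- sum_op C E x) (sum_weight_op C m E x)
      + cinner (sum_weight_op C m E x) (- sum_op C E x) \<le> complex_of_real (- (2 * \<kappa>) * (norm x)\<^sup>2)"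
proof -
  let ?S = "sum_op C E x" and ?W = "sum_weight_op C m E x"
  have "\<kappa> * (norm x)\<^sup>2 \<le> inner ?S ?W"
  proof (rule inner_hsum_mono)
    fix \<eta>
    show "\<kappa> * (norm (hsum_nth x \<eta>))\<^sup>2 \<le> inner (hsum_nth ?S \<eta>) (hsum_nth ?W \<eta>)"
      using weight_lyapunov[OF \<kappa>] x
      by (auto simp: hsum_nth_sum_weight hsum_nth_sum_op[OF x] sum_op_dom_def hsum_on_def)
  qed
  then have "\<kappa> * (norm x)\<^sup>2 \<le> - Re (cinner (- ?S) ?W)"
    by (simp add: inner_eq_Re_cinner[symmetric])
  then show ?thesis
    by (subst cinner_commute[of ?W]) (simp add: less_eq_complex_def)
qed

lemma semigroup_exponentially_stable:
  assumes \<kappa>: "0 < \<kappa>" "\<And>\<eta>. \<eta> \<in> E \<Longrightarrow> coercive_generator (2 * K) \<kappa> m \<bar>\<eta>\<bar> (A \<eta>)"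
  shows "\<exists>M>0. \<exists>\<omega>>0. \<forall>t\<ge>0. opnorm_on (hsum_on E) (T t) \<le> M * exp (- \<omega> * t)"
proof -
  obtain M \<omega> where M: "0 < M" "0 < \<omega>" and decay: "\<And>h A y t. 1 \<le> h \<Longrightarrow> coercive_generator (2 * K) \<kappa> m h A \<Longrightarrow>
      solves A y \<Longrightarrow> 0 \<le> t \<Longrightarrow> (norm (y t))\<^sup>2 \<le> M * exp (- \<omega> * t) * (norm (y 0))\<^sup>2"
    using exponential_decay[of "2 * K" \<kappa> m] \<kappa>(1) K_pos by auto
  \<comment> \<open>The component estimates concern squared norms, so taking the root halves the
    rate.\<close>
  have "opnorm_on (hsum_on E) (T t) \<le> sqrt M * exp (- (\<omega> / 2) * t)" if t: "0 \<le> t" for t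
  proof (rule power2_le_imp_le)
    have "(opnorm_on (hsum_on E) (T t))\<^sup>2 \<le> M * exp (- \<omega> * t)"
      using M by (intro opnorm_le[OF t] decay[OF E_ge \<kappa>(2) _ t]) auto
    also have "\<dots> = (sqrt M * exp (- (\<omega> / 2) * t))\<^sup>2"
      using M by (simp add: power_mult_distrib flip: exp_double)
    finally show "(opnorm_on (hsum_on E) (T t))\<^sup>2 \<le> (sqrt M * exp (- (\<omega> / 2) * t))\<^sup>2" .
  qed (use M in simp)
  moreover have "0 < sqrt M" "0 < \<omega> / 2" using M by simp_all
  ultimately show ?thesis by blast
qed

lemma opnorm_upper:
  assumes \<kappa>: "0 < \<kappa>" "\<And>\<eta>. \<eta> \<in> E \<Longrightarrow> coercive_generator (2 * K) \<kappa> m \<bar>\<eta>\<bar> (A \<eta>)"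
  shows "\<exists>c>0. \<exists>\<tau>>0. \<forall>t. 0 \<le> t \<longrightarrow> t \<le> \<tau> \<longrightarrow> (opnorm_on (hsum_on E) (T t))\<^sup>2 \<le> 1 - c * t ^ (2 * m + 1)"
proof -
  obtain c \<tau> where c: "0 < c" "0 < \<tau>" "c * \<tau> ^ (2 * m + 1) \<le> 1"
    and decay: "\<And>h A y t. 1 \<le> h \<Longrightarrow> coercive_generator (2 * K) \<kappa> m h A \<Longrightarrow>
      solves A y \<Longrightarrow> 0 \<le> t \<Longrightarrow> t \<le> \<tau> \<Longrightarrow> (norm (y t))\<^sup>2 \<le> (1 - c * t ^ (2 * m + 1)) * (norm (y 0))\<^sup>2"
    using short_time_decay[of "2 * K" \<kappa> m] \<kappa>(1) K_pos by auto
  have "(opnorm_on (hsum_on E) (T t))\<^sup>2 \<le> 1 - c * t ^ (2 * m + 1)" if t: "0 \<le> t" "t \<le> \<tau>" for t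
  proof (rule opnorm_le[OF t(1)])
    \<comment> \<open>\<open>opnorm_le\<close> asks for a nonnegative factor; this is what
      \<open>c \<tau>^(2m+1) \<le> 1\<close> was recorded for.\<close>
    have "c * t ^ (2 * m + 1) \<le> c * \<tau> ^ (2 * m + 1)"
      using t c by (intro mult_left_mono power_mono) auto
    then show "0 \<le> 1 - c * t ^ (2 * m + 1)" using c by linarith
  qed (rule decay[OF E_ge \<kappa>(2) _ t])
  then show ?thesis using c by blast
qed

text \<open>One summand suffices, because the norm on the direct sum dominates it. The initial
  vector depends on the tolerance \<open>e\<close>, but \<open>c\<close> depends only on the chosen
  \<eta>, so \<open>e\<close> can tend to 0 at fixed \<open>t\<close>.\<close>

lemma opnorm_lower:
  assumes nonzero: "\<exists>x::'h. x \<noteq> 0" and least: "\<And>n. n < m \<Longrightarrow> \<not> hypocoercivity_condition C n"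
    and E: "E \<noteq> {}"
  shows "\<exists>c>0. \<forall>t. 0 \<le> t \<longrightarrow> t \<le> 1 \<longrightarrow> 1 - c * t ^ (2 * m + 1) \<le> (opnorm_on (hsum_on E) (T t))\<^sup>2"
proof -
  obtain \<eta> where \<eta>: "\<eta> \<in> E" using E by blast
  define L where "L = \<bar>\<eta>\<bar> * (2 * K)"
  have L: "0 < L" using K_pos E_ge[OF \<eta>] by (auto simp: L_def)
  define c where "c = 4 * K * L ^ (2 * m)"
  have "1 - c * t ^ (2 * m + 1) \<le> (opnorm_on (hsum_on E) (T t))\<^sup>2" if t: "0 \<le> t" "t \<le> 1" for t
  proof (rule field_le_epsilon)
    fix e :: real
    assume e: "0 < e"
    then obtain z where z: "norm z = 1" "(\<Sum>j<m. q ((A \<eta> ^^ j) z)) \<le> e / (4 * 2 ^ m)"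
      using almost_null_vector[OF nonzero least E_ge[OF \<eta>], of m "e / (4 * 2 ^ m)"] by auto
    define x where "x = hfamily {\<eta>} (\<lambda>_. z)"
    have sq: "square_summable_on (\<lambda>_. z) {\<eta>}" by (simp add: square_summable_on_def)
    have nth: "hsum_nth x i = (if i = \<eta> then z else 0)" for i
      by (simp add: x_def hsum_nth_hfamily[OF sq])
    have "(norm x)\<^sup>2 = 1" unfolding x_def norm_hfamily[OF sq] by (simp add: z(1))
    then have nx: "norm x = 1" by (simp add: power2_eq_1_iff) (smt (verit) norm_ge_zero)
    have xV: "x \<in> hsum_on E" using \<eta> by (auto simp: hsum_on_def nth)
    have xD: "x \<in> sum_op_dom C E"
      by (rule finite_support_in_dom[OF xV, of "{\<eta>}"]) (auto simp: nth)
    have T0: "T 0 x = x" using semigroup xV by (simp add: c0_semigroup_on_def)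
    have "1 - 4 * 2 ^ m * (e / (4 * 2 ^ m)) - 4 * K * L ^ (2 * m) * t ^ (2 * m + 1)
        \<le> (norm (hsum_nth (T t x) \<eta>))\<^sup>2"
      using z L norm_scaled_le[OF E_ge[OF \<eta>]] t
      by (intro slow_decay[OF dissipative_scaled _ _ component_solves[OF xD \<eta>]])
         (auto simp: T0 nth L_def)
    also have "\<dots> \<le> (opnorm_on (hsum_on E) (T t))\<^sup>2"
      using opnorm_ge[OF t(1) xV] norm_hsum_nth_le[of "T t x" \<eta>] nx by (intro power_mono) auto
    finally show "1 - c * t ^ (2 * m + 1) \<le> (opnorm_on (hsum_on E) (T t))\<^sup>2 + e"
      by (simp add: c_def)
  qed
  moreover have "0 < c" using K_pos L by (simp add: c_def)
  ultimately show ?thesis by blast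
qed

end

section \<open>Assembly of the estimates for the hypocoercivity index\<close>

theorem theorem1:
  fixes C :: "'h::chilbert_space \<Rightarrow> 'h"
    and E :: "real set"
    and T :: "real \<Rightarrow> (real, 'h) hsum \<Rightarrow> (real, 'h) hsum"
  assumes nonzero: "\<exists>x :: 'h. x \<noteq> 0"
    and hypo: "hypocoercive C"
    and E: "E \<subseteq> UNIV - {-1<..<1}" "E \<noteq> {}" "countable E"
    and T: "generates_on (hsum_on E) (sum_op_dom C E) (\<lambda>x. - sum_op C E x) T"
  shows
    "((\<forall>x\<in>hsum_on E. square_summable_on (\<lambda>\<eta>. weight_op C (hypocoercivity_index C) \<eta> (hsum_nth x \<eta>)) E) \<and>
      bounded_selfadjoint_on (hsum_on E) (sum_weight_op C (hypocoercivity_index C) E) \<and>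
      op_le_on (hsum_on E) (\<lambda>x. x) (sum_weight_op C (hypocoercivity_index C) E) \<and>
      (\<exists>\<sigma>>0. \<forall>x\<in>sum_op_dom C E.
        cinner (- sum_op C E x) (sum_weight_op C (hypocoercivity_index C) E x)
            + cinner (sum_weight_op C (hypocoercivity_index C) E x) (- sum_op C E x)
          \<le> complex_of_real (- \<sigma> * (norm x)\<^sup>2)) \<and>
      (\<exists>M>0. \<exists>\<omega>>0. \<forall>t\<ge>0. opnorm_on (hsum_on E) (T t) \<le> M * exp (- \<omega> * t))) \<and>
     (\<exists>c1>0. \<exists>c2>0. \<exists>\<tau>>0. \<forall>t. 0 \<le> t \<and> t \<le> \<tau> \<longrightarrow>
        1 - c1 * t ^ (2 * hypocoercivity_index C + 1) \<le> (opnorm_on (hsum_on E) (T t))\<^sup>2 \<and>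
        (opnorm_on (hsum_on E) (T t))\<^sup>2 \<le> 1 - c2 * t ^ (2 * hypocoercivity_index C + 1))"
proof -
  define m where "m = hypocoercivity_index C"
  have m: "hypocoercivity_condition C m" and least: "\<And>n. n < m \<Longrightarrow> \<not> hypocoercivity_condition C n"
    using hypo LeastI_ex[of "hypocoercivity_condition C"] not_less_Least
    by (auto simp: hypocoercive_def m_def hypocoercivity_index_def)
  have clin: "bounded_clinear_on UNIV C" and acc: "accretive C"
    using hypo by (auto simp: hypocoercive_def)
  obtain K where K: "0 < K" "\<And>x. norm (C x) \<le> norm x * K"
    using bounded_linear.pos_bounded[OF bounded_clinear_on_linear[OF clin]] by blast
  interpret direct_sum_semigroup C K E T
  proof unfold_locales
    fix \<eta> assume "\<eta> \<in> E"
    then show "1 \<le> \<bar>\<eta>\<bar>" using E(1) by (force simp: not_less abs_le_iff)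
  qed (use clin acc K T in \<open>simp_all add: mult.commute\<close>)
  obtain \<kappa> where \<kappa>: "0 < \<kappa>" "\<And>\<eta>. \<eta> \<in> E \<Longrightarrow> coercive_generator (2 * K) \<kappa> m \<bar>\<eta>\<bar> (A \<eta>)"
    using coercive_scaled[OF m] E_ge by blast
  obtain c2 \<tau> where up: "0 < c2" "0 < \<tau>"
    "\<And>t. 0 \<le> t \<Longrightarrow> t \<le> \<tau> \<Longrightarrow> (opnorm_on (hsum_on E) (T t))\<^sup>2 \<le> 1 - c2 * t ^ (2 * m + 1)"
    using opnorm_upper[OF \<kappa>] by blast
  obtain c1 where lo: "0 < c1"
    "\<And>t. 0 \<le> t \<Longrightarrow> t \<le> 1 \<Longrightarrow> 1 - c1 * t ^ (2 * m + 1) \<le> (opnorm_on (hsum_on E) (T t))\<^sup>2"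
    using opnorm_lower[OF nonzero least E(2)] by blast
  have "\<exists>\<sigma>>0. \<forall>x\<in>sum_op_dom C E. cinner (- sum_op C E x) (sum_weight_op C m E x)
      + cinner (sum_weight_op C m E x) (- sum_op C E x) \<le> complex_of_real (- \<sigma> * (norm x)\<^sup>2)"
    using sum_weight_lyapunov[OF \<kappa>(2)] \<kappa>(1) by (intro exI[of _ "2 * \<kappa>"]) simp
  moreover have "\<exists>c1>0. \<exists>c2>0. \<exists>\<tau>>0. \<forall>t. 0 \<le> t \<and> t \<le> \<tau> \<longrightarrow>
      1 - c1 * t ^ (2 * m + 1) \<le> (opnorm_on (hsum_on E) (T t))\<^sup>2 \<and>
      (opnorm_on (hsum_on E) (T t))\<^sup>2 \<le> 1 - c2 * t ^ (2 * m + 1)"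
  proof -
    \<comment> \<open>The lower bound was obtained on the unit interval and the upper one up to
      \<tau>.\<close>
    have "0 < min 1 \<tau>" using up(2) by simp
    moreover have "1 - c1 * t ^ (2 * m + 1) \<le> (opnorm_on (hsum_on E) (T t))\<^sup>2 \<and>
        (opnorm_on (hsum_on E) (T t))\<^sup>2 \<le> 1 - c2 * t ^ (2 * m + 1)" if "0 \<le> t \<and> t \<le> min 1 \<tau>" for t
      using up(3)[of t] lo(2)[of t] that by simp
    ultimately show ?thesis using up(1) lo(1) by blast
  qed
  ultimately show ?thesis
    unfolding m_def[symmetric]
    using square_summable_weight bounded_selfadjoint_sum_weight sum_weight_ge
      semigroup_exponentially_stable[OF \<kappa>] by blast
qed

end
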